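(* Let $k\ge1$ and, for each $n\ge1$, let $\alpha_n\in\mathrm{Hom}(\mathbf{F}_k,S_n)$ be a homomorphism chosen uniformly at random. Let $H\le\mathbf{F}_k$ be a finitely generated subgroup. Then, as $n\to\infty$, the average number of common fixed points of $\alpha_n(H)$ (i.e. the expected number of elements of $\{1,\ldots,n\}$ fixed by all elements of $\alpha_n(H)$) is $$\frac{1}{n^{\widetilde{\mathrm{rk}}(H)}}+\frac{|\mathrm{Crit}(H)|}{n^{\widetilde{\pi}(H)}}+O\left(\frac{1}{n^{\widetilde{\pi}(H)+1}}\right).$$ In particular, for a word $w\in\mathbf{F}_k$, $$\mathbb{E}[\#\mathrm{fix}(\alpha_n(w))]=1+\frac{|\mathrm{Crit}(w)|}{n^{\widetilde{\pi}(w)}}+O\left(\frac{1}{n^{\widetilde{\pi}(w)+1}}\right).$$ (When $\widetilde\pi=\infty$, the second and third terms are understood to be $0$.)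
   Context: $\mathbf{F}_k$ is the free group of rank $k$; $\mathrm{rk}(H)$ is the rank of a free group $H$ and $\widetilde{\mathrm{rk}}(H)=\mathrm{rk}(H)-1$ is its reduced rank. A subgroup $H$ of a free group $J$ is a free factor of $J$ if $J=H*H'$ for some $H'\le J$; an element of $J$ is primitive in $J$ if it belongs to some basis of $J$. The primitivity rank of a finitely generated $H\le\mathbf{F}_k$ is $$\pi(H)=\min\{\mathrm{rk}(J)\;:\;H\le J\le\mathbf{F}_k,\ H\text{ is not a free factor of }J\},$$ with $\pi(H)=\infty$ if no such $J$ exists. $\mathrm{Crit}(H)$ is the (finite) set of $H$-critical subgroups, i.e. the subgroups $J$ for which this minimum is attained. Similarly for $w\in\mathbf{F}_k$, $\pi(w)=\min\{\mathrm{rk}(J): w\in J\le\mathbf{F}_k,\ w\text{ is not primitive in }J\}$ ($\infty$ if no such $J$ exists), and $\mathrm{Crit}(w)$ is the set of $J$ attaining the minimum. Put $\widetilde{\pi}(\cdot)=\pi(\cdot)-1$. $\#\mathrm{fix}(\sigma)$ is the number of fixed points of $\sigma\in S_n$. The implied constants may depend on $H$ (resp. $w$). *)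

theory Defs
  imports "HOL-Algebra.Sym_Groups" "HOL-Algebra.Generated_Groups"
    "HOL-Probability.Probability_Mass_Function" "HOL-Library.Landau_Symbols"
    "HOL-Library.Extended_Nat"
begin

definition list_product :: "('a, 'b) monoid_scheme \<Rightarrow> 'a list \<Rightarrow> 'a" where
  "list_product G xs = foldr (\<lambda>x y. x \<otimes>\<^bsub>G\<^esub> y) xs \<one>\<^bsub>G\<^esub>"

text \<open>Words are lists of signed letters: \<open>(x, True)\<close> stands for \<open>x\<close> and \<open>(x, False)\<close> for its
  formal inverse.\<close>

definition letter_value :: "('a, 'b) monoid_scheme \<Rightarrow> 'a \<times> bool \<Rightarrow> 'a" where
  "letter_value G l = (if snd l then fst l else inv\<^bsub>G\<^esub> (fst l))"

definition reduced_word :: "('a \<times> bool) list \<Rightarrow> bool" where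
  "reduced_word ls \<longleftrightarrow> successively (\<lambda>l m. \<not> (fst l = fst m \<and> snd l \<noteq> snd m)) ls"

definition free_basis :: "('a, 'b) monoid_scheme \<Rightarrow> 'a set \<Rightarrow> 'a set \<Rightarrow> bool" where
  "free_basis G J B \<longleftrightarrow>
     B \<subseteq> carrier G \<and> generate G B = J \<and>
     (\<forall>ls. ls \<noteq> [] \<and> reduced_word ls \<and> fst ` set ls \<subseteq> B \<longrightarrow>
           list_product G (map (letter_value G) ls) \<noteq> \<one>\<^bsub>G\<^esub>)"

definition free_group_of_rank :: "('a, 'b) monoid_scheme \<Rightarrow> nat \<Rightarrow> bool" where
  "free_group_of_rank F k \<longleftrightarrow>
     group F \<and> (\<exists>X. free_basis F (carrier F) X \<and> finite X \<and> card X = k)"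

text \<open>All bases of a free group are equinumerous, so the choice below is immaterial. (Every
  subgroup of a free group has a basis; other subgroups get an unspecified rank.)\<close>

definition rk :: "('a, 'b) monoid_scheme \<Rightarrow> 'a set \<Rightarrow> enat" where
  "rk G J = (let B = (SOME B. free_basis G J B) in if finite B then enat (card B) else \<infinity>)"

text \<open>Only meaningful for subgroups of finite rank. The value is \<open>-1\<close> for the trivial subgroup.\<close>

definition reduced_rk :: "('a, 'b) monoid_scheme \<Rightarrow> 'a set \<Rightarrow> int" where
  "reduced_rk G J = int (the_enat (rk G J)) - 1"

definition finitely_generated :: "('a, 'b) monoid_scheme \<Rightarrow> 'a set \<Rightarrow> bool" where
  "finitely_generated G H \<longleftrightarrow> (\<exists>S. finite S \<and> S \<subseteq> carrier G \<and> H = generate G S)"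

text \<open>Internal free product, \<open>J = H * K\<close>: no nonempty product of nontrivial factors taken
  alternately from \<open>H\<close> and \<open>K\<close> is trivial. In particular \<open>H\<close> and \<open>K\<close> meet trivially, because an
  \<open>x\<close> in both makes \<open>[x, inv x]\<close> alternating.\<close>

definition free_product_of ::
    "('a, 'b) monoid_scheme \<Rightarrow> 'a set \<Rightarrow> 'a set \<Rightarrow> 'a set \<Rightarrow> bool" where
  "free_product_of G J H K \<longleftrightarrow>
     subgroup H G \<and> subgroup K G \<and> generate G (H \<union> K) = J \<and>
     (\<forall>xs. xs \<noteq> [] \<and> set xs \<subseteq> (H \<union> K) - {\<one>\<^bsub>G\<^esub>} \<and>
           successively (\<lambda>x y. x \<in> H \<and> y \<in> K \<or> x \<in> K \<and> y \<in> H) xs \<longrightarrow>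
           list_product G xs \<noteq> \<one>\<^bsub>G\<^esub>)"

definition free_factor :: "('a, 'b) monoid_scheme \<Rightarrow> 'a set \<Rightarrow> 'a set \<Rightarrow> bool" where
  "free_factor G H J \<longleftrightarrow> (\<exists>K. free_product_of G J H K)"

definition primitive_in :: "('a, 'b) monoid_scheme \<Rightarrow> 'a \<Rightarrow> 'a set \<Rightarrow> bool" where
  "primitive_in G w J \<longleftrightarrow> (\<exists>B. free_basis G J B \<and> w \<in> B)"

text \<open>In \<^typ>\<open>enat\<close> the infimum of a nonempty set is attained and that of the empty set is \<open>\<infinity>\<close>.\<close>

definition nonfactor_overgroups :: "('a, 'b) monoid_scheme \<Rightarrow> 'a set \<Rightarrow> 'a set set" where
  "nonfactor_overgroups F H = {J. subgroup J F \<and> H \<subseteq> J \<and> \<not> free_factor F H J}"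

definition primitivity_rank :: "('a, 'b) monoid_scheme \<Rightarrow> 'a set \<Rightarrow> enat" where
  "primitivity_rank F H = (INF J\<in>nonfactor_overgroups F H. rk F J)"

definition Crit :: "('a, 'b) monoid_scheme \<Rightarrow> 'a set \<Rightarrow> 'a set set" where
  "Crit F H = {J \<in> nonfactor_overgroups F H. rk F J = primitivity_rank F H}"

definition imprimitive_overgroups :: "('a, 'b) monoid_scheme \<Rightarrow> 'a \<Rightarrow> 'a set set" where
  "imprimitive_overgroups F w = {J. subgroup J F \<and> w \<in> J \<and> \<not> primitive_in F w J}"

definition word_primitivity_rank :: "('a, 'b) monoid_scheme \<Rightarrow> 'a \<Rightarrow> enat" where
  "word_primitivity_rank F w = (INF J\<in>imprimitive_overgroups F w. rk F J)"

definition word_Crit :: "('a, 'b) monoid_scheme \<Rightarrow> 'a \<Rightarrow> 'a set set" where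
  "word_Crit F w = {J \<in> imprimitive_overgroups F w. rk F J = word_primitivity_rank F w}"

text \<open>\<^const>\<open>hom\<close> leaves a map unconstrained off the carrier; \<^const>\<open>extensional\<close> makes each
  homomorphism occur exactly once, so that the set is finite when \<open>F\<close> is finitely generated.\<close>

definition random_hom :: "('a, 'b) monoid_scheme \<Rightarrow> nat \<Rightarrow> ('a \<Rightarrow> nat \<Rightarrow> nat) pmf" where
  "random_hom F n = pmf_of_set (hom F (sym_group n) \<inter> extensional (carrier F))"

definition num_fix :: "nat \<Rightarrow> (nat \<Rightarrow> nat) \<Rightarrow> nat" where
  "num_fix n \<sigma> = card {i \<in> {1..n}. \<sigma> i = i}"

definition num_common_fix :: "nat \<Rightarrow> (nat \<Rightarrow> nat) set \<Rightarrow> nat" where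
  "num_common_fix n P = card {i \<in> {1..n}. \<forall>\<sigma>\<in>P. \<sigma> i = i}"

definition expected_common_fix :: "('a, 'b) monoid_scheme \<Rightarrow> 'a set \<Rightarrow> nat \<Rightarrow> real" where
  "expected_common_fix F H n =
     measure_pmf.expectation (random_hom F n) (\<lambda>\<alpha>. real (num_common_fix n (\<alpha> ` H)))"

definition expected_fix :: "('a, 'b) monoid_scheme \<Rightarrow> 'a \<Rightarrow> nat \<Rightarrow> real" where
  "expected_fix F w n =
     measure_pmf.expectation (random_hom F n) (\<lambda>\<alpha>. real (num_fix n (\<alpha> w)))"

end

theory Submission imports Defs begin

text \<open>Let \<open>H\<close> be a finitely generated subgroup of the free group \<open>F\<close>. By symmetry the expectation is \<open>n\<close> times
  the probability that \<open>H\<close> fixes the point \<open>1\<close>. More generally, for subgroups \<open>H \<subseteq> N\<close> consider the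
  probability \<open>P(N)\<close> that \<open>H\<close> fixes \<open>1\<close> under a uniformly random homomorphism from \<open>N\<close> to the symmetric group.
  Everything rests on a decomposition \<open>P(N) = (\<Sum>J. C J)\<close>, the sum being over a finite family of
  subgroups \<open>J\<close> with \<open>H \<subseteq> J \<subseteq> N\<close>, in which \<open>C J\<close> is a function of \<open>n\<close> of order \<open>n ^ - rk J\<close> that does not
  depend on \<open>N\<close> (\<open>fix_prob_expansion\<close>).

  To find it, fix a finite connected piece \<open>W\<close> of the Cayley tree that contains the generators of \<open>H\<close> and
  the letters. A subgroup \<open>N\<close> folds \<open>W\<close> to a finite graph, and for the groups \<open>N\<close> that are the fundamental
  group of this graph a random homomorphism amounts to a random covering, that is, to an independent
  uniform permutation for each edge (\<open>connections_bij\<close>). The sheet \<open>1\<close> over the base point lies in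
  a component, whose fundamental group, as far as \<open>W\<close> can see, is a subgroup \<open>M\<close>, and \<open>H\<close> fixes \<open>1\<close> precisely
  if \<open>H \<subseteq> M\<close>. The probability of a given \<open>M\<close> is \<open>n ^ - rk M\<close> times a product of factors \<open>1 - s / n\<close> and of
  inverses of such factors, where \<open>s\<close> counts pairs of vertices or of edges of \<open>M\<close> that coincide in \<open>N\<close>
  (\<open>card_shape\<close>). Each coincidence is the condition \<open>J \<subseteq> N\<close> for a group \<open>J\<close> generated by \<open>M\<close> and one further
  element. Multiplying out, one gets a sum over groups \<open>J \<subseteq> N\<close> with coefficients of order \<open>n ^ - (rk M + d)\<close>,
  where \<open>J\<close> is generated by \<open>M\<close> and \<open>d\<close> elements (\<open>shape_expansion\<close>). As \<open>rk J \<le> rk M + d\<close>, this is the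
  decomposition.

  Now \<open>C J\<close> can be computed where it matters. If \<open>H\<close> is a free factor of \<open>N\<close>, then \<open>P(N)\<close> is exactly
  \<open>n ^ - rk H\<close>, and \<open>H\<close> is also a free factor of every \<open>J\<close> between \<open>H\<close> and \<open>N\<close>; by induction \<open>C H\<close> is \<open>n ^ - rk H\<close> and
  the other \<open>C J\<close> vanish. If \<open>J\<close> is critical, the term with \<open>M = J\<close> contributes \<open>n ^ - rk J\<close>. A term with
  smaller \<open>M\<close> is of lower order: \<open>rk J = rk M + d\<close> would make \<open>M\<close> a free factor of \<open>J\<close>, because free groups of
  finite rank are Hopfian, and then \<open>H\<close> would not be a free factor of \<open>M\<close>, against the minimality of \<open>rk J\<close>.
  All other subgroups \<open>J\<close> have larger rank (\<open>fix_prob_asymptotics\<close>).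

  The facts on free groups are obtained from homomorphisms to symmetric groups, which detect reduced
  words and whose number determines the rank. The theorem of Nielsen and Schreier is proved in the form
  that the part of a subgroup supported in a connected piece of the Cayley tree is a free factor of it
  (\<open>nielsen_schreier\<close>). This gives the inheritance of free factors by intermediate groups, and it
  shows that critical subgroups belong to the finite family. A word \<open>w \<noteq> \<one>\<close> is primitive in \<open>J\<close> if and only if
  the cyclic group that it generates is a free factor of \<open>J\<close>, so the second statement follows from the first.\<close>

section \<open>Words in a free group\<close>

abbreviation word_value :: "('a, 'b) monoid_scheme \<Rightarrow> ('a \<times> bool) list \<Rightarrow> 'a" where
  "word_value G ls \<equiv> list_product G (map (letter_value G) ls)"

definition inverse_word :: "('a \<times> bool) list \<Rightarrow> ('a \<times> bool) list" where
  "inverse_word ls = rev (map (\<lambda>l. (fst l, \<not> snd l)) ls)"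

lemma list_product_simps [simp]:
  "list_product G [] = \<one>\<^bsub>G\<^esub>"
  "list_product G (x # xs) = x \<otimes>\<^bsub>G\<^esub> list_product G xs"
  by (simp_all add: list_product_def)

lemma reduced_word_Nil [simp]: "reduced_word []"
  by (simp add: reduced_word_def)

lemma reduced_word_ConsD: "reduced_word (l # ls) \<Longrightarrow> reduced_word ls"
  by (cases ls) (auto simp: reduced_word_def)

lemma reduced_word_inverse_word [simp]: "reduced_word (inverse_word ls) \<longleftrightarrow> reduced_word ls"
  unfolding reduced_word_def inverse_word_def successively_rev successively_map
  by (rule successively_cong) auto

lemma set_inverse_word [simp]: "fst ` set (inverse_word ls) = fst ` set ls"
  by (auto simp: inverse_word_def image_image)

lemma inverse_word_eq_Nil_iff [simp]: "inverse_word ls = [] \<longleftrightarrow> ls = []"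
  by (simp add: inverse_word_def)

lemma free_basis_word_neq_one:
  "free_basis G J B \<Longrightarrow> ls \<noteq> [] \<Longrightarrow> reduced_word ls \<Longrightarrow> fst ` set ls \<subseteq> B \<Longrightarrow>
   word_value G ls \<noteq> \<one>\<^bsub>G\<^esub>"
  unfolding free_basis_def by (elim conjE allE[of _ ls]) simp

context group
begin

lemma list_product_closed [simp, intro]:
  "set xs \<subseteq> carrier G \<Longrightarrow> list_product G xs \<in> carrier G"
  by (induction xs) auto

lemma list_product_append:
  "set xs \<subseteq> carrier G \<Longrightarrow> set ys \<subseteq> carrier G \<Longrightarrow>
   list_product G (xs @ ys) = list_product G xs \<otimes> list_product G ys"
  by (induction xs) (auto simp: m_assoc)

lemma letter_value_closed: "fst l \<in> carrier G \<Longrightarrow> letter_value G l \<in> carrier G"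
  by (simp add: letter_value_def)

lemma word_value_closed [intro]:
  "fst ` set ls \<subseteq> carrier G \<Longrightarrow> word_value G ls \<in> carrier G"
  by (rule list_product_closed) (auto simp: letter_value_def)

lemma word_value_append:
  "fst ` set ls \<subseteq> carrier G \<Longrightarrow> fst ` set ms \<subseteq> carrier G \<Longrightarrow>
   word_value G (ls @ ms) = word_value G ls \<otimes> word_value G ms"
  unfolding map_append by (rule list_product_append) (auto simp: letter_value_def)

lemma word_value_inverse_word:
  "fst ` set ls \<subseteq> carrier G \<Longrightarrow> word_value G (inverse_word ls) = inv (word_value G ls)"
proof (induction ls)
  case (Cons l ls)
  have "inverse_word (l # ls) = inverse_word ls @ [(fst l, \<not> snd l)]"
    by (simp add: inverse_word_def)
  moreover have "word_value G [(fst l, \<not> snd l)] = inv (letter_value G l)"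
    using Cons.prems by (auto simp: letter_value_def)
  moreover have "word_value G ls \<in> carrier G" "letter_value G l \<in> carrier G"
    using Cons.prems by (auto intro!: word_value_closed letter_value_closed)
  ultimately show ?case
    using Cons by (simp add: word_value_append inv_mult_group del: map_append)
qed (simp add: inverse_word_def)

lemma word_value_in_generate:
  assumes "B \<subseteq> carrier G"
  shows "fst ` set ls \<subseteq> B \<Longrightarrow> word_value G ls \<in> generate G B"
proof (induction ls)
  case (Cons l ls)
  then have "letter_value G l \<in> generate G B"
    by (auto simp: letter_value_def intro: generate.incl generate.inv)
  with Cons show ?case by (auto intro: generate.eng)
qed (auto intro: generate.one)

lemma generate_word:
  assumes "B \<subseteq> carrier G" "u \<in> generate G B"
  shows "\<exists>ls. fst ` set ls \<subseteq> B \<and> word_value G ls = u"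
  using assms(2)
proof induction
  case one
  show ?case by (intro exI[of _ "[]"]) simp
next
  case (incl h)
  then show ?case using assms(1) by (intro exI[of _ "[(h, True)]"]) (auto simp: letter_value_def)
next
  case (inv h)
  then show ?case using assms(1) by (intro exI[of _ "[(h, False)]"]) (auto simp: letter_value_def)
next
  case (eng h1 h2)
  then obtain ls ms where "fst ` set ls \<subseteq> B" "word_value G ls = h1"
    "fst ` set ms \<subseteq> B" "word_value G ms = h2" by blast
  then show ?case
    using assms(1) by (intro exI[of _ "ls @ ms"]) (auto simp: word_value_append image_Un simp del: map_append)
qed

lemma exists_reduced_word:
  assumes "B \<subseteq> carrier G"
  shows "fst ` set ls \<subseteq> B \<Longrightarrow>
    \<exists>rs. reduced_word rs \<and> fst ` set rs \<subseteq> B \<and> word_value G rs = word_value G ls"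
proof (induction ls)
  case (Cons l ls)
  then obtain rs where rs: "reduced_word rs" "fst ` set rs \<subseteq> B" "word_value G rs = word_value G ls"
    by auto
  have l: "fst l \<in> carrier G" and lB: "fst l \<in> B" using Cons.prems assms by auto
  show ?case
  proof (cases "reduced_word (l # rs)")
    case True
    then show ?thesis using rs lB by (intro exI[of _ "l # rs"]) auto
  next
    case False
    then obtain m ms where m: "rs = m # ms" "fst l = fst m" "snd l \<noteq> snd m"
      using rs(1) by (cases rs) (auto simp: reduced_word_def)
    have c: "word_value G ms \<in> carrier G" using rs m assms by (auto intro!: word_value_closed)
    have "word_value G (l # ls) = letter_value G l \<otimes> (letter_value G m \<otimes> word_value G ms)"
      using rs(3) m by simp
    also have "\<dots> = word_value G ms"
      using m l c by (cases "snd l") (auto simp: letter_value_def m_assoc[symmetric])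
    finally show ?thesis using rs m reduced_word_ConsD[of m ms] by (intro exI[of _ ms]) auto
  qed
qed (auto intro!: exI[of _ "[]"])

lemma generate_reduced_word:
  assumes "B \<subseteq> carrier G" "u \<in> generate G B"
  shows "\<exists>ls. reduced_word ls \<and> fst ` set ls \<subseteq> B \<and> word_value G ls = u"
proof -
  obtain ls where ls: "fst ` set ls \<subseteq> B" "word_value G ls = u"
    using generate_word[OF assms] by (elim exE conjE) (rule that)
  obtain rs where "reduced_word rs" "fst ` set rs \<subseteq> B" "word_value G rs = word_value G ls"
    using exists_reduced_word[OF assms(1) ls(1)] by (elim exE conjE) (rule that)
  then show ?thesis using ls(2) by (intro exI[of _ rs]) simp
qed

text \<open>Two different reduced words with the same value, stripped of their common prefix, would combine to
  a nonempty reduced word with trivial value.\<close>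

lemma reduced_word_unique:
  assumes basis: "free_basis G J B"
  shows "reduced_word ls \<Longrightarrow> reduced_word ms \<Longrightarrow> fst ` set ls \<subseteq> B \<Longrightarrow> fst ` set ms \<subseteq> B \<Longrightarrow>
    word_value G ls = word_value G ms \<Longrightarrow> ls = ms"
proof (induction ls arbitrary: ms)
  case Nil
  then have "word_value G ms = \<one>" by simp
  then show ?case using free_basis_word_neq_one[OF basis, of ms] Nil.prems(2,4) by blast
next
  case (Cons l ls)
  have B: "B \<subseteq> carrier G" using basis by (simp add: free_basis_def)
  show ?case
  proof (cases ms)
    case Nil
    then have "word_value G (l # ls) = \<one>" using Cons.prems(5) by simp
    then show ?thesis using free_basis_word_neq_one[OF basis, of "l # ls"] Cons.prems(1,3) by blast
  next
    case (Cons m ms')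
    have cl: "word_value G ls \<in> carrier G" "word_value G ms' \<in> carrier G"
      "letter_value G l \<in> carrier G"
      using Cons.prems Cons B by (auto intro!: word_value_closed letter_value_closed)
    show ?thesis
    proof (cases "l = m")
      case True
      then have "word_value G ls = word_value G ms'" using Cons.prems(5) Cons cl by simp
      then show ?thesis using Cons.IH[of ms'] Cons.prems Cons True
          reduced_word_ConsD[of l ls] reduced_word_ConsD[of m ms'] by auto
    next
      case False
      let ?ws = "inverse_word (l # ls) @ ms"
      have "reduced_word (inverse_word (l # ls))" using Cons.prems by simp
      then have "reduced_word ?ws"
        using Cons.prems(2) False Cons
        unfolding reduced_word_def successively_append_iff
        by (auto simp: inverse_word_def prod_eq_iff)
      moreover have "fst ` set ?ws \<subseteq> B"
        unfolding set_append image_Un set_inverse_word using Cons.prems by auto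
      moreover have "?ws \<noteq> []" by simp
      moreover have "word_value G ?ws = inv (word_value G (l # ls)) \<otimes> word_value G ms"
      proof -
        have c: "fst ` set (l # ls) \<subseteq> carrier G" "fst ` set ms \<subseteq> carrier G"
          using Cons.prems(3,4) B by blast+
        then have c': "fst ` set (inverse_word (l # ls)) \<subseteq> carrier G"
          unfolding set_inverse_word by blast
        show ?thesis
          using word_value_append[OF c' c(2)] word_value_inverse_word[OF c(1)] by (simp only:)
      qed
      moreover have "\<dots> = \<one>"
      proof -
        have "word_value G ms \<in> carrier G" using Cons.prems(4) B by (auto intro!: word_value_closed)
        then show ?thesis using Cons.prems(5) by simp
      qed
      ultimately show ?thesis using free_basis_word_neq_one[OF basis, of ?ws] by simp
    qed
  qed
qed

text \<open>The Cayley graph of a group with respect to a generating set is connected: a property that passes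
  along its edges in both directions holds everywhere as soon as it holds at \<open>\<one>\<close>.\<close>

lemma generate_induct_iff [consumes 2, case_names one step]:
  assumes "u \<in> generate G B" "B \<subseteq> carrier G" and one: "P \<one>"
    and step: "\<And>x u. x \<in> B \<Longrightarrow> u \<in> generate G B \<Longrightarrow> P u \<longleftrightarrow> P (x \<otimes> u)"
  shows "P u"
proof -
  have "fst ` set ls \<subseteq> B \<Longrightarrow> P (word_value G ls)" for ls
  proof (induction ls)
    case (Cons l ls)
    let ?v = "word_value G ls"
    have v: "?v \<in> generate G B" and l: "fst l \<in> B"
      using Cons.prems word_value_in_generate[OF assms(2)] by auto
    then have c: "fst l \<in> carrier G" "?v \<in> carrier G"
      using assms(2) generate_in_carrier by auto
    show ?case
    proof (cases "snd l")
      case True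
      then have "letter_value G l = fst l" by (simp add: letter_value_def)
      then show ?thesis using step[OF l v] Cons by simp
    next
      case False
      have "inv (fst l) \<otimes> ?v \<in> generate G B" using l v by (auto intro: generate.eng generate.inv)
      moreover have "letter_value G l = inv (fst l)" using False by (simp add: letter_value_def)
      moreover have "fst l \<otimes> (inv (fst l) \<otimes> ?v) = ?v" using c by (simp add: m_assoc[symmetric])
      ultimately show ?thesis using step[OF l, of "inv (fst l) \<otimes> ?v"] Cons by simp
    qed
  qed (simp add: one)
  then show ?thesis using generate_word[OF assms(2,1)] by auto
qed

lemma generate_coset_step:
  assumes "subgroup J G" "x \<in> J" "u \<in> carrier G"
  shows "x \<otimes> u \<in> J \<longleftrightarrow> u \<in> J"
proof
  assume "x \<otimes> u \<in> J"
  then have "inv x \<otimes> (x \<otimes> u) \<in> J" using assms by (auto intro: subgroup.m_closed subgroup.m_inv_closed)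
  then show "u \<in> J" using assms subgroup.mem_carrier[OF assms(1)] by (simp add: m_assoc[symmetric])
qed (use assms in \<open>auto intro: subgroup.m_closed\<close>)

text \<open>The Cayley graph of a free group is a tree, so a function on it is freely determined by
  its value at one vertex and its increments along the edges. With a constant increment for each
  letter the function is a homomorphism.\<close>

lemma free_basis_cocycle:
  fixes A :: "('c, 'd) monoid_scheme"
  assumes basis: "free_basis G J B" and A: "group A"
    and c: "\<And>x u. x \<in> B \<Longrightarrow> u \<in> J \<Longrightarrow> c x u \<in> carrier A"
  shows "\<exists>h. h \<one> = \<one>\<^bsub>A\<^esub> \<and> (\<forall>u\<in>J. h u \<in> carrier A) \<and>
    (\<forall>x\<in>B. \<forall>u\<in>J. h (x \<otimes> u) = c x u \<otimes>\<^bsub>A\<^esub> h u)"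
proof -
  interpret A: group A by (rule A)
  have B: "B \<subseteq> carrier G" and J: "generate G B = J" using basis by (auto simp: free_basis_def)
  then have sub: "subgroup J G" using generate_is_subgroup by auto
  have BJ: "B \<subseteq> J" using J by (auto intro: generate.incl)
  define nf where "nf u = (SOME ls. reduced_word ls \<and> fst ` set ls \<subseteq> B \<and> word_value G ls = u)" for u
  have nf: "reduced_word (nf u)" "fst ` set (nf u) \<subseteq> B" "word_value G (nf u) = u" if "u \<in> J" for u
    using someI_ex[OF generate_reduced_word[OF B, of u]] that J by (auto simp: nf_def)
  have nf_eq: "nf (word_value G ls) = ls" if "reduced_word ls" "fst ` set ls \<subseteq> B" for ls
  proof -
    have "word_value G ls \<in> J" using word_value_in_generate[OF B that(2)] J by simp
    from nf[OF this] show ?thesis using reduced_word_unique[OF basis _ that(1) _ that(2)] by blast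
  qed
  define step where "step l v = (if snd l then c (fst l) v
     else inv\<^bsub>A\<^esub> (c (fst l) (inv (fst l) \<otimes> v)))" for l v
  define hw where "hw = rec_list \<one>\<^bsub>A\<^esub> (\<lambda>l ls r. step l (word_value G ls) \<otimes>\<^bsub>A\<^esub> r)"
  have hw [simp]: "hw [] = \<one>\<^bsub>A\<^esub>" "hw (l # ls) = step l (word_value G ls) \<otimes>\<^bsub>A\<^esub> hw ls" for l ls
    by (simp_all add: hw_def)
  have closed: "step l v \<in> carrier A" if "fst l \<in> B" "v \<in> J" for l v
    using that c BJ sub unfolding step_def
    by (auto intro!: c subgroup.m_closed[OF sub] subgroup.m_inv_closed[OF sub] A.inv_closed)
  have hw_closed: "fst ` set ls \<subseteq> B \<Longrightarrow> hw ls \<in> carrier A" for ls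
    by (induction ls) (use word_value_in_generate[OF B] J closed in auto)
  have main: "hw (nf (x \<otimes> u)) = c x u \<otimes>\<^bsub>A\<^esub> hw (nf u)" if x: "x \<in> B" and u: "u \<in> J" for x u
  proof -
    have cc: "x \<in> carrier G" "u \<in> carrier G" using x u B subgroup.mem_carrier[OF sub] by auto
    show ?thesis
    proof (cases "reduced_word ((x, True) # nf u)")
      case True
      have "word_value G ((x, True) # nf u) = x \<otimes> u" using nf(3)[OF u] by (simp add: letter_value_def)
      then have "nf (x \<otimes> u) = (x, True) # nf u" using nf_eq[OF True] x nf(2)[OF u] by auto
      then show ?thesis using nf[OF u] by (simp add: step_def)
    next
      case False
      then obtain ms where ms: "nf u = (x, False) # ms"
        using nf(1)[OF u] by (cases "nf u") (auto simp: reduced_word_def)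
      have msB: "fst ` set ms \<subseteq> B" "reduced_word ms"
        using nf[OF u] ms reduced_word_ConsD by auto
      have wm: "word_value G ms \<in> J" using word_value_in_generate[OF B msB(1)] J by simp
      then have wmc: "word_value G ms \<in> carrier G" using subgroup.mem_carrier[OF sub] by auto
      have u': "u = inv x \<otimes> word_value G ms" using nf(3)[OF u] ms by (simp add: letter_value_def)
      then have "x \<otimes> u = word_value G ms" using cc wmc by (simp add: m_assoc[symmetric])
      then have "nf (x \<otimes> u) = ms" using nf_eq[OF msB(2,1)] by simp
      moreover have "hw (nf u) = inv\<^bsub>A\<^esub> (c x u) \<otimes>\<^bsub>A\<^esub> hw ms"
        using ms u' by (simp add: step_def)
      ultimately show ?thesis using c[OF x u] hw_closed[OF msB(1)]
        by (simp add: A.m_assoc[symmetric])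
    qed
  qed
  have "nf \<one> = []" using nf_eq[of "[]"] by simp
  then show ?thesis
    using main hw_closed nf(2) by (intro exI[of _ "\<lambda>u. hw (nf u)"]) auto
qed

end

section \<open>Homomorphisms to symmetric groups\<close>

definition perm_homs ::
    "('a, 'b) monoid_scheme \<Rightarrow> 'a set \<Rightarrow> nat \<Rightarrow> ('a \<Rightarrow> nat \<Rightarrow> nat) set" where
  "perm_homs G J n = hom (G\<lparr>carrier := J\<rparr>) (sym_group n) \<inter> extensional J"

abbreviation perms :: "nat \<Rightarrow> (nat \<Rightarrow> nat) set" where
  "perms n \<equiv> carrier (sym_group n)"

lemma finite_perms [simp]: "finite (perms n)"
  unfolding sym_group_def by (simp add: finite_permutations)

lemma card_perms [simp]: "card (perms n) = fact n"
  unfolding sym_group_def by (simp add: card_permutations)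

lemma id_perms [simp]: "id \<in> perms n"
  by (simp add: sym_group_carrier permutes_id)

lemma comp_perms: "p \<in> perms n \<Longrightarrow> q \<in> perms n \<Longrightarrow> p \<circ> q \<in> perms n"
  by (simp add: sym_group_carrier permutes_compose)

lemma perms_inj: "p \<in> perms n \<Longrightarrow> inj p"
  by (simp add: sym_group_carrier permutes_inj)

lemma perm_homs_iff:
  "\<phi> \<in> perm_homs G J n \<longleftrightarrow> \<phi> \<in> extensional J \<and> (\<forall>u\<in>J. \<phi> u \<in> perms n) \<and>
     (\<forall>u\<in>J. \<forall>v\<in>J. \<phi> (u \<otimes>\<^bsub>G\<^esub> v) = \<phi> u \<circ> \<phi> v)"
  by (auto simp: perm_homs_def hom_def sym_group_mult)

lemma perm_homs_mult:
  "\<phi> \<in> perm_homs G J n \<Longrightarrow> u \<in> J \<Longrightarrow> v \<in> J \<Longrightarrow> \<phi> (u \<otimes>\<^bsub>G\<^esub> v) = \<phi> u \<circ> \<phi> v"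
  by (simp add: perm_homs_iff)

lemma perm_homs_perms: "\<phi> \<in> perm_homs G J n \<Longrightarrow> u \<in> J \<Longrightarrow> \<phi> u \<in> perms n"
  by (simp add: perm_homs_iff)

context group
begin

lemma perm_homs_one:
  assumes "\<phi> \<in> perm_homs G J n" "subgroup J G"
  shows "\<phi> \<one> = id"
proof -
  have 1: "\<one> \<in> J" using assms(2) by (rule subgroup.one_closed)
  then have "\<phi> \<one> \<circ> \<phi> \<one> = \<phi> \<one> \<circ> id" using perm_homs_mult[OF assms(1) 1 1] by simp
  then show ?thesis
    using perms_inj[OF perm_homs_perms[OF assms(1) 1]] by (auto simp: fun_eq_iff inj_eq)
qed

lemma perm_homs_eq:
  assumes "\<phi> \<in> perm_homs G J n" "\<psi> \<in> perm_homs G J n" "generate G B = J" "B \<subseteq> carrier G"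
    and eq: "\<And>b. b \<in> B \<Longrightarrow> \<phi> b = \<psi> b"
  shows "\<phi> = \<psi>"
proof (rule extensionalityI)
  show "\<phi> \<in> extensional J" "\<psi> \<in> extensional J" using assms by (auto simp: perm_homs_iff)
  have sub: "subgroup J G" using assms generate_is_subgroup by auto
  fix u assume "u \<in> J"
  then have "u \<in> generate G B" using assms by simp
  then show "\<phi> u = \<psi> u" using assms(4)
  proof (induction rule: generate_induct_iff)
    case one
    show ?case using perm_homs_one[OF assms(1) sub] perm_homs_one[OF assms(2) sub] by simp
  next
    case (step x u)
    then have x: "x \<in> J" "u \<in> J" using assms(3) generate.incl by auto
    have "inj (\<psi> x)" using perm_homs_perms[OF assms(2) x(1)] perms_inj by blast
    then show ?case
      using perm_homs_mult[OF assms(1) x] perm_homs_mult[OF assms(2) x] eq[OF step(1)]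
      by (auto simp: fun_eq_iff inj_eq)
  qed
qed

lemma perm_homs_restrict_inj:
  assumes "generate G S = J" "S \<subseteq> carrier G"
  shows "inj_on (\<lambda>\<phi>. restrict \<phi> S) (perm_homs G J n)"
proof (rule inj_onI)
  fix \<phi> \<psi> assume *: "\<phi> \<in> perm_homs G J n" "\<psi> \<in> perm_homs G J n" "restrict \<phi> S = restrict \<psi> S"
  show "\<phi> = \<psi>"
    using fun_cong[OF *(3)] by (intro perm_homs_eq[OF *(1,2) assms]) (metis restrict_apply')
qed

lemma perm_homs_extend:
  assumes basis: "free_basis G J B" and f: "\<And>b. b \<in> B \<Longrightarrow> f b \<in> perms n"
  shows "\<exists>\<phi>\<in>perm_homs G J n. \<forall>b\<in>B. \<phi> b = f b"
proof -
  have B: "B \<subseteq> carrier G" and J: "generate G B = J" using basis by (auto simp: free_basis_def)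
  have sub: "subgroup J G" using B J generate_is_subgroup by auto
  have BJ: "B \<subseteq> J" using J by (auto intro: generate.incl)
  have "\<exists>h. h \<one> = id \<and> (\<forall>u\<in>J. h u \<in> perms n) \<and> (\<forall>x\<in>B. \<forall>u\<in>J. h (x \<otimes> u) = f x \<circ> h u)"
    by (rule free_basis_cocycle[OF basis sym_group_is_group, where c = "\<lambda>x u. f x",
          unfolded sym_group_mult sym_group_one]) (rule f)
  then obtain h where
    "h \<one> = id \<and> (\<forall>u\<in>J. h u \<in> perms n) \<and> (\<forall>x\<in>B. \<forall>u\<in>J. h (x \<otimes> u) = f x \<circ> h u)" ..
  then have h1: "h \<one> = id" and hc: "\<And>u. u \<in> J \<Longrightarrow> h u \<in> perms n"
    and hs: "\<And>x u. x \<in> B \<Longrightarrow> u \<in> J \<Longrightarrow> h (x \<otimes> u) = f x \<circ> h u" by auto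
  have hm: "h (u \<otimes> v) = h u \<circ> h v" if u: "u \<in> J" and v: "v \<in> J" for u v
  proof -
    have "u \<in> generate G B" using u J by simp
    then show ?thesis using B
    proof (induction rule: generate_induct_iff)
      case one
      show ?case using h1 v subgroup.mem_carrier[OF sub] by simp
    next
      case (step x u)
      have c: "u \<in> J" "x \<in> carrier G" "u \<in> carrier G" "v \<in> carrier G"
        using step B J v subgroup.mem_carrier[OF sub] by auto
      have "u \<otimes> v \<in> J" using subgroup.m_closed[OF sub c(1) v] .
      then have "h (x \<otimes> u \<otimes> v) = f x \<circ> h (u \<otimes> v)" using hs[OF step(1)] c by (simp add: m_assoc)
      moreover have "inj (f x)" using f[OF step(1)] perms_inj by blast
      ultimately show ?case using hs[OF step(1) c(1)] by (auto simp: fun_eq_iff inj_eq)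
    qed
  qed
  show ?thesis
  proof (intro bexI ballI)
    show "restrict h J \<in> perm_homs G J n"
      using hc hm subgroup.m_closed[OF sub] by (auto simp: perm_homs_iff)
    fix b assume b: "b \<in> B"
    then have "h (b \<otimes> \<one>) = f b \<circ> h \<one>" using hs subgroup.one_closed[OF sub] by blast
    then show "restrict h J b = f b" using b BJ B h1 by auto
  qed
qed

lemma bij_betw_perm_homs_basis:
  assumes basis: "free_basis G J B"
  shows "bij_betw (\<lambda>\<phi>. restrict \<phi> B) (perm_homs G J n) (B \<rightarrow>\<^sub>E perms n)"
proof -
  have B: "B \<subseteq> carrier G" and J: "generate G B = J" using basis by (auto simp: free_basis_def)
  have BJ: "B \<subseteq> J" using J by (auto intro: generate.incl)
  note perm_homs_restrict_inj[OF J B, of n]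
  moreover have "(\<lambda>\<phi>. restrict \<phi> B) ` perm_homs G J n = (B \<rightarrow>\<^sub>E perms n)"
  proof (intro equalityI subsetI)
    fix f assume f: "f \<in> B \<rightarrow>\<^sub>E perms n"
    then obtain \<phi> where "\<phi> \<in> perm_homs G J n" "\<forall>b\<in>B. \<phi> b = f b"
      using perm_homs_extend[OF basis, of f n] by (auto simp: PiE_iff)
    moreover have "restrict \<phi> B = f" using f calculation(2)
      by (intro extensionalityI[of _ B]) (auto simp: PiE_iff)
    ultimately show "f \<in> (\<lambda>\<phi>. restrict \<phi> B) ` perm_homs G J n" by blast
  qed (use BJ perm_homs_perms in fastforce)
  ultimately show ?thesis by (simp add: bij_betw_def)
qed

lemma card_perm_homs:
  assumes "free_basis G J B" "finite B"
  shows "finite (perm_homs G J n)" "card (perm_homs G J n) = fact n ^ card B"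
proof -
  note bij = bij_betw_perm_homs_basis[OF assms(1), of n]
  have "finite (B \<rightarrow>\<^sub>E perms n)" using assms(2) by (intro finite_PiE) auto
  then show "finite (perm_homs G J n)" using bij_betw_finite[OF bij] by simp
  show "card (perm_homs G J n) = fact n ^ card B"
    using bij_betw_same_card[OF bij] assms(2) by (simp add: card_PiE)
qed

text \<open>Each of the \<open>2 ^ m\<close> maps from \<open>m\<close> basis elements to \<open>sym_group 2\<close> extends to a
  homomorphism, and a homomorphism is determined by its values on a generating set.\<close>

lemma basis_card_le_generators:
  assumes basis: "free_basis G J B" and S: "finite S" "S \<subseteq> carrier G" "generate G S = J"
  shows "finite B \<and> card B \<le> card S"
proof (rule finite_if_finite_subsets_card_bdd)
  fix C assume C: "C \<subseteq> B" "finite C"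
  define ext where "ext f = (SOME \<phi>. \<phi> \<in> perm_homs G J 2 \<and> (\<forall>b\<in>C. \<phi> b = f b))" for f
  have ext: "ext f \<in> perm_homs G J 2 \<and> (\<forall>b\<in>C. ext f b = f b)" if f: "f \<in> C \<rightarrow>\<^sub>E perms 2" for f
  proof -
    have "(if b \<in> C then f b else id) \<in> perms 2" for b
      using f by (auto simp: PiE_iff)
    then obtain \<phi> where "\<phi> \<in> perm_homs G J 2" "\<forall>b\<in>B. \<phi> b = (if b \<in> C then f b else id)"
      using perm_homs_extend[OF basis, of "\<lambda>b. if b \<in> C then f b else id" 2] by blast
    then have ex: "\<exists>\<phi>. \<phi> \<in> perm_homs G J 2 \<and> (\<forall>b\<in>C. \<phi> b = f b)"
      using C by (intro exI[of _ \<phi>] conjI ballI) auto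
    show ?thesis unfolding ext_def by (rule someI_ex[OF ex])
  qed
  have SJ: "S \<subseteq> J" using S(3) by (auto intro: generate.incl)
  have "inj_on (\<lambda>f. restrict (ext f) S) (C \<rightarrow>\<^sub>E perms 2)"
  proof (rule inj_onI)
    fix f g assume fg: "f \<in> C \<rightarrow>\<^sub>E perms 2" "g \<in> C \<rightarrow>\<^sub>E perms 2" "restrict (ext f) S = restrict (ext g) S"
    have "ext f = ext g"
      by (rule inj_onD[OF perm_homs_restrict_inj[OF S(3,2)]])
        (use fg(3) ext[OF fg(1)] ext[OF fg(2)] in auto)
    then show "f = g" using ext[OF fg(1)] ext[OF fg(2)] fg(1,2)
      by (intro extensionalityI[of _ C]) (auto simp: PiE_iff)
  qed
  moreover have "(\<lambda>f. restrict (ext f) S) ` (C \<rightarrow>\<^sub>E perms 2) \<subseteq> S \<rightarrow>\<^sub>E perms 2"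
  proof (intro image_subsetI)
    fix f assume "f \<in> C \<rightarrow>\<^sub>E perms 2"
    then have "ext f \<in> perm_homs G J 2" using ext by blast
    then show "restrict (ext f) S \<in> S \<rightarrow>\<^sub>E perms 2" using SJ perm_homs_perms by fastforce
  qed
  moreover have "finite (S \<rightarrow>\<^sub>E perms 2)" using S(1) by (intro finite_PiE) auto
  ultimately have "card (C \<rightarrow>\<^sub>E perms 2) \<le> card (S \<rightarrow>\<^sub>E perms 2)" by (rule card_inj_on_le)
  then have "(2::nat) ^ card C \<le> 2 ^ card S" using C S(1) by (simp add: card_PiE)
  then show "card C \<le> card S" by simp
qed

lemma rk_eq_card:
  assumes "free_basis G J B"
  shows "rk G J = (if finite B then enat (card B) else \<infinity>)"
proof -
  define B' where "B' = (SOME B. free_basis G J B)"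
  have B': "free_basis G J B'" unfolding B'_def using assms by (rule someI)
  note props = assms[unfolded free_basis_def] B'[unfolded free_basis_def]
  have "finite B \<longleftrightarrow> finite B'" "finite B \<Longrightarrow> card B = card B'"
    using basis_card_le_generators[OF assms, of B'] basis_card_le_generators[OF B', of B] props
    by (auto intro: antisym)
  then show ?thesis by (auto simp: rk_def B'_def[symmetric])
qed

end

lemma partial_permutation_extends:
  assumes "finite A" "D \<subseteq> A" "inj_on f D" "f ` D \<subseteq> A"
  shows "\<exists>p. p permutes A \<and> (\<forall>a\<in>D. p a = f a)"
proof -
  have "card (A - D) = card (A - f ` D)"
    using assms finite_subset[OF assms(2,1)] by (simp add: card_Diff_subset card_image)
  then obtain g where g: "bij_betw g (A - D) (A - f ` D)"
    using finite_same_card_bij[of "A - D" "A - f ` D"] assms(1) by auto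
  have "bij_betw f D (f ` D)" using assms(3) by (simp add: bij_betw_def)
  then have "bij_betw (\<lambda>a. if a \<in> D then f a else g a) (D \<union> (A - D)) (f ` D \<union> (A - f ` D))"
    using bij_betw_disjoint_Un[OF _ g, of f D "f ` D"] by auto
  then have bij: "bij_betw (\<lambda>a. if a \<in> D then f a else g a) A A"
    using assms(2,4) by (simp add: Un_absorb1)
  let ?p = "\<lambda>a. if a \<in> A then (if a \<in> D then f a else g a) else a"
  have "bij_betw ?p A A" using bij by (rule iffD1[OF bij_betw_cong, rotated]) simp
  then have "?p permutes A" by (rule bij_imp_permutes) simp
  then show ?thesis using assms(2) by (intro exI[of _ ?p]) auto
qed

fun perm_word :: "('a \<Rightarrow> nat \<Rightarrow> nat) \<Rightarrow> ('a \<times> bool) list \<Rightarrow> nat \<Rightarrow> nat" where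
  "perm_word f [] = id"
| "perm_word f (l # ls) = (if snd l then f (fst l) else inv' (f (fst l))) \<circ> perm_word f ls"

text \<open>The letters of a reduced word of length \<open>m\<close> can be made to move the point \<open>m + 1\<close> down to \<open>1\<close>, one
  step each. That the word is reduced says exactly that no letter is thereby asked to be multivalued
  or non-injective, so the required partial maps extend to permutations.\<close>

lemma reduced_word_acts_nontrivially:
  assumes red: "reduced_word ls" and ne: "ls \<noteq> []"
  shows "\<exists>n f. (\<forall>x. f x \<in> perms n) \<and> perm_word f ls \<noteq> id"
proof -
  define m where "m = length ls"
  define A where "A = {1..Suc m}"
  \<comment> \<open>The value of the letter \<open>ls ! i\<close> is to send the point \<open>i + 2\<close> to \<open>i + 1\<close>.\<close>
  define R where "R x = {(a, b). \<exists>i<m. fst (ls ! i) = x \<and>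
     (if snd (ls ! i) then a = Suc (Suc i) \<and> b = Suc i else a = Suc i \<and> b = Suc (Suc i))}" for x
  have adj: "\<not> (fst (ls ! i) = fst (ls ! Suc i) \<and> snd (ls ! i) \<noteq> snd (ls ! Suc i))" if "Suc i < m" for i
    using red that unfolding reduced_word_def m_def successively_conv_nth by blast
  have R_fun: "b = b'" if "(a, b) \<in> R x" "(a, b') \<in> R x" for a b b' x
  proof -
    from that(1) obtain i where i: "i < m" "fst (ls ! i) = x" "if snd (ls ! i) then a = Suc (Suc i) \<and> b = Suc i
        else a = Suc i \<and> b = Suc (Suc i)" unfolding R_def by blast
    from that(2) obtain j where j: "j < m" "fst (ls ! j) = x" "if snd (ls ! j) then a = Suc (Suc j) \<and> b' = Suc j
        else a = Suc j \<and> b' = Suc (Suc j)" unfolding R_def by blast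
    show ?thesis using i j adj[of i] adj[of j]
      by (cases "snd (ls ! i)"; cases "snd (ls ! j)") auto
  qed 
  have R_inj: "a = a'" if "(a, b) \<in> R x" "(a', b) \<in> R x" for a a' b x
  proof -
    from that(1) obtain i where i: "i < m" "fst (ls ! i) = x" "if snd (ls ! i) then a = Suc (Suc i) \<and> b = Suc i
        else a = Suc i \<and> b = Suc (Suc i)" unfolding R_def by blast
    from that(2) obtain j where j: "j < m" "fst (ls ! j) = x" "if snd (ls ! j) then a' = Suc (Suc j) \<and> b = Suc j
        else a' = Suc j \<and> b = Suc (Suc j)" unfolding R_def by blast
    show ?thesis using i j adj[of i] adj[of j]
      by (cases "snd (ls ! i)"; cases "snd (ls ! j)") auto
  qed
  have "\<exists>p. p permutes A \<and> (\<forall>(a, b)\<in>R x. p a = b)" for x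
  proof -
    define g where "g a = (THE b. (a, b) \<in> R x)" for a
    have g: "g a = b" if "(a, b) \<in> R x" for a b
      unfolding g_def using that R_fun by blast
    have "inj_on g (Domain (R x))"
    proof (rule inj_onI)
      fix a a' assume *: "a \<in> Domain (R x)" "a' \<in> Domain (R x)" "g a = g a'"
      then obtain b b' where "(a, b) \<in> R x" "(a', b') \<in> R x" by blast
      with g *(3) R_inj show "a = a'" by metis
    qed
    moreover have "g ` Domain (R x) \<subseteq> A"
    proof (intro image_subsetI)
      fix a assume "a \<in> Domain (R x)"
      then obtain b where "(a, b) \<in> R x" by blast
      moreover from this have "b \<in> A" by (auto simp: R_def A_def split: if_splits)
      ultimately show "g a \<in> A" using g by simp
    qed
    moreover have "Domain (R x) \<subseteq> A" by (auto simp: R_def A_def split: if_splits)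
    ultimately obtain p where "p permutes A" "\<forall>a\<in>Domain (R x). p a = g a"
      using partial_permutation_extends[of A "Domain (R x)" g] by (auto simp: A_def)
    then show ?thesis using g by (intro exI[of _ p]) auto
  qed
  then have "\<forall>x. \<exists>p. p permutes A \<and> (\<forall>(a, b)\<in>R x. p a = b)" by blast
  from choice[OF this] obtain f where f: "\<forall>x. f x permutes A \<and> (\<forall>(a, b)\<in>R x. f x a = b)"
    by (elim exE) (rule that)
  then have f: "\<And>x. f x permutes A" "\<And>x a b. (a, b) \<in> R x \<Longrightarrow> f x a = b" by auto
  have letter: "(if snd (ls ! i) then f (fst (ls ! i)) else inv' (f (fst (ls ! i)))) (Suc (Suc i)) = Suc i"
    if "i < m" for i
  proof (cases "snd (ls ! i)")
    case True
    then have "(Suc (Suc i), Suc i) \<in> R (fst (ls ! i))" using that by (auto simp: R_def)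
    then show ?thesis using f(2) True by simp
  next
    case False
    then have "(Suc i, Suc (Suc i)) \<in> R (fst (ls ! i))" using that by (auto simp: R_def)
    then have "f (fst (ls ! i)) (Suc i) = Suc (Suc i)" using f(2) by blast
    then show ?thesis using False permutes_inverses(2)[OF f(1)] by metis
  qed
  have "perm_word f (drop i ls) (Suc m) = Suc i" if "i \<le> m" for i
    using that
  proof (induction i rule: inc_induct)
    case (step i)
    then have "drop i ls = ls ! i # drop (Suc i) ls" by (simp add: Cons_nth_drop_Suc m_def)
    then show ?case using step letter[of i] by simp
  qed (simp add: m_def)
  from this[of 0] have "perm_word f ls (Suc m) = 1" by simp
  moreover have "m > 0" using ne by (simp add: m_def)
  ultimately have "perm_word f ls (Suc m) \<noteq> Suc m" by simp
  then have "perm_word f ls \<noteq> id" by auto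
  then show ?thesis using f(1) unfolding A_def sym_group_carrier by blast
qed

section \<open>Free factors and bases\<close>

context group
begin

lemma perm_homs_inv:
  assumes "\<phi> \<in> perm_homs G J n" "subgroup J G" "x \<in> J"
  shows "\<phi> (inv x) = inv' (\<phi> x)"
proof -
  have x: "inv x \<in> J" "x \<in> carrier G"
    using subgroup.m_inv_closed[OF assms(2,3)] subgroup.mem_carrier[OF assms(2,3)] .
  then have "\<phi> x \<circ> \<phi> (inv x) = id"
    using perm_homs_mult[OF assms(1,3) x(1)] perm_homs_one[OF assms(1,2)] by simp
  then show ?thesis
    using perms_inj[OF perm_homs_perms[OF assms(1,3)]]
    by (metis comp_assoc comp_id id_comp inv_o_cancel)
qed

lemma perm_homs_word:
  assumes "\<phi> \<in> perm_homs G J n" "subgroup J G"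
  shows "fst ` set ls \<subseteq> J \<Longrightarrow> (\<And>x. x \<in> fst ` set ls \<Longrightarrow> \<phi> x = f x) \<Longrightarrow>
    word_value G ls \<in> J \<and> \<phi> (word_value G ls) = perm_word f ls"
proof (induction ls)
  case Nil
  then show ?case using perm_homs_one[OF assms] subgroup.one_closed[OF assms(2)] by simp
next
  case (Cons l ls)
  have IH: "word_value G ls \<in> J" "\<phi> (word_value G ls) = perm_word f ls" using Cons by auto
  have l: "fst l \<in> J" "\<phi> (fst l) = f (fst l)" using Cons.prems by auto
  have lv: "letter_value G l \<in> J"
    using l(1) subgroup.m_inv_closed[OF assms(2)] by (simp add: letter_value_def)
  have "\<phi> (letter_value G l) = (if snd l then f (fst l) else inv' (f (fst l)))"
    using perm_homs_inv[OF assms l(1)] l(2) by (simp add: letter_value_def)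
  then show ?case
    using perm_homs_mult[OF assms(1) lv IH(1)] IH subgroup.m_closed[OF assms(2) lv IH(1)] by simp
qed

text \<open>Nonempty reduced words are detected by symmetric groups, so no other groups have to be tested for
  the universal property.\<close>

lemma free_basis_if_maps_extend:
  assumes B: "B \<subseteq> carrier G" "generate G B = J"
    and ext: "\<And>n f. (\<And>b. f b \<in> perms n) \<Longrightarrow> \<exists>\<phi>\<in>perm_homs G J n. \<forall>b\<in>B. \<phi> b = f b"
  shows "free_basis G J B"
  unfolding free_basis_def
proof (intro conjI allI impI)
  fix ls :: "('a \<times> bool) list"
  assume ls: "ls \<noteq> [] \<and> reduced_word ls \<and> fst ` set ls \<subseteq> B"
  have sub: "subgroup J G" using B generate_is_subgroup by auto
  have BJ: "B \<subseteq> J" using B(2) by (auto intro: generate.incl)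
  obtain n and f :: "'a \<Rightarrow> nat \<Rightarrow> nat" where f: "\<And>x. f x \<in> perms n" "perm_word f ls \<noteq> id"
    using reduced_word_acts_nontrivially[of ls] ls by blast
  obtain \<phi> where \<phi>: "\<phi> \<in> perm_homs G J n" "\<forall>b\<in>B. \<phi> b = f b" using ext[of f n] f(1) by blast
  have "\<phi> (word_value G ls) = perm_word f ls"
    using perm_homs_word[OF \<phi>(1) sub, of ls f] ls BJ \<phi>(2) by blast
  then show "word_value G ls \<noteq> \<one>" using f(2) perm_homs_one[OF \<phi>(1) sub] by auto
qed (use B in auto)

text \<open>Free groups of finite rank are Hopfian. Restriction to \<open>S\<close> embeds the homomorphisms to a
  symmetric group into the maps defined on \<open>S\<close>; there are equally many of both, so every map
  extends.\<close>

lemma free_basis_if_card_le: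
  assumes basis: "free_basis G J B" "finite B"
    and S: "finite S" "S \<subseteq> carrier G" "generate G S = J" "card S \<le> card B"
  shows "free_basis G J S"
proof (rule free_basis_if_maps_extend[OF S(2,3)])
  fix n and f :: "'a \<Rightarrow> nat \<Rightarrow> nat"
  assume f: "\<And>b. f b \<in> perms n"
  have cS: "card S = card B" using basis_card_le_generators[OF basis(1) S(1-3)] S(4) by simp
  have SJ: "S \<subseteq> J" using S(3) by (auto intro: generate.incl)
  let ?r = "\<lambda>\<phi>. restrict \<phi> S"
  have inj: "inj_on ?r (perm_homs G J n)" by (rule perm_homs_restrict_inj[OF S(3,2)])
  have "?r ` perm_homs G J n = S \<rightarrow>\<^sub>E perms n"
  proof (rule card_subset_eq)
    show "finite (S \<rightarrow>\<^sub>E perms n)" using S(1) by (intro finite_PiE) auto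
    show "?r ` perm_homs G J n \<subseteq> S \<rightarrow>\<^sub>E perms n" using SJ perm_homs_perms by fastforce
    show "card (?r ` perm_homs G J n) = card (S \<rightarrow>\<^sub>E perms n)"
      using card_perm_homs(2)[OF basis] cS S(1) by (simp add: card_image[OF inj] card_PiE)
  qed
  moreover have "restrict f S \<in> S \<rightarrow>\<^sub>E perms n" using f by auto
  ultimately obtain \<phi> where "\<phi> \<in> perm_homs G J n" "restrict f S = restrict \<phi> S" by blast
  then show "\<exists>\<phi>\<in>perm_homs G J n. \<forall>b\<in>S. \<phi> b = f b" by (metis restrict_apply')
qed

lemma free_basis_subset:
  assumes "free_basis G J B" "B0 \<subseteq> B"
  shows "free_basis G (generate G B0) B0"
  using assms unfolding free_basis_def by (meson order_trans)

lemma free_basis_neq_one: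
  assumes "free_basis G J B" "b \<in> B"
  shows "b \<noteq> \<one>"
proof -
  have "b \<in> carrier G" using assms by (auto simp: free_basis_def)
  then show ?thesis
    using free_basis_word_neq_one[OF assms(1), of "[(b, True)]"] assms(2)
    by (simp add: letter_value_def reduced_word_def)
qed

lemma free_basis_nontrivial_word:
  assumes "free_basis G J B" "x \<in> J" "x \<noteq> \<one>"
  shows "\<exists>ls. reduced_word ls \<and> ls \<noteq> [] \<and> fst ` set ls \<subseteq> B \<and> word_value G ls = x"
proof -
  have B: "B \<subseteq> carrier G" "x \<in> generate G B" using assms by (auto simp: free_basis_def)
  obtain ls where ls: "reduced_word ls" "fst ` set ls \<subseteq> B" "word_value G ls = x"
    using generate_reduced_word[OF B] by (elim exE conjE) (rule that)
  then have "ls \<noteq> []" using assms(3) by auto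
  then show ?thesis using ls by (intro exI[of _ ls]) simp
qed

text \<open>Reduced words for the factors of an alternating product concatenate to a reduced word, since
  letters of adjacent factors come from disjoint parts of the basis.\<close>

lemma free_product_of_subbasis:
  assumes basis: "free_basis G J B" and B0: "B0 \<subseteq> B"
  shows "free_product_of G J (generate G B0) (generate G (B - B0))"
proof -
  let ?H = "generate G B0" and ?K = "generate G (B - B0)"
  have B: "B \<subseteq> carrier G" and J: "generate G B = J" using basis by (auto simp: free_basis_def)
  have bH: "free_basis G ?H B0" and bK: "free_basis G ?K (B - B0)"
    using free_basis_subset[OF basis] B0 by auto
  have disj: "x = \<one>" if "x \<in> ?H" "x \<in> ?K" for x
  proof (rule ccontr)
    assume "x \<noteq> \<one>"
    from free_basis_nontrivial_word[OF bH that(1) this] obtain ls where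
      ls: "reduced_word ls" "ls \<noteq> []" "fst ` set ls \<subseteq> B0" "word_value G ls = x"
      by (elim exE conjE) (rule that)
    from free_basis_nontrivial_word[OF bK that(2) \<open>x \<noteq> \<one>\<close>] obtain ms where
      ms: "reduced_word ms" "ms \<noteq> []" "fst ` set ms \<subseteq> B - B0" "word_value G ms = x"
      by (elim exE conjE) (rule that)
    have "ls = ms" using reduced_word_unique[OF basis ls(1) ms(1)] ls ms B0 by (metis Diff_subset order_trans)
    moreover have "hd ls \<in> set ls" using ls(2) by simp
    ultimately show False using ls(3) ms(3) by blast
  qed
  let ?R = "\<lambda>x y. x \<in> ?H \<and> y \<in> ?K \<or> x \<in> ?K \<and> y \<in> ?H"
  have words: "xs \<noteq> [] \<Longrightarrow> set xs \<subseteq> ?H \<union> ?K - {\<one>} \<Longrightarrow> successively ?R xs \<Longrightarrow>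
    \<exists>ls. reduced_word ls \<and> ls \<noteq> [] \<and> fst ` set ls \<subseteq> B \<and> word_value G ls = list_product G xs \<and>
      (fst (hd ls) \<in> B0 \<longleftrightarrow> hd xs \<in> ?H)" for xs
  proof (induction xs)
    case (Cons x xs)
    have "\<exists>ms. reduced_word ms \<and> ms \<noteq> [] \<and> fst ` set ms \<subseteq> (if x \<in> ?H then B0 else B - B0) \<and> word_value G ms = x"
    proof (cases "x \<in> ?H")
      case True
      then show ?thesis using Cons.prems(2) free_basis_nontrivial_word[OF bH True] by simp
    next
      case False
      then have "x \<in> ?K" using Cons.prems(2) by auto
      then show ?thesis using Cons.prems(2) free_basis_nontrivial_word[OF bK] False by simp
    qed
    then obtain ms where ms: "reduced_word ms" "ms \<noteq> []"
      "fst ` set ms \<subseteq> (if x \<in> ?H then B0 else B - B0)" "word_value G ms = x"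
      by (elim exE conjE) (rule that)
    have msB: "fst ` set ms \<subseteq> B" using ms(3) B0 by (auto split: if_splits)
    have ends: "fst (hd ms) \<in> fst ` set ms" "fst (last ms) \<in> fst ` set ms" using ms(2) by auto
    have hd: "fst (hd ms) \<in> B0 \<longleftrightarrow> x \<in> ?H"
      using subsetD[OF ms(3) ends(1)] by (auto split: if_splits)
    have last: "fst (last ms) \<in> B0 \<longleftrightarrow> x \<in> ?H"
      using subsetD[OF ms(3) ends(2)] by (auto split: if_splits)
    have xc: "x \<in> carrier G" using word_value_closed[of ms] ms(4) msB B by blast
    show ?case
    proof (cases "xs = []")
      case True
      then show ?thesis using ms msB hd xc by (intro exI[of _ ms]) auto
    next
      case False
      have succ: "successively ?R xs" "?R x (hd xs)"
        using Cons.prems(3) False by (auto simp: successively_Cons)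
      obtain ls where ls: "reduced_word ls" "ls \<noteq> []" "fst ` set ls \<subseteq> B"
        "word_value G ls = list_product G xs" "fst (hd ls) \<in> B0 \<longleftrightarrow> hd xs \<in> ?H"
        using Cons.IH[OF False _ succ(1)] Cons.prems(2) by (auto simp del: map_append)
      have "hd xs \<noteq> \<one>" "x \<noteq> \<one>" using Cons.prems(2) hd_in_set[OF False] by auto
      then have "x \<in> ?H \<longleftrightarrow> hd xs \<notin> ?H" using succ(2) disj by blast
      then have "fst (last ms) \<noteq> fst (hd ls)" using ls(5) last by auto
      then have "reduced_word (ms @ ls)"
        using ms(1) ls(1) unfolding reduced_word_def successively_append_iff by simp
      moreover have "word_value G (ms @ ls) = list_product G (x # xs)"
        using word_value_append[of ms ls] msB ls(3) B ms(4) ls(4)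
        by (simp only: list_product_simps)
      moreover have "fst ` set (ms @ ls) \<subseteq> B" using msB ls(3) by auto
      moreover have "fst (hd (ms @ ls)) \<in> B0 \<longleftrightarrow> hd (x # xs) \<in> ?H" using hd ms(2) by simp
      ultimately show ?thesis using ms(2) by (intro exI[of _ "ms @ ls"]) blast
    qed
  qed simp
  have "generate G (?H \<union> ?K) = J"
  proof (rule generateI[symmetric])
    show "subgroup J G" using J B generate_is_subgroup by auto
    show "?H \<union> ?K \<subseteq> J" using J B0 mono_generate[of B0 B] mono_generate[of "B - B0" B] by auto
    fix K assume K: "subgroup K G" "?H \<union> ?K \<subseteq> K"
    then have "B \<subseteq> K" by (auto intro: generate.incl)
    then show "J \<subseteq> K" using generate_subgroup_incl[OF _ K(1)] J by blast
  qed
  moreover have "subgroup ?H G" "subgroup ?K G" using B B0 by (auto intro!: generate_is_subgroup)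
  ultimately show ?thesis
    unfolding free_product_of_def
  proof (intro conjI allI impI)
    fix xs assume "xs \<noteq> [] \<and> set xs \<subseteq> ?H \<union> ?K - {\<one>} \<and> successively ?R xs"
    then obtain ls where "reduced_word ls" "ls \<noteq> []" "fst ` set ls \<subseteq> B" "word_value G ls = list_product G xs"
      using words[of xs] by (elim conjE exE) (metis)
    then show "list_product G xs \<noteq> \<one>" using free_basis_word_neq_one[OF basis, of ls] by simp
  qed
qed

lemma free_product_of_disjoint:
  assumes fp: "free_product_of G J H K" and x: "x \<in> H" "x \<in> K"
  shows "x = \<one>"
proof (rule ccontr)
  assume ne: "x \<noteq> \<one>"
  have sub: "subgroup H G" "subgroup K G" using fp by (auto simp: free_product_of_def)
  then have c: "x \<in> carrier G" "inv x \<in> H"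
    using subgroup.mem_carrier[OF sub(1) x(1)] subgroup.m_inv_closed[OF sub(1) x(1)] by auto
  have "inv x \<noteq> \<one>" using ne c by (metis inv_eq_1_iff)
  then have "list_product G [x, inv x] \<noteq> \<one>"
    using fp x c ne unfolding free_product_of_def by (elim conjE allE[of _ "[x, inv x]"]) simp
  then show False using c by simp
qed

text \<open>Conversely, a reduced word over both bases is cut into maximal syllables over one of them. A
  syllable is a nonempty reduced word and so has a nontrivial value.\<close>

lemma free_basis_Un:
  assumes fp: "free_product_of G J H K" and bH: "free_basis G H B" and bK: "free_basis G K C"
  shows "free_basis G J (B \<union> C)"
proof -
  have sub: "subgroup H G" "subgroup K G" and J: "generate G (H \<union> K) = J"
    using fp by (auto simp: free_product_of_def)
  have H: "generate G B = H" "B \<subseteq> carrier G" and K: "generate G C = K" "C \<subseteq> carrier G"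
    using bH bK by (auto simp: free_basis_def)
  have BH: "B \<subseteq> H" and CK: "C \<subseteq> K" using H K by (auto intro: generate.incl)
  have disj: "x = \<one>" if "x \<in> H" "x \<in> K" for x using free_product_of_disjoint[OF fp that] .
  let ?R = "\<lambda>x y. x \<in> H \<and> y \<in> K \<or> x \<in> K \<and> y \<in> H"
  have syll: "ls \<noteq> [] \<Longrightarrow> reduced_word ls \<Longrightarrow> fst ` set ls \<subseteq> B \<union> C \<Longrightarrow>
    \<exists>ms xs. ms \<noteq> [] \<and> reduced_word ms \<and> hd ms = hd ls \<and> (fst ` set ms \<subseteq> B \<or> fst ` set ms \<subseteq> C) \<and>
      set xs \<subseteq> H \<union> K - {\<one>} \<and> successively ?R (word_value G ms # xs) \<and>
      word_value G ls = word_value G ms \<otimes> list_product G xs" for ls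
  proof (induction ls)
    case (Cons l ls)
    have lc: "letter_value G l \<in> carrier G"
      using Cons.prems(3) H K by (intro letter_value_closed) auto
    show ?case
    proof (cases "ls = []")
      case True
      then show ?thesis using Cons.prems lc by (intro exI[of _ "[l]"] exI[of _ "[]"]) auto
    next
      case False
      have red: "reduced_word ls" using Cons.prems(2) reduced_word_ConsD by blast
      have lets: "fst ` set ls \<subseteq> B \<union> C" using Cons.prems(3) by auto
      obtain ms xs where ms: "ms \<noteq> []" "reduced_word ms" "hd ms = hd ls"
        "fst ` set ms \<subseteq> B \<or> fst ` set ms \<subseteq> C" and xs: "set xs \<subseteq> H \<union> K - {\<one>}"
        "successively ?R (word_value G ms # xs)"
        "word_value G ls = word_value G ms \<otimes> list_product G xs"
        using Cons.IH[OF False red lets] by (elim exE conjE) (rule that)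
      have ms1: "word_value G ms \<noteq> \<one>"
        using ms(4) free_basis_word_neq_one[OF bH ms(1,2)] free_basis_word_neq_one[OF bK ms(1,2)] by blast
      have msHK: "fst ` set ms \<subseteq> B \<Longrightarrow> word_value G ms \<in> H" "fst ` set ms \<subseteq> C \<Longrightarrow> word_value G ms \<in> K"
        using word_value_in_generate H K by blast+
      have mc: "word_value G ms \<in> carrier G" using ms(4) H K by (auto intro!: word_value_closed)
      have xc: "list_product G xs \<in> carrier G"
        using xs(1) subgroup.subset[OF sub(1)] subgroup.subset[OF sub(2)] by (intro list_product_closed) blast
      have lHK: "fst l \<in> B \<Longrightarrow> letter_value G l \<in> H" "fst l \<in> C \<Longrightarrow> letter_value G l \<in> K"
        using BH CK subgroup.m_inv_closed[OF sub(1)] subgroup.m_inv_closed[OF sub(2)]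
        by (auto simp: letter_value_def)
      show ?thesis
      proof (cases "fst l \<in> B \<and> fst ` set ms \<subseteq> B \<or> fst l \<in> C \<and> fst ` set ms \<subseteq> C")
        case True
        have same: "letter_value G l \<otimes> word_value G ms \<in> H \<and> word_value G ms \<in> H \<or>
            letter_value G l \<otimes> word_value G ms \<in> K \<and> word_value G ms \<in> K"
          using True msHK lHK subgroup.m_closed[OF sub(1)] subgroup.m_closed[OF sub(2)] by blast
        have "reduced_word (l # ms)"
          using Cons.prems(2) False ms(1,2,3) unfolding reduced_word_def
          by (auto simp: successively_Cons)
        moreover have "successively ?R (word_value G (l # ms) # xs)"
        proof (cases "xs = []")
          case False
          then have h: "?R (word_value G ms) (hd xs)" "successively ?R xs"
            using xs(2) by (auto simp: successively_Cons)
          have "hd xs \<noteq> \<one>" using xs(1) hd_in_set[OF False] by blast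
          then have "?R (letter_value G l \<otimes> word_value G ms) (hd xs)"
            using same h(1) disj ms1 by blast
          then show ?thesis using False h(2) by (auto simp: successively_Cons)
        qed simp
        ultimately show ?thesis
          using True ms xs lc mc xc by (intro exI[of _ "l # ms"] exI[of _ xs]) (auto simp: m_assoc)
      next
        case False
        then have "fst l \<in> B \<and> fst ` set ms \<subseteq> C \<or> fst l \<in> C \<and> fst ` set ms \<subseteq> B"
          using Cons.prems(3) ms(4) by auto
        then have "?R (letter_value G l) (word_value G ms)" using msHK lHK by blast
        then have "successively ?R (word_value G [l] # word_value G ms # xs)"
          using xs(2) lc by simp
        moreover have "set (word_value G ms # xs) \<subseteq> H \<union> K - {\<one>}"
          using xs(1) ms(4) msHK ms1 by auto
        moreover have "word_value G (l # ls) = word_value G [l] \<otimes> list_product G (word_value G ms # xs)"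
          using xs(3) lc by simp
        moreover have "fst ` set [l] \<subseteq> B \<or> fst ` set [l] \<subseteq> C" using Cons.prems(3) by auto
        ultimately show ?thesis
          by (intro exI[of _ "[l]"] exI[of _ "word_value G ms # xs"]) (simp add: reduced_word_def)
      qed
    qed
  qed simp
  show ?thesis
    unfolding free_basis_def
  proof (intro conjI allI impI)
    show "B \<union> C \<subseteq> carrier G" using H K by simp
    show "generate G (B \<union> C) = J"
    proof (rule generateI[symmetric])
      show "subgroup J G" using J generate_is_subgroup subgroup.subset[OF sub(1)] subgroup.subset[OF sub(2)] by auto
      show "B \<union> C \<subseteq> J" using BH CK J by (auto intro: generate.incl)
      fix L assume L: "subgroup L G" "B \<union> C \<subseteq> L"
      then have "H \<union> K \<subseteq> L" using generate_subgroup_incl[OF _ L(1)] H(1) K(1) by blast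
      then show "J \<subseteq> L" using generate_subgroup_incl[OF _ L(1)] J by blast
    qed
    fix ls :: "('a \<times> bool) list"
    assume "ls \<noteq> [] \<and> reduced_word ls \<and> fst ` set ls \<subseteq> B \<union> C"
    then have ls: "ls \<noteq> []" "reduced_word ls" "fst ` set ls \<subseteq> B \<union> C" by auto
    obtain ms xs where ms: "ms \<noteq> []" "reduced_word ms" "fst ` set ms \<subseteq> B \<or> fst ` set ms \<subseteq> C"
      and xs: "set xs \<subseteq> H \<union> K - {\<one>}" "successively ?R (word_value G ms # xs)"
        "word_value G ls = word_value G ms \<otimes> list_product G xs"
      using syll[OF ls] by (elim conjE exE) (rule that)
    have ms1: "word_value G ms \<noteq> \<one>"
      using ms free_basis_word_neq_one[OF bH ms(1,2)] free_basis_word_neq_one[OF bK ms(1,2)] by blast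
    have "word_value G ms \<in> H \<union> K" using word_value_in_generate H K ms(3) by blast
    then have "list_product G (word_value G ms # xs) \<noteq> \<one>"
      using fp ms1 xs unfolding free_product_of_def
      by (elim conjE allE[of _ "word_value G ms # xs"]) simp
    then show "word_value G ls \<noteq> \<one>" using xs(3) by simp
  qed
qed

end

section \<open>Subgroups of free groups\<close>

text \<open>Connectedness of the subgraph of the Cayley graph with vertex set \<open>W\<close> and the edges
  \<open>u \<rightarrow> x \<otimes> u\<close> for \<open>(x, u) \<in> D\<close>: no property that passes along the edges separates a vertex from \<open>\<one>\<close>. In this form
  connectedness is visibly preserved by unions, and it serves as an induction rule.\<close>

definition cayley_connected :: "('a, 'b) monoid_scheme \<Rightarrow> ('a \<times> 'a) set \<Rightarrow> 'a set \<Rightarrow> bool" where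
  "cayley_connected G D W \<longleftrightarrow> \<one>\<^bsub>G\<^esub> \<in> W \<and>
     (\<forall>P. P \<one>\<^bsub>G\<^esub> \<longrightarrow> (\<forall>(x, u)\<in>D. u \<in> W \<longrightarrow> x \<otimes>\<^bsub>G\<^esub> u \<in> W \<longrightarrow> (P u \<longleftrightarrow> P (x \<otimes>\<^bsub>G\<^esub> u))) \<longrightarrow>
        (\<forall>u\<in>W. P u))"

text \<open>The subgroup read off from the coincidences of left cosets \<open>u <# J\<close> with \<open>u \<in> W\<close>. If \<open>W\<close> is connected it is
  the fundamental group of the image of \<open>W\<close> in the Schreier graph of \<open>J\<close>.\<close>

definition supported_part :: "('a, 'b) monoid_scheme \<Rightarrow> 'a set \<Rightarrow> 'a set \<Rightarrow> 'a set" where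
  "supported_part G W J =
     generate G {inv\<^bsub>G\<^esub> u \<otimes>\<^bsub>G\<^esub> v |u v. u \<in> W \<and> v \<in> W \<and> inv\<^bsub>G\<^esub> u \<otimes>\<^bsub>G\<^esub> v \<in> J}"

lemma cayley_connected_induct [consumes 2, case_names one step]:
  assumes "cayley_connected G D W" "u \<in> W" "P \<one>\<^bsub>G\<^esub>"
    and "\<And>x u. (x, u) \<in> D \<Longrightarrow> u \<in> W \<Longrightarrow> x \<otimes>\<^bsub>G\<^esub> u \<in> W \<Longrightarrow> P u \<longleftrightarrow> P (x \<otimes>\<^bsub>G\<^esub> u)"
  shows "P u"
proof -
  have "\<forall>(x, u)\<in>D. u \<in> W \<longrightarrow> x \<otimes>\<^bsub>G\<^esub> u \<in> W \<longrightarrow> (P u \<longleftrightarrow> P (x \<otimes>\<^bsub>G\<^esub> u))"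
    using assms(4) by auto
  with assms(1,3) have "\<forall>u\<in>W. P u"
    unfolding cayley_connected_def by (elim conjE allE[of _ P]) simp
  then show ?thesis using assms(2) ..
qed

lemma cayley_connected_one: "cayley_connected G D W \<Longrightarrow> \<one>\<^bsub>G\<^esub> \<in> W"
  by (simp add: cayley_connected_def)

lemma cayley_connectedI:
  assumes "\<one>\<^bsub>G\<^esub> \<in> W"
    and "\<And>P u. P \<one>\<^bsub>G\<^esub> \<Longrightarrow>
      (\<And>x u. (x, u) \<in> D \<Longrightarrow> u \<in> W \<Longrightarrow> x \<otimes>\<^bsub>G\<^esub> u \<in> W \<Longrightarrow> P u \<longleftrightarrow> P (x \<otimes>\<^bsub>G\<^esub> u)) \<Longrightarrow> u \<in> W \<Longrightarrow> P u"
  shows "cayley_connected G D W"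
  unfolding cayley_connected_def
proof (intro conjI allI impI ballI)
  fix P u assume "P \<one>\<^bsub>G\<^esub>" "u \<in> W"
    "\<forall>(x, u)\<in>D. u \<in> W \<longrightarrow> x \<otimes>\<^bsub>G\<^esub> u \<in> W \<longrightarrow> (P u \<longleftrightarrow> P (x \<otimes>\<^bsub>G\<^esub> u))"
  then show "P u" by (intro assms(2)[of P u]) auto
qed (rule assms(1))

lemma cayley_connected_Union:
  assumes "\<And>W. W \<in> C \<Longrightarrow> cayley_connected G D W" "C \<noteq> {}"
  shows "cayley_connected G D (\<Union>C)"
proof (rule cayley_connectedI)
  show "\<one>\<^bsub>G\<^esub> \<in> \<Union>C" using assms cayley_connected_one by blast
  fix P u assume P: "P \<one>\<^bsub>G\<^esub>"
    "\<And>x u. (x, u) \<in> D \<Longrightarrow> u \<in> \<Union>C \<Longrightarrow> x \<otimes>\<^bsub>G\<^esub> u \<in> \<Union>C \<Longrightarrow> P u \<longleftrightarrow> P (x \<otimes>\<^bsub>G\<^esub> u)"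
    and "u \<in> \<Union>C"
  then obtain W where W: "W \<in> C" "u \<in> W" by blast
  show "P u"
    using assms(1)[OF W(1)] W(2) P(1) by (rule cayley_connected_induct) (use P(2) W(1) in blast)
qed

lemma cayley_connected_mono:
  assumes "cayley_connected G D W" "D \<subseteq> D'"
  shows "cayley_connected G D' W"
proof (rule cayley_connectedI)
  show "\<one>\<^bsub>G\<^esub> \<in> W" using assms cayley_connected_one by blast
  fix P u assume P: "P \<one>\<^bsub>G\<^esub>"
    "\<And>x u. (x, u) \<in> D' \<Longrightarrow> u \<in> W \<Longrightarrow> x \<otimes>\<^bsub>G\<^esub> u \<in> W \<Longrightarrow> P u \<longleftrightarrow> P (x \<otimes>\<^bsub>G\<^esub> u)" and u: "u \<in> W"
  show "P u"
    using assms(1) u P(1) by (rule cayley_connected_induct) (use P(2) assms(2) in auto)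
qed

lemma cayley_connected_insert:
  assumes "cayley_connected G D W" "(x, u) \<in> D" "u \<in> W \<and> v = x \<otimes>\<^bsub>G\<^esub> u \<or> x \<otimes>\<^bsub>G\<^esub> u \<in> W \<and> v = u"
  shows "cayley_connected G D (insert v W)"
proof (rule cayley_connectedI)
  show "\<one>\<^bsub>G\<^esub> \<in> insert v W" using assms cayley_connected_one by blast
  fix P w assume P: "P \<one>\<^bsub>G\<^esub>"
    "\<And>x u. (x, u) \<in> D \<Longrightarrow> u \<in> insert v W \<Longrightarrow> x \<otimes>\<^bsub>G\<^esub> u \<in> insert v W \<Longrightarrow> P u \<longleftrightarrow> P (x \<otimes>\<^bsub>G\<^esub> u)"
    and w: "w \<in> insert v W"
  have W: "P w" if "w \<in> W" for w
    using assms(1) that P(1) by (rule cayley_connected_induct) (use P(2) in auto)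
  moreover have "P v" using P(2)[OF assms(2)] assms(3) W by blast
  ultimately show "P w" using w by blast
qed

context group
begin

lemma mult_inv_cancel [simp]:
  assumes "x \<in> carrier G" "y \<in> carrier G"
  shows "x \<otimes> (inv x \<otimes> y) = y" "inv x \<otimes> (x \<otimes> y) = y"
  using assms by (simp_all add: m_assoc[symmetric])

lemma coset_sym:
  assumes "subgroup J G" "u \<in> carrier G" "v \<in> carrier G" "inv u \<otimes> v \<in> J"
  shows "inv v \<otimes> u \<in> J"
proof -
  have "inv (inv u \<otimes> v) \<in> J" by (rule subgroup.m_inv_closed[OF assms(1,4)])
  then show ?thesis using assms by (simp add: inv_mult_group)
qed

lemma coset_trans:
  assumes "subgroup J G" "u \<in> carrier G" "v \<in> carrier G" "w \<in> carrier G"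
    "inv u \<otimes> v \<in> J" "inv v \<otimes> w \<in> J"
  shows "inv u \<otimes> w \<in> J"
proof -
  have "(inv u \<otimes> v) \<otimes> (inv v \<otimes> w) \<in> J"
    by (rule subgroup.m_closed[OF assms(1,5,6)])
  moreover have "(inv u \<otimes> v) \<otimes> (inv v \<otimes> w) = inv u \<otimes> w"
    using assms by (simp add: m_assoc)
  ultimately show ?thesis by simp
qed

lemma inv_mult_cancel_left:
  assumes "x \<in> carrier G" "u \<in> carrier G" "v \<in> carrier G"
  shows "inv (x \<otimes> u) \<otimes> (x \<otimes> v) = inv u \<otimes> v"
  using assms by (simp add: inv_mult_group m_assoc)

lemma supported_part_subgroup:
  "W \<subseteq> carrier G \<Longrightarrow> subgroup (supported_part G W J) G"
  unfolding supported_part_def by (rule generate_is_subgroup) auto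

lemma supported_part_subset:
  "subgroup J G \<Longrightarrow> supported_part G W J \<subseteq> J"
  unfolding supported_part_def by (rule generate_subgroup_incl) auto

lemma supported_part_member:
  "u \<in> W \<Longrightarrow> v \<in> W \<Longrightarrow> inv u \<otimes> v \<in> J \<Longrightarrow> inv u \<otimes> v \<in> supported_part G W J"
  unfolding supported_part_def by (rule generate.incl) blast

text \<open>A maximal partial transversal that is connected by the edges in \<open>D\<close> cannot be left by such
  an edge.\<close>

lemma schreier_transversal_extension:
  assumes J: "subgroup J G" and D: "\<And>x u. (x, u) \<in> D \<Longrightarrow> x \<in> carrier G \<and> u \<in> carrier G"
    and inv: "\<And>x u j. (x, u) \<in> D \<Longrightarrow> j \<in> J \<Longrightarrow> (x, u \<otimes> j) \<in> D"
    and T0: "T0 \<subseteq> carrier G" "cayley_connected G D T0"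
      "\<And>s t. s \<in> T0 \<Longrightarrow> t \<in> T0 \<Longrightarrow> inv s \<otimes> t \<in> J \<Longrightarrow> s = t"
  obtains T where "T0 \<subseteq> T" "T \<subseteq> carrier G" "cayley_connected G D T"
    "\<And>s t. s \<in> T \<Longrightarrow> t \<in> T \<Longrightarrow> inv s \<otimes> t \<in> J \<Longrightarrow> s = t"
    "\<And>x u. (x, u) \<in> D \<Longrightarrow> (\<exists>t\<in>T. inv t \<otimes> u \<in> J) \<longleftrightarrow> (\<exists>t\<in>T. inv t \<otimes> (x \<otimes> u) \<in> J)"
proof -
  define A where "A = {T. T0 \<subseteq> T \<and> T \<subseteq> carrier G \<and> cayley_connected G D T \<and>
     (\<forall>s\<in>T. \<forall>t\<in>T. inv s \<otimes> t \<in> J \<longrightarrow> s = t)}"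
  have "\<exists>M\<in>A. \<forall>X\<in>A. M \<subseteq> X \<longrightarrow> X = M"
  proof (rule subset_Zorn_nonempty)
    show "A \<noteq> {}" using T0 by (auto simp: A_def)
    fix C assume C: "C \<noteq> {}" "subset.chain A C"
    have CA: "C \<subseteq> A" and lin: "\<And>S T. S \<in> C \<Longrightarrow> T \<in> C \<Longrightarrow> S \<subseteq> T \<or> T \<subseteq> S"
      using C(2) unfolding subset.chain_def by auto
    have "cayley_connected G D (\<Union>C)" using CA C(1) by (intro cayley_connected_Union) (auto simp: A_def)
    moreover have "s = t" if st: "s \<in> \<Union>C" "t \<in> \<Union>C" "inv s \<otimes> t \<in> J" for s t
    proof -
      obtain S T where ST: "s \<in> S" "t \<in> T" "S \<in> C" "T \<in> C" using st(1,2) by blast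
      obtain R where "R \<in> C" "s \<in> R" "t \<in> R" using lin[OF ST(3,4)] ST by blast
      then show ?thesis using CA st(3) unfolding A_def by blast
    qed
    moreover have "\<Union>C \<subseteq> carrier G" using CA unfolding A_def by blast
    moreover obtain S where "S \<in> C" using C(1) by blast
    then have "T0 \<subseteq> \<Union>C" using CA unfolding A_def by blast
    ultimately show "\<Union>C \<in> A" unfolding A_def by (intro CollectI conjI ballI impI)
  qed
  then obtain T where TA: "T \<in> A" and max: "\<And>X. X \<in> A \<Longrightarrow> T \<subseteq> X \<Longrightarrow> X = T" by blast
  then have T: "T0 \<subseteq> T" "T \<subseteq> carrier G" "cayley_connected G D T"
    and inj: "\<And>s t. s \<in> T \<Longrightarrow> t \<in> T \<Longrightarrow> inv s \<otimes> t \<in> J \<Longrightarrow> s = t"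
    unfolding A_def by blast+
  \<comment> \<open>A neighbour of \<open>T\<close> in an uncovered coset could be added.\<close>
  have cover: "\<exists>t\<in>T. inv t \<otimes> v \<in> J"
    if v: "v \<in> carrier G" and conn: "cayley_connected G D (insert v T)" for v
  proof (rule ccontr)
    assume no: "\<not> (\<exists>t\<in>T. inv t \<otimes> v \<in> J)"
    have "s = t" if "s \<in> insert v T" "t \<in> insert v T" "inv s \<otimes> t \<in> J" for s t
      using that no inj coset_sym[OF J _ _ that(3)] T(2) v by blast
    then have "insert v T \<in> A" using T v conn unfolding A_def by blast
    then have "v \<in> T" using max by blast
    then have "inv v \<otimes> v \<in> J" using v subgroup.one_closed[OF J] by simp
    then show False using no \<open>v \<in> T\<close> by blast
  qed
  have step: "(\<exists>t\<in>T. inv t \<otimes> u \<in> J) \<longleftrightarrow> (\<exists>t\<in>T. inv t \<otimes> (x \<otimes> u) \<in> J)" if xu: "(x, u) \<in> D" for x u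
  proof
    have c: "x \<in> carrier G" "u \<in> carrier G" using D[OF xu] by auto
    assume "\<exists>t\<in>T. inv t \<otimes> u \<in> J"
    then obtain t where t: "t \<in> T" "inv t \<otimes> u \<in> J" by blast
    then have tc: "t \<in> carrier G" using T by auto
    have "u \<otimes> (inv u \<otimes> t) = t" using c tc by simp
    then have "(x, t) \<in> D" using inv[OF xu coset_sym[OF J tc c(2) t(2)]] by simp
    then have "cayley_connected G D (insert (x \<otimes> t) T)"
      using cayley_connected_insert[OF T(3)] t(1) by blast
    then obtain s where s: "s \<in> T" "inv s \<otimes> (x \<otimes> t) \<in> J" using cover[of "x \<otimes> t"] c tc by auto
    have "inv (x \<otimes> t) \<otimes> (x \<otimes> u) \<in> J" using t(2) c tc by (simp add: inv_mult_cancel_left)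
    then have "inv s \<otimes> (x \<otimes> u) \<in> J" using coset_trans[OF J _ _ _ s(2)] s(1) T c tc by auto
    then show "\<exists>t\<in>T. inv t \<otimes> (x \<otimes> u) \<in> J" using s(1) by blast
  next
    have c: "x \<in> carrier G" "u \<in> carrier G" using D[OF xu] by auto
    assume "\<exists>t\<in>T. inv t \<otimes> (x \<otimes> u) \<in> J"
    then obtain t where t: "t \<in> T" "inv t \<otimes> (x \<otimes> u) \<in> J" by blast
    then have tc: "t \<in> carrier G" using T by auto
    let ?v = "inv x \<otimes> t"
    have vc: "?v \<in> carrier G" "x \<otimes> ?v = t" using c tc by auto
    have uv: "inv u \<otimes> ?v \<in> J"
      using coset_sym[OF J tc _ t(2)] c tc by (simp add: inv_mult_group m_assoc)
    moreover have "u \<otimes> (inv u \<otimes> ?v) = ?v" using c tc by simp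
    ultimately have "(x, ?v) \<in> D" using inv[OF xu uv] by simp
    then have "cayley_connected G D (insert ?v T)"
      using cayley_connected_insert[OF T(3), of x ?v ?v] t(1) vc(2) by auto
    then obtain s where s: "s \<in> T" "inv s \<otimes> ?v \<in> J" using cover[of ?v] vc by auto
    then have "inv s \<otimes> u \<in> J"
      using coset_trans[OF J _ _ _ s(2) coset_sym[OF J _ _ uv]] T c vc by auto
    then show "\<exists>t\<in>T. inv t \<otimes> u \<in> J" using s(1) by blast
  qed
  show ?thesis by (rule that[OF T inj step])
qed

text \<open>A spanning tree of the Schreier graph of \<open>J\<close> is lifted to a transversal \<open>T\<close>, and the edges outside the tree
  give generators \<open>\<gamma> x s\<close>. They are free because arbitrary permutations can be assigned to them and the
  identity to the tree edges; the resulting cocycle restricts to a homomorphism on \<open>J\<close>. The tree is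
  grown in two stages, first inside the image of \<open>W\<close>, whose fundamental group is then generated by the
  edges of that image: a subset of the basis.\<close>

lemma nielsen_schreier:
  assumes basis: "free_basis G L X" and J: "subgroup J G" "J \<subseteq> L"
    and W: "W \<subseteq> L" "cayley_connected G (X \<times> UNIV) W"
  shows "\<exists>B B0. free_basis G J B \<and> B0 \<subseteq> B \<and> generate G B0 = supported_part G W J"
proof -
  have X: "X \<subseteq> carrier G" and L: "generate G X = L" using basis by (auto simp: free_basis_def)
  then have subL: "subgroup L G" using generate_is_subgroup by auto
  note Lm = subgroup.m_closed[OF subL] subgroup.m_inv_closed[OF subL]
  have XL: "X \<subseteq> L" using L by (auto intro: generate.incl)
  have Lc: "u \<in> carrier G" if "u \<in> L" for u using subgroup.mem_carrier[OF subL that] .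
  note Xc = subsetD[OF X]
  \<comment> \<open>The lifts of the edges in the image of \<open>W\<close>. Edges outside the image must not enter the first
    tree, even if they join two vertices of the image.\<close>
  define D where "D = {(x, u). x \<in> X \<and> u \<in> L \<and> (\<exists>w\<in>W. x \<otimes> w \<in> W \<and> inv w \<otimes> u \<in> J)}"
  have D_inv: "(x, u \<otimes> j) \<in> D" if xj: "(x, u) \<in> D" "j \<in> J" for x u j
  proof -
    obtain w where w: "x \<in> X" "u \<in> L" "w \<in> W" "x \<otimes> w \<in> W" "inv w \<otimes> u \<in> J" using xj(1) by (auto simp: D_def)
    have "inv w \<otimes> u \<otimes> j \<in> J" using subgroup.m_closed[OF J(1) w(5) xj(2)] .
    then have "inv w \<otimes> (u \<otimes> j) \<in> J" using w W(1) Lc xj(2) J(2) by (auto simp: m_assoc subset_eq)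
    then show ?thesis using w xj(2) J(2) Lm(1) by (auto simp: D_def)
  qed
  obtain T1 where T1: "{\<one>} \<subseteq> T1" "T1 \<subseteq> carrier G" "cayley_connected G D T1"
    "\<And>s t. s \<in> T1 \<Longrightarrow> t \<in> T1 \<Longrightarrow> inv s \<otimes> t \<in> J \<Longrightarrow> s = t"
    "\<And>x u. (x, u) \<in> D \<Longrightarrow> (\<exists>t\<in>T1. inv t \<otimes> u \<in> J) \<longleftrightarrow> (\<exists>t\<in>T1. inv t \<otimes> (x \<otimes> u) \<in> J)"
  proof (rule schreier_transversal_extension[OF J(1), of D "{\<one>}"])
    show "x \<in> carrier G \<and> u \<in> carrier G" if "(x, u) \<in> D" for x u using that Lc Xc by (auto simp: D_def)
    show "cayley_connected G D {\<one>}" by (rule cayley_connectedI) auto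
  qed (use D_inv in auto)
  let ?D' = "X \<times> L"
  have DD': "D \<subseteq> ?D'" by (auto simp: D_def)
  obtain T where T: "T1 \<subseteq> T" "T \<subseteq> carrier G" "cayley_connected G ?D' T"
    "\<And>s t. s \<in> T \<Longrightarrow> t \<in> T \<Longrightarrow> inv s \<otimes> t \<in> J \<Longrightarrow> s = t"
    "\<And>x u. (x, u) \<in> ?D' \<Longrightarrow> (\<exists>t\<in>T. inv t \<otimes> u \<in> J) \<longleftrightarrow> (\<exists>t\<in>T. inv t \<otimes> (x \<otimes> u) \<in> J)"
  proof (rule schreier_transversal_extension[OF J(1), of ?D' T1])
    show "x \<in> carrier G \<and> u \<in> carrier G" if "(x, u) \<in> ?D'" for x u using that Lc Xc by auto
    show "cayley_connected G ?D' T1" using cayley_connected_mono[OF T1(3) DD'] .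
    show "(x, u \<otimes> j) \<in> ?D'" if "(x, u) \<in> ?D'" "j \<in> J" for x u j using that J(2) Lm by auto
  qed (use T1 in auto)
  have one_T: "\<one> \<in> T" using T1 T by auto
  have TL: "t \<in> L" if "t \<in> T" for t
    using T(3) that
  proof (induction rule: cayley_connected_induct)
    case one
    show ?case using subgroup.one_closed[OF subL] .
  next
    case (step x u)
    then show ?case using generate_coset_step[OF subL] XL Lc by auto
  qed
  have cover: "\<exists>t\<in>T. inv t \<otimes> u \<in> J" if "u \<in> L" for u
  proof -
    have "u \<in> generate G X" using that L by simp
    then show ?thesis using X
    proof (induction rule: generate_induct_iff)
      case one
      show ?case using one_T subgroup.one_closed[OF J(1)] by (intro bexI[of _ \<one>]) auto
    next
      case (step x u)
      then show ?case using T(5)[of x u] L by auto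
    qed
  qed
  have coverW: "\<exists>t\<in>T1. inv t \<otimes> u \<in> J" if "u \<in> W" for u
    using W(2) that
  proof (induction rule: cayley_connected_induct)
    case one
    show ?case using T1(1) subgroup.one_closed[OF J(1)] by (intro bexI[of _ \<one>]) auto
  next
    case (step x u)
    have "inv u \<otimes> u \<in> J" using step W(1) Lc subgroup.one_closed[OF J(1)] by auto
    then have "(x, u) \<in> D" using step W(1) by (auto simp: D_def)
    then show ?case using T1(5) by blast
  qed
  define t where "t u = (SOME t. t \<in> T \<and> inv t \<otimes> u \<in> J)" for u
  have t: "t u \<in> T" "inv (t u) \<otimes> u \<in> J" if "u \<in> L" for u
    using someI_ex[of "\<lambda>t. t \<in> T \<and> inv t \<otimes> u \<in> J"] cover[OF that] unfolding t_def by blast+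
  have tL: "t u \<in> L" if "u \<in> L" for u using TL t(1) that by blast
  have t_eq: "t u = s" if "u \<in> L" "s \<in> T" "inv s \<otimes> u \<in> J" for u s
  proof -
    have "inv s \<otimes> t u \<in> J"
      using coset_trans[OF J(1) _ _ _ that(3) coset_sym[OF J(1) _ _ t(2)[OF that(1)]]] that tL TL Lc by auto
    then show ?thesis using T(4) t(1) that by blast
  qed
  have t_T: "t s = s" if "s \<in> T" for s
    using that TL Lc subgroup.one_closed[OF J(1)] by (intro t_eq) auto
  have t_cong: "t u = t v" if "u \<in> L" "v \<in> L" "inv u \<otimes> v \<in> J" for u v
    using that t(1) tL Lc coset_trans[OF J(1) _ _ _ t(2)[OF that(1)] that(3)] by (intro t_eq[symmetric]) auto
  have t_W: "t u \<in> T1" if u: "u \<in> W" for u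
  proof -
    obtain s where "s \<in> T1" "inv s \<otimes> u \<in> J" using coverW[OF u] by blast
    moreover from this have "t u = s" using t_eq[of u s] u W(1) T(1) by auto
    ultimately show ?thesis by simp
  qed
  define \<gamma> where "\<gamma> x u = inv (t (x \<otimes> u)) \<otimes> (x \<otimes> t u)" for x u
  have xu: "x \<otimes> u \<in> L" if "x \<in> X" "u \<in> L" for x u using that XL Lm by auto
  have \<gamma>_cong: "\<gamma> x u = \<gamma> x v" if "x \<in> X" "u \<in> L" "v \<in> L" "inv u \<otimes> v \<in> J" for x u v
  proof -
    have "inv (x \<otimes> u) \<otimes> (x \<otimes> v) \<in> J" using that Lc Xc by (simp add: inv_mult_cancel_left)
    then have "t (x \<otimes> u) = t (x \<otimes> v)" "t u = t v"
      using t_cong[OF xu[OF that(1,2)] xu[OF that(1,3)]] t_cong[OF that(2-4)] by auto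
    then show ?thesis by (simp add: \<gamma>_def)
  qed
  have \<gamma>_t: "\<gamma> x (t u) = \<gamma> x u" if "x \<in> X" "u \<in> L" for x u
    using \<gamma>_cong that tL t(2) by blast
  have \<gamma>_J: "\<gamma> x u \<in> J" if x: "x \<in> X" and u: "u \<in> L" for x u
  proof -
    have c: "x \<in> carrier G" "u \<in> carrier G" "t u \<in> carrier G" "t (x \<otimes> u) \<in> carrier G"
      using x u Xc Lc tL xu by auto
    have "inv (x \<otimes> u) \<otimes> (x \<otimes> t u) \<in> J"
      using coset_sym[OF J(1) c(3,2) t(2)[OF u]] c by (simp add: inv_mult_cancel_left)
    then show ?thesis
      unfolding \<gamma>_def using coset_trans[OF J(1) _ _ _ t(2)[OF xu[OF x u]]] c by auto
  qed
  have \<gamma>_step: "inv (t (x \<otimes> u)) \<otimes> (x \<otimes> u) = \<gamma> x u \<otimes> (inv (t u) \<otimes> u)" if x: "x \<in> X" and u: "u \<in> L" for x u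
  proof -
    have c: "x \<in> carrier G" "u \<in> carrier G" "t u \<in> carrier G" "t (x \<otimes> u) \<in> carrier G"
      using x u Xc Lc tL xu by auto
    then have "t u \<otimes> (inv (t u) \<otimes> u) = u" by simp
    then show ?thesis using c by (simp add: \<gamma>_def m_assoc)
  qed
  define B where "B = {\<gamma> x s |x s. x \<in> X \<and> s \<in> T} - {\<one>}"
  define B0 where "B0 = {\<gamma> x s |x s. s \<in> T \<and> (x, s) \<in> D} - {\<one>}"
  have BJ: "B \<subseteq> J" using \<gamma>_J TL by (auto simp: B_def)
  have Jc: "J \<subseteq> carrier G" using subgroup.subset[OF J(1)] .
  have B0B: "B0 \<subseteq> B" by (auto simp: B_def B0_def D_def)
  have genI: "\<gamma> x s \<in> generate G C" if "\<gamma> x s \<noteq> \<one> \<Longrightarrow> \<gamma> x s \<in> C" for x s C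
    using that generate.one[of G C] generate.incl[of "\<gamma> x s" C G] by (cases "\<gamma> x s = \<one>") auto
  have genJ: "generate G B = J"
  proof (rule generateI[symmetric])
    fix K assume K: "subgroup K G" "B \<subseteq> K"
    have "inv (t u) \<otimes> u \<in> K" if "u \<in> L" for u
    proof -
      have "u \<in> generate G X" using that L by simp
      then show ?thesis using X
      proof (induction rule: generate_induct_iff)
        case one
        show ?case using t_T[OF one_T] subgroup.one_closed[OF K(1)] by simp
      next
        case (step x u)
        then have uL: "u \<in> L" using L by simp
        have "\<gamma> x (t u) \<in> generate G B"
          by (rule genI) (use t(1)[OF uL] step(1) in \<open>auto simp: B_def\<close>)
        then have "\<gamma> x u \<in> generate G B" using \<gamma>_t[OF step(1) uL] by simp
        then have "\<gamma> x u \<in> K" using generate_subgroup_incl[OF K(2,1)] by blast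
        then show ?case
          using \<gamma>_step[OF step(1) uL] generate_coset_step[OF K(1)] uL tL Lc by simp
      qed
    qed
    moreover have "t u = \<one>" if "u \<in> J" for u
      using that J(2) Jc one_T by (intro t_eq) auto
    ultimately show "J \<subseteq> K" using J(2) Jc by fastforce
  qed (use J BJ in auto)
  have free: "free_basis G J B"
  proof (rule free_basis_if_maps_extend[OF _ genJ])
    show "B \<subseteq> carrier G" using BJ Jc by blast
    fix n and f :: "'a \<Rightarrow> nat \<Rightarrow> nat"
    assume f: "\<And>b. f b \<in> perms n"
    define c where "c x u = (if \<gamma> x u = \<one> then id else f (\<gamma> x u))" for x u
    have "\<exists>h. h \<one> = id \<and> (\<forall>u\<in>L. h u \<in> perms n) \<and> (\<forall>x\<in>X. \<forall>u\<in>L. h (x \<otimes> u) = c x u \<circ> h u)"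
      by (rule free_basis_cocycle[OF basis sym_group_is_group, where c = c,
          unfolded sym_group_mult sym_group_one]) (simp add: c_def f)
    then obtain h where "h \<one> = id \<and> (\<forall>u\<in>L. h u \<in> perms n) \<and> (\<forall>x\<in>X. \<forall>u\<in>L. h (x \<otimes> u) = c x u \<circ> h u)" ..
    then have h1: "h \<one> = id" and hp: "\<And>u. u \<in> L \<Longrightarrow> h u \<in> perms n"
      and hs: "\<And>x u. x \<in> X \<Longrightarrow> u \<in> L \<Longrightarrow> h (x \<otimes> u) = c x u \<circ> h u" by auto
    have c_inj: "inj (c x u)" for x u using perms_inj[OF f] by (auto simp: c_def)
    have hm: "h (u \<otimes> j) = h u \<circ> h j" if u: "u \<in> L" and j: "j \<in> J" for u j
    proof -
      have "u \<in> generate G X" using u L by simp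
      then show ?thesis using X
      proof (induction rule: generate_induct_iff)
        case one
        show ?case using h1 j Jc by auto
      next
        case (step x u)
        then have uL: "u \<in> L" "u \<otimes> j \<in> L" using L Lm J(2) j by auto
        have cc: "x \<in> carrier G" "u \<in> carrier G" "j \<in> carrier G" using step Xc Lc uL j Jc by auto
        have "inv u \<otimes> (u \<otimes> j) \<in> J" using cc j by simp
        then have "c x (u \<otimes> j) = c x u" using \<gamma>_cong[OF step(1) uL] by (simp add: c_def)
        then have "h (x \<otimes> u \<otimes> j) = c x u \<circ> h (u \<otimes> j)" using hs[OF step(1) uL(2)] cc by (simp add: m_assoc)
        then show ?case using hs[OF step(1) uL(1)] c_inj by (auto simp: fun_eq_iff inj_eq)
      qed
    qed
    have hT: "h s = id" if "s \<in> T" for s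
      using T(3) that
    proof (induction rule: cayley_connected_induct)
      case (step x s)
      have "\<gamma> x s = \<one>" using t_T step TL Lc by (auto simp: \<gamma>_def)
      then show ?case using hs[of x s] step by (auto simp: c_def)
    qed (rule h1)
    show "\<exists>\<phi>\<in>perm_homs G J n. \<forall>b\<in>B. \<phi> b = f b"
    proof (intro bexI ballI)
      show "restrict h J \<in> perm_homs G J n"
        using hp hm J(2) subgroup.m_closed[OF J(1)] by (auto simp: perm_homs_iff subset_eq)
      fix b assume b: "b \<in> B"
      then obtain x s where xs: "b = \<gamma> x s" "x \<in> X" "s \<in> T" "b \<noteq> \<one>" by (auto simp: B_def)
      then have sL: "s \<in> L" "x \<otimes> s \<in> L" using TL xu by auto
      have "x \<otimes> s = t (x \<otimes> s) \<otimes> \<gamma> x s"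
        using t_T[OF xs(3)] sL tL Lc xs(2) Xc by (simp add: \<gamma>_def)
      then have "h (x \<otimes> s) = h (t (x \<otimes> s)) \<circ> h (\<gamma> x s)"
        using hm[OF tL[OF sL(2)] \<gamma>_J[OF xs(2) sL(1)]] by metis
      then have "h (\<gamma> x s) = h (x \<otimes> s)" using hT t(1)[OF sL(2)] by simp
      also have "\<dots> = c x s" using hs[OF xs(2) sL(1)] hT[OF xs(3)] by simp
      also have "\<dots> = f b" using xs by (simp add: c_def)
      finally show "restrict h J b = f b" using xs(1) b BJ by auto
    qed
  qed
  let ?JW = "supported_part G W J"
  have Wc: "W \<subseteq> carrier G" using W(1) Lc by auto
  note subJW = supported_part_subgroup[OF Wc, of J]
  have gen0: "generate G B0 = ?JW"
  proof (rule generateI[symmetric])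
    show "subgroup ?JW G" by (rule subJW)
    have key: "\<forall>w\<in>W. inv s \<otimes> w \<in> J \<longrightarrow> inv s \<otimes> w \<in> ?JW" if "s \<in> T1" for s
      using T1(3) that
    proof (induction rule: cayley_connected_induct)
      case one
      show ?case using supported_part_member[of \<one> W] cayley_connected_one[OF W(2)] by auto
    next
      case (step x s)
      then obtain v where v: "x \<in> X" "s \<in> L" "v \<in> W" "x \<otimes> v \<in> W" "inv v \<otimes> s \<in> J" by (auto simp: D_def)
      have cc: "x \<in> carrier G" "s \<in> carrier G" "v \<in> carrier G" using v Xc Lc Wc by auto
      have sv: "inv s \<otimes> v \<in> J" using coset_sym[OF J(1) cc(3,2) v(5)] .
      have xsv: "inv (x \<otimes> s) \<otimes> (x \<otimes> v) = inv s \<otimes> v" using cc by (simp add: inv_mult_cancel_left)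
      show ?case
      proof (intro iffI ballI impI)
        fix w assume P: "\<forall>w\<in>W. inv s \<otimes> w \<in> J \<longrightarrow> inv s \<otimes> w \<in> ?JW" and w: "w \<in> W" "inv (x \<otimes> s) \<otimes> w \<in> J"
        have "inv (x \<otimes> v) \<otimes> w \<in> J"
          using coset_trans[OF J(1) _ _ _ coset_sym[OF J(1)] w(2), of "x \<otimes> v"] xsv sv cc w Wc by auto
        then have "inv (x \<otimes> v) \<otimes> w \<in> ?JW" using supported_part_member v w by blast
        moreover have "inv (x \<otimes> s) \<otimes> (x \<otimes> v) \<in> ?JW" using P v(3) sv xsv by auto
        ultimately show "inv (x \<otimes> s) \<otimes> w \<in> ?JW" using coset_trans[OF subJW, of "x \<otimes> s" "x \<otimes> v" w] cc w Wc by auto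
      next
        fix w assume P: "\<forall>w\<in>W. inv (x \<otimes> s) \<otimes> w \<in> J \<longrightarrow> inv (x \<otimes> s) \<otimes> w \<in> ?JW" and w: "w \<in> W" "inv s \<otimes> w \<in> J"
        have "inv v \<otimes> w \<in> J" using coset_trans[OF J(1) _ _ _ v(5) w(2)] cc w Wc by auto
        then have "inv v \<otimes> w \<in> ?JW" using supported_part_member v w by blast
        moreover have "inv s \<otimes> v \<in> ?JW" using P v(4) sv xsv by auto
        ultimately show "inv s \<otimes> w \<in> ?JW" using coset_trans[OF subJW, of s v w] cc w Wc by auto
      qed
    qed
    show "B0 \<subseteq> ?JW"
    proof
      fix b assume "b \<in> B0"
      then obtain x s where xs: "b = \<gamma> x s" "s \<in> T" "(x, s) \<in> D" by (auto simp: B0_def)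
      then obtain w where w: "x \<in> X" "s \<in> L" "w \<in> W" "x \<otimes> w \<in> W" "inv w \<otimes> s \<in> J" by (auto simp: D_def)
      have wL: "w \<in> L" "x \<otimes> w \<in> L" using w W(1) by auto
      have in1: "inv (t w) \<otimes> w \<in> ?JW" using key[OF t_W[OF w(3)]] w(3) t(2)[OF wL(1)] by blast
      have in2: "inv (t (x \<otimes> w)) \<otimes> (x \<otimes> w) \<in> ?JW" using key[OF t_W[OF w(4)]] w(4) t(2)[OF wL(2)] by blast
      have "\<gamma> x w \<otimes> (inv (t w) \<otimes> w) \<in> ?JW" using in2 \<gamma>_step[OF w(1) wL(1)] by simp
      then have "\<gamma> x w \<otimes> (inv (t w) \<otimes> w) \<otimes> inv (inv (t w) \<otimes> w) \<in> ?JW"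
        using in1 subgroup.m_closed[OF subJW] subgroup.m_inv_closed[OF subJW] by blast
      moreover have "\<gamma> x w \<in> carrier G" "inv (t w) \<otimes> w \<in> carrier G"
        using \<gamma>_J[OF w(1) wL(1)] Jc wL tL Lc by auto
      ultimately have "\<gamma> x w \<in> ?JW" by (simp add: m_assoc)
      then show "b \<in> ?JW" using \<gamma>_cong[OF w(1) wL(1) w(2,5)] xs(1) by simp
    qed
    fix K assume K: "subgroup K G" "B0 \<subseteq> K"
    have inK: "inv (t w) \<otimes> w \<in> K" if "w \<in> W" for w
      using W(2) that
    proof (induction rule: cayley_connected_induct)
      case one
      show ?case using t_T[OF one_T] subgroup.one_closed[OF K(1)] by simp
    next
      case (step x w)
      then have wL: "w \<in> L" "x \<in> X" using W(1) by auto
      have "(x, t w) \<in> D"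
        using step wL tL coset_sym[OF J(1) _ _ t(2)[OF wL(1)]] Lc by (auto simp: D_def)
      then have "\<gamma> x (t w) \<in> generate G B0"
        by (intro genI) (use t(1)[OF wL(1)] in \<open>auto simp: B0_def\<close>)
      then have "\<gamma> x w \<in> generate G B0" using \<gamma>_t[OF wL(2,1)] by simp
      then have "\<gamma> x w \<in> K" using generate_subgroup_incl[OF K(2,1)] by blast
      then show ?case using \<gamma>_step[OF wL(2,1)] generate_coset_step[OF K(1)] wL tL Lc by simp
    qed
    show "?JW \<subseteq> K"
      unfolding supported_part_def
    proof (rule generate_subgroup_incl[OF _ K(1)], clarify)
      fix u v assume uv: "u \<in> W" "v \<in> W" "inv u \<otimes> v \<in> J"
      then have L: "u \<in> L" "v \<in> L" using W(1) by auto
      have "t u = t v" using t_cong[OF L uv(3)] .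
      then have "inv u \<otimes> t u \<in> K" "inv (t u) \<otimes> v \<in> K"
        using inK[OF uv(1)] inK[OF uv(2)] coset_sym[OF K(1)] L tL Lc by auto
      then show "inv u \<otimes> v \<in> K" using coset_trans[OF K(1), of u "t u" v] L tL Lc by auto
    qed
  qed
  show ?thesis using free B0B gen0 by blast
qed

end

locale free_group_with_basis = group +
  fixes X :: "'a set"
  assumes basis: "free_basis G (carrier G) X"
begin

lemma X_carrier: "X \<subseteq> carrier G"
  using basis by (simp add: free_basis_def)

lemma subgroup_has_basis:
  assumes "subgroup J G"
  shows "\<exists>B. free_basis G J B"
proof -
  have "cayley_connected G (X \<times> UNIV) {\<one>}" by (rule cayley_connectedI) auto
  from nielsen_schreier[OF basis assms subgroup.subset[OF assms] _ this] show ?thesis by auto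
qed

lemma free_factor_iff:
  assumes J: "subgroup J G"
  shows "free_factor G H J \<longleftrightarrow> (\<exists>B B0. free_basis G J B \<and> B0 \<subseteq> B \<and> generate G B0 = H)"
proof
  assume "free_factor G H J"
  then obtain K where K: "free_product_of G J H K" by (auto simp: free_factor_def)
  then have sub: "subgroup H G" "subgroup K G" by (auto simp: free_product_of_def)
  obtain B C where B: "free_basis G H B" "free_basis G K C"
    using subgroup_has_basis sub by blast
  have "free_basis G J (B \<union> C)" by (rule free_basis_Un[OF K B])
  moreover have "generate G B = H" using B by (simp add: free_basis_def)
  ultimately show "\<exists>B B0. free_basis G J B \<and> B0 \<subseteq> B \<and> generate G B0 = H" by blast
next
  assume "\<exists>B B0. free_basis G J B \<and> B0 \<subseteq> B \<and> generate G B0 = H"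
  then obtain B B0 where "free_basis G J B" "B0 \<subseteq> B" "generate G B0 = H" by blast
  then show "free_factor G H J"
    using free_product_of_subbasis[of J B B0] by (auto simp: free_factor_def)
qed

lemma free_factor_subgroup:
  assumes "free_factor G H J"
  shows "subgroup H G" "H \<subseteq> J"
  using assms by (auto simp: free_factor_def free_product_of_def intro: generate.incl)

lemma free_factor_refl:
  assumes "subgroup J G"
  shows "free_factor G J J"
proof -
  obtain B where "free_basis G J B" using subgroup_has_basis[OF assms] by blast
  moreover from this have "generate G B = J" by (simp add: free_basis_def)
  ultimately show ?thesis using free_factor_iff[OF assms] by blast
qed

text \<open>A basis of \<open>H\<close> is enlarged to one of \<open>M\<close>, and that to one of \<open>J\<close>.\<close>

lemma free_factor_trans:
  assumes "free_factor G H M" "free_factor G M J" "subgroup J G"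
  shows "free_factor G H J"
proof -
  obtain K where K: "free_product_of G J M K" using assms(2) by (auto simp: free_factor_def)
  have sub: "subgroup M G" "subgroup K G" using K by (auto simp: free_product_of_def)
  obtain B B0 where B: "free_basis G M B" "B0 \<subseteq> B" "generate G B0 = H"
    using assms(1) free_factor_iff[OF sub(1)] by blast
  obtain C where "free_basis G K C" using subgroup_has_basis sub(2) by blast
  then have "free_basis G J (B \<union> C)" using free_basis_Un[OF K B(1)] by blast
  then show ?thesis using B(2,3) free_factor_iff[OF assms(3)] by blast
qed

lemma supported_part_free_factor:
  assumes "subgroup J G" "W \<subseteq> carrier G" "cayley_connected G (X \<times> UNIV) W"
  shows "free_factor G (supported_part G W J) J"
  using nielsen_schreier[OF basis assms(1) subgroup.subset[OF assms(1)] assms(2,3)]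
    free_factor_iff[OF assms(1)] by blast

text \<open>Let \<open>B0\<close> be the part of a basis of \<open>J\<close> that generates \<open>H\<close>. In the Schreier graph of the
  intermediate group \<open>M\<close> with respect to this basis, the letters of \<open>B0\<close> are loops at the base
  point, so a Schreier basis of \<open>M\<close> contains them.\<close>

lemma free_factor_intermediate:
  assumes HJ: "free_factor G H J" and J: "subgroup J G" and M: "subgroup M G" "H \<subseteq> M" "M \<subseteq> J"
  shows "free_factor G H M"
proof -
  obtain B B0 where B: "free_basis G J B" "B0 \<subseteq> B" "generate G B0 = H"
    using HJ free_factor_iff[OF J] by blast
  have subH: "subgroup H G" using free_factor_subgroup[OF HJ] by blast
  have Bc: "B \<subseteq> carrier G" "B \<subseteq> J" using B(1) by (auto simp: free_basis_def intro: generate.incl)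
  have B0H: "B0 \<subseteq> H" using B(3) by (auto intro: generate.incl)
  let ?W = "insert \<one> B0"
  have WH: "?W \<subseteq> H" using B0H subgroup.one_closed[OF subH] by blast
  have "cayley_connected G (B \<times> UNIV) ?W"
  proof (rule cayley_connectedI)
    fix P u assume P: "P \<one>"
      "\<And>x u. (x, u) \<in> B \<times> UNIV \<Longrightarrow> u \<in> ?W \<Longrightarrow> x \<otimes> u \<in> ?W \<Longrightarrow> P u \<longleftrightarrow> P (x \<otimes> u)" "u \<in> ?W"
    show "P u"
    proof (cases "u = \<one>")
      case False
      then have "u \<in> B0" "u \<in> carrier G" using P(3) B(2) Bc by auto
      then show ?thesis using P(1) P(2)[of u \<one>] B(2) by auto
    qed (use P(1) in simp)
  qed simp
  moreover have "?W \<subseteq> J" using WH M by blast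
  ultimately obtain C C0 where C: "free_basis G M C" "C0 \<subseteq> C" "generate G C0 = supported_part G ?W M"
    using nielsen_schreier[OF B(1) M(1,3)] by blast
  have "supported_part G ?W M = H"
    unfolding supported_part_def
  proof (rule generateI[symmetric])
    show "subgroup H G" by (rule subH)
    have "inv u \<otimes> v \<in> H" if "u \<in> ?W" "v \<in> ?W" for u v
      using that WH subgroup.m_closed[OF subH] subgroup.m_inv_closed[OF subH] by blast
    then show "{inv u \<otimes> v |u v. u \<in> ?W \<and> v \<in> ?W \<and> inv u \<otimes> v \<in> M} \<subseteq> H" by blast
    fix K assume K: "subgroup K G" "{inv u \<otimes> v |u v. u \<in> ?W \<and> v \<in> ?W \<and> inv u \<otimes> v \<in> M} \<subseteq> K"
    have "b \<in> K" if "b \<in> B0" for b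
    proof -
      have "inv \<one> \<otimes> b = b" "b \<in> M" using that B(2) Bc B0H M(2) by auto
      then have "b \<in> {inv u \<otimes> v |u v. u \<in> ?W \<and> v \<in> ?W \<and> inv u \<otimes> v \<in> M}"
        using that by (intro CollectI exI[of _ \<one>] exI[of _ b]) auto
      then show ?thesis using K(2) by blast
    qed
    then show "H \<subseteq> K" using generate_subgroup_incl[OF _ K(1), of B0] B(3) by blast
  qed
  then show ?thesis using C free_factor_iff[OF M(1)] by blast
qed

lemma rk_basis:
  assumes "subgroup J G" "rk G J = enat r"
  obtains B where "free_basis G J B" "finite B" "card B = r"
proof -
  obtain B where B: "free_basis G J B" using subgroup_has_basis[OF assms(1)] by blast
  then show ?thesis using that rk_eq_card[OF B] assms(2) by (auto split: if_splits)
qed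

lemma rk_le_card_generators:
  assumes "finite S" "S \<subseteq> carrier G" "generate G S = J"
  shows "rk G J \<le> enat (card S)"
proof -
  have "subgroup J G" using assms generate_is_subgroup by auto
  then obtain B where B: "free_basis G J B" using subgroup_has_basis by blast
  show ?thesis using rk_eq_card[OF B] basis_card_le_generators[OF B assms] by simp
qed

lemma free_factor_rk_le:
  assumes "free_factor G M J" "subgroup J G"
  shows "rk G M \<le> rk G J"
proof -
  obtain B B0 where B: "free_basis G J B" "B0 \<subseteq> B" "generate G B0 = M"
    using assms free_factor_iff by blast
  have "free_basis G M B0" using free_basis_subset[OF B(1,2)] B(3) by simp
  then show ?thesis
    using rk_eq_card[OF B(1)] rk_eq_card[of M B0] B(2) finite_subset[OF B(2)] card_mono[OF _ B(2)] by auto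
qed

lemma free_factor_rk_eq:
  assumes "free_factor G M J" "subgroup J G" "rk G M = rk G J" "rk G J \<noteq> \<infinity>"
  shows "M = J"
proof -
  obtain B B0 where B: "free_basis G J B" "B0 \<subseteq> B" "generate G B0 = M"
    using assms free_factor_iff by blast
  have "free_basis G M B0" using free_basis_subset[OF B(1,2)] B(3) by simp
  then have "finite B" "card B0 = card B"
    using rk_eq_card[OF B(1)] rk_eq_card[of M B0] assms(3,4) by (auto split: if_splits)
  then have "B0 = B" using B(2) card_subset_eq by blast
  then show ?thesis using B by (simp add: free_basis_def)
qed

lemma generate_Un_generate:
  assumes "B \<subseteq> carrier G" "S \<subseteq> carrier G" "generate G B = M"
  shows "generate G (B \<union> S) = generate G (M \<union> S)"
proof (rule generateI)
  have M: "M \<subseteq> carrier G" using assms(1,3) generate_incl by blast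
  show "subgroup (generate G (B \<union> S)) G" using assms by (intro generate_is_subgroup) auto
  show "M \<union> S \<subseteq> generate G (B \<union> S)"
    using mono_generate[of B "B \<union> S"] assms(3) by (auto intro: generate.incl)
  fix K assume K: "subgroup K G" "M \<union> S \<subseteq> K"
  then have "B \<union> S \<subseteq> K" using assms(3) by (auto intro: generate.incl)
  then show "generate G (B \<union> S) \<subseteq> K" using generate_subgroup_incl K(1) by blast
qed

text \<open>A basis of \<open>M\<close> and \<open>S\<close> together generate; if their number equals the rank then they form a basis, by the
  Hopf property.\<close>

lemma rk_generate_Un_le:
  assumes M: "subgroup M G" "rk G M = enat r" and S: "finite S" "S \<subseteq> carrier G"
  shows "rk G (generate G (M \<union> S)) \<le> enat (r + card S)"
    and "rk G (generate G (M \<union> S)) = enat (r + card S) \<Longrightarrow> free_factor G M (generate G (M \<union> S))"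
proof -
  obtain B where B: "free_basis G M B" "finite B" "card B = r" using rk_basis[OF M] by blast
  let ?J = "generate G (M \<union> S)"
  have gB: "generate G B = M" "B \<subseteq> carrier G" using B(1) by (auto simp: free_basis_def)
  have gen: "generate G (B \<union> S) = ?J" using generate_Un_generate[OF gB(2) S(2) gB(1)] .
  have BS: "finite (B \<union> S)" "B \<union> S \<subseteq> carrier G" using B(2) S gB(2) by auto
  have le: "card (B \<union> S) \<le> r + card S" using card_Un_le[of B S] B(3) by simp
  have "rk G ?J \<le> enat (card (B \<union> S))" by (rule rk_le_card_generators[OF BS gen])
  also have "\<dots> \<le> enat (r + card S)" using le by simp
  finally show "rk G ?J \<le> enat (r + card S)" .
  assume eq: "rk G ?J = enat (r + card S)"
  have sub: "subgroup ?J G" using gen generate_is_subgroup[OF BS(2)] by simp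
  obtain C where C: "free_basis G ?J C" "finite C" "card C = r + card S" using rk_basis[OF sub eq] .
  have "free_basis G ?J (B \<union> S)" using free_basis_if_card_le[OF C(1,2) BS gen] le C(3) by simp
  then show "free_factor G M ?J" using free_factor_iff[OF sub] gB(1) by blast
qed

end

section \<open>Random coverings of a finite piece of a Schreier graph\<close>

lemma inj_comp_eq: "inj p \<Longrightarrow> p \<circ> f = p \<circ> g \<longleftrightarrow> f = g"
  by (auto simp: fun_eq_iff inj_eq)

text \<open>Coverings are counted over a finite connected piece \<open>W\<close> of the Cayley tree. A subgroup \<open>N\<close> folds it
  to a finite graph, with vertices \<open>verts N\<close> and edges \<open>edges N\<close>, and \<open>N\<close> is spanned if it is the fundamental
  group of that graph. Attaching a permutation of \<open>{1..n}\<close> to each edge describes an \<open>n\<close>-sheeted covering.\<close>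

locale cayley_window = free_group_with_basis +
  fixes W :: "'a set"
  assumes finite_W: "finite W" and W_carrier: "W \<subseteq> carrier G" and X_W: "X \<subseteq> W"
    and W_connected: "cayley_connected G (X \<times> UNIV) W"
begin

definition window_edges :: "('a \<times> 'a) set" where
  "window_edges = {(x, u). x \<in> X \<and> u \<in> W \<and> x \<otimes> u \<in> W}"

definition verts :: "'a set \<Rightarrow> 'a set set" where
  "verts N = (\<lambda>u. u <# N) ` W"

definition edges :: "'a set \<Rightarrow> ('a \<times> 'a set) set" where
  "edges N = (\<lambda>(x, u). (x, u <# N)) ` window_edges"

definition spanned :: "'a set \<Rightarrow> bool" where
  "spanned N \<longleftrightarrow> subgroup N G \<and> supported_part G W N = N"

text \<open>The transport of sheets along the path from \<open>\<one>\<close> to \<open>u\<close>. Edges of the Schreier graph outside the image of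
  the window carry the identity, so that the transport is defined on the whole group and restricts
  to a homomorphism on \<open>N\<close>.\<close>

definition holonomy :: "'a set \<Rightarrow> nat \<Rightarrow> ('a \<times> 'a set \<Rightarrow> nat \<Rightarrow> nat) \<Rightarrow> 'a \<Rightarrow> nat \<Rightarrow> nat" where
  "holonomy N n a = (SOME h. h \<one> = id \<and> (\<forall>u\<in>carrier G. h u \<in> perms n) \<and>
     (\<forall>x\<in>X. \<forall>u\<in>carrier G. h (x \<otimes> u) =
        (if (x, u <# N) \<in> edges N then a (x, u <# N) else id) \<circ> h u))"

abbreviation connections :: "'a set \<Rightarrow> nat \<Rightarrow> ('a \<times> 'a set \<Rightarrow> nat \<Rightarrow> nat) set" where
  "connections N n \<equiv> edges N \<rightarrow>\<^sub>E perms n"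

lemma one_W: "\<one> \<in> W"
  using cayley_connected_one[OF W_connected] .

lemma W_closed: "u \<in> W \<Longrightarrow> u \<in> carrier G"
  using W_carrier by blast

lemma X_closed: "x \<in> X \<Longrightarrow> x \<in> carrier G"
  using X_carrier by blast

lemma finite_window_edges: "finite window_edges"
  by (rule finite_subset[of _ "W \<times> W"]) (use X_W finite_W in \<open>auto simp: window_edges_def\<close>)

lemma finite_verts: "finite (verts N)" and finite_edges: "finite (edges N)"
  using finite_W finite_window_edges by (auto simp: verts_def edges_def)

lemma window_edges_induct [consumes 1, case_names one step]:
  assumes "u \<in> W" "P \<one>"
    and "\<And>x u. (x, u) \<in> window_edges \<Longrightarrow> P u \<longleftrightarrow> P (x \<otimes> u)"
  shows "P u"
  using W_connected assms(1,2)
  by (rule cayley_connected_induct) (use assms(3) in \<open>auto simp: window_edges_def\<close>)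

lemma window_edgesD:
  assumes "(x, u) \<in> window_edges"
  shows "x \<in> X" "u \<in> W" "x \<otimes> u \<in> W" "x \<in> carrier G" "u \<in> carrier G"
  using assms W_closed X_closed by (auto simp: window_edges_def)

lemma edgesI: "(x, u) \<in> window_edges \<Longrightarrow> (x, u <# N) \<in> edges N"
  by (auto simp: edges_def)

lemma l_coset_eq_iff:
  assumes N: "subgroup N G" and u: "u \<in> carrier G" "v \<in> carrier G"
  shows "u <# N = v <# N \<longleftrightarrow> inv u \<otimes> v \<in> N"
proof
  assume "u <# N = v <# N"
  moreover have "v \<in> v <# N" using u subgroup.one_closed[OF N] by (auto simp: l_coset_def intro!: bexI[of _ \<one>])
  ultimately have "v \<in> u <# N" by simp
  then obtain h where "h \<in> N" "v = u \<otimes> h" by (auto simp: l_coset_def)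
  then show "inv u \<otimes> v \<in> N" using u subgroup.mem_carrier[OF N] by simp
next
  assume uv: "inv u \<otimes> v \<in> N"
  have "a <# N \<subseteq> b <# N" if ab: "inv b \<otimes> a \<in> N" "a \<in> carrier G" "b \<in> carrier G" for a b
  proof
    fix w assume "w \<in> a <# N"
    then obtain h where h: "h \<in> N" "w = a \<otimes> h" by (auto simp: l_coset_def)
    have "w = b \<otimes> (inv b \<otimes> a \<otimes> h)" using h ab subgroup.mem_carrier[OF N h(1)] by (simp add: m_assoc)
    then show "w \<in> b <# N" using subgroup.m_closed[OF N ab(1) h(1)] by (auto simp: l_coset_def)
  qed
  then show "u <# N = v <# N" using uv coset_sym[OF N u uv] u by blast
qed

lemma one_l_coset: "subgroup N G \<Longrightarrow> \<one> <# N = N"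
  using subgroup.mem_carrier by (force simp: l_coset_def)

lemma l_coset_mult:
  "subgroup N G \<Longrightarrow> u \<in> carrier G \<Longrightarrow> h \<in> N \<Longrightarrow> (u \<otimes> h) <# N = u <# N"
  using l_coset_eq_iff[of N u "u \<otimes> h"] subgroup.mem_carrier[of N G h] by auto

lemma l_coset_left_mult:
  "subgroup N G \<Longrightarrow> x \<in> carrier G \<Longrightarrow> u \<in> carrier G \<Longrightarrow> v \<in> carrier G \<Longrightarrow>
   u <# N = v <# N \<Longrightarrow> (x \<otimes> u) <# N = (x \<otimes> v) <# N"
  by (simp add: l_coset_eq_iff inv_mult_cancel_left)

lemma vertex_representatives:
  assumes N: "subgroup N G"
  shows "\<exists>t. t N = \<one> \<and> (\<forall>v\<in>verts N. t v \<in> W \<and> t v <# N = v)"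
proof -
  define t where "t v = (if v = N then \<one> else SOME u. u \<in> W \<and> u <# N = v)" for v
  have "t v \<in> W \<and> t v <# N = v" if v: "v \<in> verts N" for v
  proof -
    obtain u where u: "u \<in> W \<and> u <# N = v" using v by (auto simp: verts_def)
    have "(SOME u. u \<in> W \<and> u <# N = v) \<in> W \<and> (SOME u. u \<in> W \<and> u <# N = v) <# N = v"
      by (rule someI[of "\<lambda>u. u \<in> W \<and> u <# N = v", OF u])
    then show ?thesis using one_W one_l_coset[OF N] by (auto simp: t_def)
  qed
  moreover have "t N = \<one>" by (simp add: t_def)
  ultimately show ?thesis by blast
qed

lemma N_in_verts: "subgroup N G \<Longrightarrow> N \<in> verts N"
  unfolding verts_def using one_W one_l_coset by (intro image_eqI[of _ _ \<one>]) auto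

context
  fixes N :: "'a set" and n :: nat and a :: "'a \<times> 'a set \<Rightarrow> nat \<Rightarrow> nat"
  assumes N: "subgroup N G" and a: "a \<in> connections N n"
begin

lemma holonomy_props:
  "holonomy N n a \<one> = id \<and> (\<forall>u\<in>carrier G. holonomy N n a u \<in> perms n) \<and>
     (\<forall>x\<in>X. \<forall>u\<in>carrier G. holonomy N n a (x \<otimes> u) =
        (if (x, u <# N) \<in> edges N then a (x, u <# N) else id) \<circ> holonomy N n a u)"
proof -
  have ex: "\<exists>h. h \<one> = id \<and> (\<forall>u\<in>carrier G. h u \<in> perms n) \<and>
     (\<forall>x\<in>X. \<forall>u\<in>carrier G. h (x \<otimes> u) =
        (if (x, u <# N) \<in> edges N then a (x, u <# N) else id) \<circ> h u)"
    by (rule free_basis_cocycle[OF basis sym_group_is_group,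
          where c = "\<lambda>x u. if (x, u <# N) \<in> edges N then a (x, u <# N) else id",
          unfolded sym_group_mult sym_group_one]) (use a in \<open>auto simp: PiE_iff\<close>)
  show ?thesis unfolding holonomy_def by (rule someI_ex[OF ex])
qed

lemma holonomy_one: "holonomy N n a \<one> = id"
  using holonomy_props by blast

lemma holonomy_perms: "u \<in> carrier G \<Longrightarrow> holonomy N n a u \<in> perms n"
  using holonomy_props by blast

lemma holonomy_step:
  "x \<in> X \<Longrightarrow> u \<in> carrier G \<Longrightarrow> (x, u <# N) \<in> edges N \<Longrightarrow>
   holonomy N n a (x \<otimes> u) = a (x, u <# N) \<circ> holonomy N n a u"
  using holonomy_props by simp

lemma holonomy_edge:
  assumes "(x, u) \<in> window_edges"
  shows "holonomy N n a (x \<otimes> u) = a (x, u <# N) \<circ> holonomy N n a u"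
  using holonomy_step[OF window_edgesD(1,5)[OF assms] edgesI[OF assms]] .

lemma connection_perms: "e \<in> edges N \<Longrightarrow> a e \<in> perms n"
  using a by (auto simp: PiE_iff)

lemma holonomy_mult:
  assumes u: "u \<in> carrier G" and h: "h \<in> N"
  shows "holonomy N n a (u \<otimes> h) = holonomy N n a u \<circ> holonomy N n a h"
proof -
  have hc: "h \<in> carrier G" using subgroup.mem_carrier[OF N h] .
  have "u \<in> generate G X" using u basis by (simp add: free_basis_def)
  then show ?thesis using X_carrier
  proof (induction rule: generate_induct_iff)
    case one
    show ?case using holonomy_one hc by simp
  next
    case (step x u)
    then have uc: "u \<in> carrier G" "x \<in> carrier G" using generate_in_carrier[OF X_carrier] X_closed by auto
    define c where "c = (if (x, u <# N) \<in> edges N then a (x, u <# N) else id)"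
    have "inj c" using perms_inj[OF connection_perms] by (auto simp: c_def)
    moreover have "holonomy N n a (x \<otimes> u) = c \<circ> holonomy N n a u"
      using holonomy_props step(1) uc by (simp add: c_def)
    moreover have "holonomy N n a (x \<otimes> (u \<otimes> h)) = c \<circ> holonomy N n a (u \<otimes> h)"
      using holonomy_props step(1) uc hc l_coset_mult[OF N uc(1) h] by (simp add: c_def)
    ultimately show ?case using uc hc by (auto simp: m_assoc fun_eq_iff inj_eq)
  qed
qed

lemma holonomy_perm_homs: "restrict (holonomy N n a) N \<in> perm_homs G N n"
  using holonomy_perms holonomy_mult subgroup.mem_carrier[OF N] subgroup.m_closed[OF N]
  by (auto simp: perm_homs_iff)

lemma holonomy_quotient:
  assumes "u \<in> carrier G" "v \<in> carrier G" "inv u \<otimes> v \<in> N"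
  shows "holonomy N n a v = holonomy N n a u \<circ> holonomy N n a (inv u \<otimes> v)"
  using holonomy_mult[OF assms(1,3)] assms(1,2) by simp

end

text \<open>A connection is determined by its holonomy representation of \<open>N\<close> at the base point and by
  the transport to each other vertex along a chosen path; both can be prescribed. Hence a uniform
  connection induces a uniform homomorphism.\<close>

lemma connections_bij:
  assumes sp: "spanned N"
  shows "\<exists>\<Phi>. bij_betw (\<lambda>a. (restrict (holonomy N n a) N, \<Phi> a)) (connections N n)
    (perm_homs G N n \<times> (verts N - {N} \<rightarrow>\<^sub>E perms n))"
proof -
  have N: "subgroup N G" and gen: "supported_part G W N = N" using sp by (auto simp: spanned_def)
  have Nc: "h \<in> carrier G" if "h \<in> N" for h using subgroup.mem_carrier[OF N that] .
  let ?h = "holonomy N n"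
  obtain t where tN: "t N = \<one>" and t': "\<forall>v\<in>verts N. t v \<in> W \<and> t v <# N = v"
    using vertex_representatives[OF N] by blast
  have t: "t v \<in> W" "t v <# N = v" if "v \<in> verts N" for v using t' that by auto
  have tc: "t v \<in> carrier G" if "v \<in> verts N" for v using W_closed t(1) that by blast
  have t_coset: "inv (t (u <# N)) \<otimes> u \<in> N" if "u \<in> W" for u
  proof -
    have v: "u <# N \<in> verts N" using that by (auto simp: verts_def)
    show ?thesis using t(2)[OF v] l_coset_eq_iff[OF N tc[OF v] W_closed[OF that]] by simp
  qed
  define \<Phi> where "\<Phi> a = (\<lambda>v\<in>verts N - {N}. ?h a (t v))" for a
  define ex where "ex g v = (if v = N then id else g v)" for g :: "'a set \<Rightarrow> nat \<Rightarrow> nat" and v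
  define \<Psi> where "\<Psi> = (\<lambda>(\<phi>, g). \<lambda>(x, v)\<in>edges N. ex g ((x \<otimes> t v) <# N) \<circ>
     \<phi> (inv (t ((x \<otimes> t v) <# N)) \<otimes> (x \<otimes> t v)) \<circ> inv' (ex g v))"
  have ev: "v \<in> verts N" "(x \<otimes> t v) <# N \<in> verts N" "x \<in> X"
    "inv (t ((x \<otimes> t v) <# N)) \<otimes> (x \<otimes> t v) \<in> N" if e: "(x, v) \<in> edges N" for x v
  proof -
    obtain u where u: "(x, u) \<in> window_edges" "v = u <# N" using e by (auto simp: edges_def)
    note c = window_edgesD[OF u(1)]
    show v: "v \<in> verts N" and "x \<in> X" using u c by (auto simp: verts_def)
    have "(x \<otimes> t v) <# N = (x \<otimes> u) <# N"
      using l_coset_left_mult[OF N c(4) tc[OF v] c(5)] t(2)[OF v] u(2) by simp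
    moreover have xv: "(x \<otimes> u) <# N \<in> verts N" using c by (auto simp: verts_def)
    ultimately show xv': "(x \<otimes> t v) <# N \<in> verts N" by simp
    show "inv (t ((x \<otimes> t v) <# N)) \<otimes> (x \<otimes> t v) \<in> N"
      using t(2)[OF xv'] l_coset_eq_iff[OF N tc[OF xv'], of "x \<otimes> t v"] c tc[OF v] by simp
  qed
  have ex_perms: "ex g v \<in> perms n" if "g \<in> verts N - {N} \<rightarrow>\<^sub>E perms n" "v \<in> verts N" for g v
    using that by (auto simp: ex_def PiE_iff)
  have inv_perms: "inv' p \<in> perms n" if "p \<in> perms n" for p
    using that permutes_inv by (auto simp: sym_group_carrier)
  have \<Psi>_in: "\<Psi> (\<phi>, g) \<in> connections N n"
    if \<phi>: "\<phi> \<in> perm_homs G N n" and g: "g \<in> verts N - {N} \<rightarrow>\<^sub>E perms n" for \<phi> g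
  proof -
    have "ex g ((x \<otimes> t v) <# N) \<circ> \<phi> (inv (t ((x \<otimes> t v) <# N)) \<otimes> (x \<otimes> t v)) \<circ> inv' (ex g v) \<in> perms n"
      if e: "(x, v) \<in> edges N" for x v
      using ev[OF e]
      by (intro comp_perms inv_perms ex_perms[OF g] perm_homs_perms[OF \<phi>])
    then show ?thesis by (auto simp: \<Psi>_def)
  qed
  have \<Phi>_in: "\<Phi> a \<in> verts N - {N} \<rightarrow>\<^sub>E perms n" if "a \<in> connections N n" for a
    using holonomy_perms[OF N that] tc by (auto simp: \<Phi>_def)
  have ex_\<Phi>: "ex (\<Phi> a) v = ?h a (t v)" if "a \<in> connections N n" "v \<in> verts N" for a v
    using that holonomy_one[OF N that(1)] tN by (auto simp: ex_def \<Phi>_def)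
  have 1: "\<Psi> (restrict (?h a) N, \<Phi> a) = a" if a: "a \<in> connections N n" for a
  proof (rule extensionalityI[of _ "edges N"])
    show "\<Psi> (restrict (?h a) N, \<Phi> a) \<in> extensional (edges N)" by (simp add: \<Psi>_def)
    show "a \<in> extensional (edges N)" using a by (simp add: PiE_iff)
    fix e assume e: "e \<in> edges N"
    obtain x v where xv: "e = (x, v)" by (cases e)
    let ?v' = "(x \<otimes> t v) <# N"
    note ev = ev[OF e[unfolded xv]]
    have c: "t v \<in> carrier G" "x \<in> carrier G" "t ?v' \<in> carrier G" using ev tc X_closed by auto
    have "?h a (x \<otimes> t v) = a (x, v) \<circ> ?h a (t v)"
      using holonomy_step[OF N a ev(3) c(1)] t(2)[OF ev(1)] e xv by simp
    moreover have "?h a (x \<otimes> t v) = ?h a (t ?v') \<circ> ?h a (inv (t ?v') \<otimes> (x \<otimes> t v))"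
      using holonomy_quotient[OF N a c(3) _ ev(4)] c by simp
    moreover have "?h a (t v) \<circ> inv' (?h a (t v)) = id"
      using holonomy_perms[OF N a c(1)] permutes_inv_o(1) unfolding sym_group_carrier by blast
    ultimately have "?h a (t ?v') \<circ> ?h a (inv (t ?v') \<otimes> (x \<otimes> t v)) \<circ> inv' (?h a (t v)) = a (x, v)"
      by (metis comp_assoc comp_id)
    then show "\<Psi> (restrict (?h a) N, \<Phi> a) e = a e"
      using e xv ev ex_\<Phi>[OF a] by (simp add: \<Psi>_def)
  qed
  have 2: "restrict (?h (\<Psi> (\<phi>, g))) N = \<phi> \<and> \<Phi> (\<Psi> (\<phi>, g)) = g"
    if \<phi>: "\<phi> \<in> perm_homs G N n" and g: "g \<in> verts N - {N} \<rightarrow>\<^sub>E perms n" for \<phi> g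
  proof -
    define a where "a = \<Psi> (\<phi>, g)"
    have a: "a \<in> connections N n" using \<Psi>_in[OF \<phi> g] by (simp add: a_def)
    have hol: "?h a u = ex g (u <# N) \<circ> \<phi> (inv (t (u <# N)) \<otimes> u)" if "u \<in> W" for u
      using that
    proof (induction rule: window_edges_induct)
      case one
      show ?case using holonomy_one[OF N a] perm_homs_one[OF \<phi> N] tN by (simp add: one_l_coset[OF N] ex_def)
    next
      case (step x u)
      note c = window_edgesD[OF step]
      let ?v = "u <# N" and ?v' = "(x \<otimes> t (u <# N)) <# N"
      have e: "(x, ?v) \<in> edges N" using edgesI[OF step] .
      note ev = ev[OF e]
      have v': "(x \<otimes> u) <# N = ?v'"
        using l_coset_left_mult[OF N c(4,5) tc[OF ev(1)]] t(2)[OF ev(1)] by simp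
      have cc: "t ?v \<in> carrier G" "t ?v' \<in> carrier G" using tc ev by auto
      have tu: "inv (t ?v) \<otimes> u \<in> N" using t_coset c by blast
      have "inv (t ?v') \<otimes> (x \<otimes> u) = (inv (t ?v') \<otimes> (x \<otimes> t ?v)) \<otimes> (inv (t ?v) \<otimes> u)"
        using c cc by (simp add: m_assoc)
      then have \<phi>_xu: "\<phi> (inv (t ?v') \<otimes> (x \<otimes> u)) = \<phi> (inv (t ?v') \<otimes> (x \<otimes> t ?v)) \<circ> \<phi> (inv (t ?v) \<otimes> u)"
        using perm_homs_mult[OF \<phi> ev(4) tu] by simp
      have ax: "a (x, ?v) = ex g ?v' \<circ> \<phi> (inv (t ?v') \<otimes> (x \<otimes> t ?v)) \<circ> inv' (ex g ?v)"
        using e by (simp add: a_def \<Psi>_def)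
      have inj: "inj (ex g ?v)" using ex_perms[OF g ev(1)] perms_inj by blast
      have rhs: "a (x, ?v) \<circ> (ex g ?v \<circ> \<phi> (inv (t ?v) \<otimes> u)) = ex g ?v' \<circ> \<phi> (inv (t ?v') \<otimes> (x \<otimes> u))"
        unfolding ax \<phi>_xu using inj by (simp add: fun_eq_iff inv_f_f)
      have inj_a: "inj (a (x, ?v))" using perms_inj[OF connection_perms[OF N a e]] .
      show ?case
        unfolding v' rhs[symmetric] holonomy_edge[OF N a step] inj_comp_eq[OF inj_a] ..
    qed
    have "\<Phi> a = g"
    proof (rule extensionalityI[of _ "verts N - {N}"])
      fix v assume v: "v \<in> verts N - {N}"
      then have "?h a (t v) = ex g v \<circ> \<phi> (inv (t v) \<otimes> t v)" using hol[of "t v"] t by auto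
      also have "\<dots> = g v" using v tc perm_homs_one[OF \<phi> N] by (simp add: ex_def)
      finally show "\<Phi> a v = g v" using v by (simp add: \<Phi>_def)
    qed (use g in \<open>auto simp: \<Phi>_def PiE_iff\<close>)
    moreover have "restrict (?h a) N = \<phi>"
    proof (rule perm_homs_eq[OF holonomy_perm_homs[OF N a] \<phi> gen[unfolded supported_part_def]])
      show "{inv u \<otimes> v |u v. u \<in> W \<and> v \<in> W \<and> inv u \<otimes> v \<in> N} \<subseteq> carrier G" using Nc by blast
      fix b assume "b \<in> {inv u \<otimes> v |u v. u \<in> W \<and> v \<in> W \<and> inv u \<otimes> v \<in> N}"
      then obtain u v where b: "b = inv u \<otimes> v" "u \<in> W" "v \<in> W" "b \<in> N" by blast
      have c: "u \<in> carrier G" "v \<in> carrier G" using b W_closed by auto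
      have uv: "u <# N = v <# N" using l_coset_eq_iff[OF N c] b by simp
      let ?t = "t (v <# N)"
      have vv: "v <# N \<in> verts N" using b by (auto simp: verts_def)
      have tt: "inv ?t \<otimes> u \<in> N" "inv ?t \<otimes> v \<in> N" using t_coset[OF b(2)] t_coset[OF b(3)] uv by auto
      have "inv ?t \<otimes> v = (inv ?t \<otimes> u) \<otimes> b" using b(1) c tc[OF vv] by (simp add: m_assoc)
      then have "\<phi> (inv ?t \<otimes> v) = \<phi> (inv ?t \<otimes> u) \<circ> \<phi> b" using perm_homs_mult[OF \<phi> tt(1) b(4)] by simp
      then have "?h a v = ?h a u \<circ> \<phi> b" using hol[OF b(2)] hol[OF b(3)] uv by (simp add: comp_assoc)
      moreover have "?h a v = ?h a u \<circ> ?h a b" using holonomy_quotient[OF N a c] b by simp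
      moreover have "inj (?h a u)" using perms_inj[OF holonomy_perms[OF N a c(1)]] .
      ultimately have "?h a b = \<phi> b" by (simp add: inj_comp_eq)
      then show "restrict (?h a) N b = \<phi> b" using b(4) by simp
    qed
    ultimately show ?thesis by (simp add: a_def)
  qed
  have "bij_betw (\<lambda>a. (restrict (?h a) N, \<Phi> a)) (connections N n)
    (perm_homs G N n \<times> (verts N - {N} \<rightarrow>\<^sub>E perms n))"
  proof (rule bij_betw_byWitness[where f' = \<Psi>])
    show "\<forall>a\<in>connections N n. \<Psi> (restrict (?h a) N, \<Phi> a) = a" using 1 by blast
    show "\<forall>p\<in>perm_homs G N n \<times> (verts N - {N} \<rightarrow>\<^sub>E perms n).
      (restrict (?h (\<Psi> p)) N, \<Phi> (\<Psi> p)) = p" using 2 by auto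
    show "(\<lambda>a. (restrict (?h a) N, \<Phi> a)) ` connections N n
      \<subseteq> perm_homs G N n \<times> (verts N - {N} \<rightarrow>\<^sub>E perms n)"
      using \<Phi>_in holonomy_perm_homs[OF N] by blast
    show "\<Psi> ` (perm_homs G N n \<times> (verts N - {N} \<rightarrow>\<^sub>E perms n)) \<subseteq> connections N n"
      using \<Psi>_in by blast
  qed
  then show ?thesis by (intro exI[of _ \<Phi>])
qed

lemma card_connections_holonomy:
  assumes sp: "spanned N"
  shows "card {a \<in> connections N n. P (restrict (holonomy N n a) N)} =
    card {\<phi> \<in> perm_homs G N n. P \<phi>} * fact n ^ (card (verts N) - 1)"
proof -
  obtain \<Phi> where bij: "bij_betw (\<lambda>a. (restrict (holonomy N n a) N, \<Phi> a)) (connections N n)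
    (perm_homs G N n \<times> (verts N - {N} \<rightarrow>\<^sub>E perms n))" (is "bij_betw ?f _ (?A \<times> ?B)")
    using connections_bij[OF sp] by blast
  have "bij_betw ?f {a \<in> connections N n. P (restrict (holonomy N n a) N)} ({\<phi> \<in> ?A. P \<phi>} \<times> ?B)"
    unfolding bij_betw_def
  proof (intro conjI equalityI subsetI)
    show "inj_on ?f {a \<in> connections N n. P (restrict (holonomy N n a) N)}"
      using bij by (auto simp: bij_betw_def intro: inj_on_subset)
    fix p assume p: "p \<in> {\<phi> \<in> ?A. P \<phi>} \<times> ?B"
    then have "p \<in> ?f ` connections N n" using bij unfolding bij_betw_def by auto
    then show "p \<in> ?f ` {a \<in> connections N n. P (restrict (holonomy N n a) N)}" using p by auto
  next
    fix p assume "p \<in> ?f ` {a \<in> connections N n. P (restrict (holonomy N n a) N)}"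
    then obtain a where a: "a \<in> connections N n" "P (restrict (holonomy N n a) N)" "p = ?f a" by blast
    then have "p \<in> ?A \<times> ?B" using bij bij_betwE by blast
    then show "p \<in> {\<phi> \<in> ?A. P \<phi>} \<times> ?B" using a by auto
  qed
  then have "card {a \<in> connections N n. P (restrict (holonomy N n a) N)} = card ({\<phi> \<in> ?A. P \<phi>} \<times> ?B)"
    by (rule bij_betw_same_card)
  moreover have "card ?B = fact n ^ (card (verts N) - 1)"
    using finite_verts[of N] N_in_verts[of N] sp by (simp add: card_PiE spanned_def card_Diff_singleton)
  ultimately show ?thesis by (simp add: card_cartesian_product)
qed

lemma spanned_finite_generators:
  assumes "spanned N"
  shows "\<exists>S. finite S \<and> S \<subseteq> carrier G \<and> generate G S = N"
proof (intro exI conjI)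
  let ?S = "{inv u \<otimes> v |u v. u \<in> W \<and> v \<in> W \<and> inv u \<otimes> v \<in> N}"
  show "finite ?S" by (rule finite_subset[of _ "(\<lambda>(u, v). inv u \<otimes> v) ` (W \<times> W)"]) (use finite_W in auto)
  show "?S \<subseteq> carrier G" using W_closed by auto
  show "generate G ?S = N" using assms by (simp add: spanned_def supported_part_def)
qed

lemma spanned_rk_finite:
  assumes "spanned N"
  shows "rk G N \<noteq> \<infinity>"
proof -
  obtain S where "finite S" "S \<subseteq> carrier G" "generate G S = N"
    using spanned_finite_generators[OF assms] by blast
  then have "rk G N \<le> enat (card S)" by (rule rk_le_card_generators)
  then show ?thesis by (cases "rk G N") auto
qed

text \<open>Counting connections with values in \<open>sym_group 2\<close> in two ways gives the Euler
  characteristic.\<close>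

lemma rk_spanned:
  assumes sp: "spanned N"
  shows "rk G N + enat (card (verts N)) = enat (card (edges N) + 1)"
proof -
  have N: "subgroup N G" using sp by (simp add: spanned_def)
  obtain r where r: "rk G N = enat r" using spanned_rk_finite[OF sp] by auto
  obtain B where B: "free_basis G N B" "finite B" "card B = r" using rk_basis[OF N r] .
  have "card (connections N 2) = card (perm_homs G N 2) * fact 2 ^ (card (verts N) - 1)"
    using card_connections_holonomy[OF sp, of 2 "\<lambda>_. True"] by simp
  then have "(2::nat) ^ card (edges N) = 2 ^ r * 2 ^ (card (verts N) - 1)"
    using card_perm_homs(2)[OF B(1,2), of 2] B(3) finite_edges by (simp add: card_PiE)
  then have "(2::nat) ^ card (edges N) = 2 ^ (r + (card (verts N) - 1))" by (simp add: power_add)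
  then have "card (edges N) = r + (card (verts N) - 1)" by simp
  moreover have "card (verts N) > 0" using N_in_verts[OF N] finite_verts card_gt_0_iff by blast
  ultimately show ?thesis using r by simp
qed

end

section \<open>Counting coverings by the subgroup they exhibit\<close>

text \<open>Running through a list and choosing values in \<open>{1..n}\<close> from the end, one has \<open>n - s\<close> choices at an entry
  that has to differ from \<open>s\<close> values chosen already.\<close>

fun crossing :: "('z \<Rightarrow> 'z \<Rightarrow> bool) \<Rightarrow> nat \<Rightarrow> 'z list \<Rightarrow> real" where
  "crossing R n [] = 1"
| "crossing R n (z # zs) = (real n - real (length (filter (R z) zs))) * crossing R n zs"

lemma crossing_map: "crossing R n (map f zs) = crossing (\<lambda>a b. R (f a) (f b)) n zs"
  by (induction zs) (auto simp: filter_map o_def)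

lemma crossing_cong:
  "(\<And>a b. a \<in> set zs \<Longrightarrow> b \<in> set zs \<Longrightarrow> R a b \<longleftrightarrow> R' a b) \<Longrightarrow> crossing R n zs = crossing R' n zs"
proof (induction zs)
  case (Cons z zs)
  have "filter (R z) zs = filter (R' z) zs" by (rule filter_cong) (use Cons.prems in auto)
  then show ?case using Cons by simp
qed simp

lemma card_separating_labellings:
  assumes n: "n \<ge> 1"
    and sym: "\<And>u v. R u v \<Longrightarrow> u \<in> set (zs @ [b]) \<Longrightarrow> v \<in> set (zs @ [b]) \<Longrightarrow> R v u"
    and trans: "\<And>u v w. R u v \<Longrightarrow> R v w \<Longrightarrow> u \<in> set (zs @ [b]) \<Longrightarrow> v \<in> set (zs @ [b]) \<Longrightarrow>
      w \<in> set (zs @ [b]) \<Longrightarrow> R u w"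
    and dist: "distinct (zs @ [b])"
  shows "real n * real (card {l \<in> set (zs @ [b]) \<rightarrow>\<^sub>E {1..n}. l b = 1 \<and>
      (\<forall>u\<in>set (zs @ [b]). \<forall>v\<in>set (zs @ [b]). u \<noteq> v \<longrightarrow> R u v \<longrightarrow> l u \<noteq> l v)}) = crossing R n (zs @ [b])"
  using sym trans dist
proof (induction zs)
  case Nil
  have "{l \<in> {b} \<rightarrow>\<^sub>E {1..n}. l b = 1} = {\<lambda>u\<in>{b}. 1}"
  proof (intro equalityI subsetI)
    fix l assume "l \<in> {l \<in> {b} \<rightarrow>\<^sub>E {1..n}. l b = 1}"
    then have "l = (\<lambda>u\<in>{b}. 1)" by (intro extensionalityI[of _ "{b}"]) (auto simp: PiE_iff)
    then show "l \<in> {\<lambda>u\<in>{b}. 1}" by simp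
  qed (use n in auto)
  then show ?case by simp
next
  case (Cons z zs)
  define V where "V = set (zs @ [b])"
  define L where "L V = {l \<in> V \<rightarrow>\<^sub>E {1..n}. l b = 1 \<and> (\<forall>u\<in>V. \<forall>v\<in>V. u \<noteq> v \<longrightarrow> R u v \<longrightarrow> l u \<noteq> l v)}" for V
  have zV: "z \<notin> V" "b \<in> V" "finite V" using Cons.prems(3) by (auto simp: V_def)
  have setV: "set ((z # zs) @ [b]) = insert z V" by (auto simp: V_def)
  have symV: "R u v \<Longrightarrow> u \<in> insert z V \<Longrightarrow> v \<in> insert z V \<Longrightarrow> R v u" for u v
    using Cons.prems(1) unfolding setV by blast
  have transV: "R u v \<Longrightarrow> R v w \<Longrightarrow> u \<in> insert z V \<Longrightarrow> v \<in> insert z V \<Longrightarrow> w \<in> insert z V \<Longrightarrow> R u w" for u v w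
    using Cons.prems(2) unfolding setV by blast
  have IH: "real n * real (card (L V)) = crossing R n (zs @ [b])"
    unfolding L_def V_def
  proof (rule Cons.IH)
    show "R v u" if "R u v" "u \<in> set (zs @ [b])" "v \<in> set (zs @ [b])" for u v
      by (rule Cons.prems(1)) (use that in simp_all)
    show "R u w" if "R u v" "R v w" "u \<in> set (zs @ [b])" "v \<in> set (zs @ [b])" "w \<in> set (zs @ [b])" for u v w
      by (rule Cons.prems(2)[of u v w]) (use that in simp_all)
    show "distinct (zs @ [b])" using Cons.prems(3) by simp
  qed
  define Z where "Z = {v \<in> V. R z v}"
  define c where "c = length (filter (R z) (zs @ [b]))"
  have "c = card ({v. R z v} \<inter> set (zs @ [b]))"
    unfolding c_def by (rule distinct_length_filter) (use Cons.prems(3) in simp)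
  moreover have "{v. R z v} \<inter> set (zs @ [b]) = Z" by (auto simp: Z_def V_def)
  ultimately have c: "c = card Z" by simp
  have finL: "finite (L V)"
    by (rule finite_subset[of _ "V \<rightarrow>\<^sub>E {1..n}"]) (use zV in \<open>auto simp: L_def intro: finite_PiE\<close>)
  define S where "S = (SIGMA l:L V. {1..n} - l ` Z)"
  have "bij_betw (\<lambda>l. (restrict l V, l z)) (L (insert z V)) S"
  proof (rule bij_betw_byWitness[where f' = "\<lambda>(l, y). l(z := y)"])
    show "\<forall>l\<in>L (insert z V). (case (restrict l V, l z) of (l, y) \<Rightarrow> l(z := y)) = l"
      by (auto simp: L_def fun_eq_iff PiE_iff extensional_def)
    show "\<forall>p\<in>S. (restrict (case p of (l, y) \<Rightarrow> l(z := y)) V, (case p of (l, y) \<Rightarrow> l(z := y)) z) = p"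
      using zV by (auto simp: S_def L_def fun_eq_iff PiE_iff extensional_def)
    show "(\<lambda>l. (restrict l V, l z)) ` L (insert z V) \<subseteq> S"
      using zV by (auto simp: S_def L_def Z_def)
    show "(\<lambda>(l, y). l(z := y)) ` S \<subseteq> L (insert z V)"
    proof (intro image_subsetI)
      fix p assume "p \<in> S"
      then obtain l y where p: "p = (l, y)" "l \<in> L V" "y \<in> {1..n}" "y \<notin> l ` Z" by (auto simp: S_def)
      have sep: "(l(z := y)) u \<noteq> (l(z := y)) v" if "u \<in> insert z V" "v \<in> insert z V" "u \<noteq> v" "R u v" for u v
      proof (cases "u = z \<or> v = z")
        case True
        then show ?thesis using that p(4) symV[OF that(4)] by (auto simp: Z_def)
      next
        case False
        then show ?thesis using that p(2) by (auto simp: L_def)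
      qed
      have "l(z := y) \<in> insert z V \<rightarrow>\<^sub>E {1..n}" using p by (auto simp: L_def PiE_iff extensional_def)
      moreover have "(l(z := y)) b = 1" using p(2) zV by (auto simp: L_def)
      ultimately have "l(z := y) \<in> L (insert z V)"
        using sep unfolding L_def mem_Collect_eq by blast
      then show "(case p of (l, y) \<Rightarrow> l(z := y)) \<in> L (insert z V)" using p(1) by simp
    qed
  qed
  then have "card (L (insert z V)) = card S" by (rule bij_betw_same_card)
  also have "\<dots> = (\<Sum>l\<in>L V. card ({1..n} - l ` Z))"
    unfolding S_def using finL by (intro card_SigmaI) auto
  finally have "real (card (L (insert z V))) = (\<Sum>l\<in>L V. real (card ({1..n} - l ` Z)))" by simp
  also have "\<dots> = (\<Sum>l\<in>L V. real n - real c)"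
  proof (rule sum.cong[OF refl])
    fix l assume l: "l \<in> L V"
    have "inj_on l Z"
    proof (rule inj_onI, rule ccontr)
      fix u v assume uv: "u \<in> Z" "v \<in> Z" "l u = l v" "u \<noteq> v"
      then have "R u z" "R z v" "u \<in> V" "v \<in> V" using symV by (auto simp: Z_def)
      then have "R u v" using transV by blast
      then show False using uv l \<open>u \<in> V\<close> \<open>v \<in> V\<close> by (auto simp: L_def)
    qed
    then have "card (l ` Z) = c" using c by (simp add: card_image)
    moreover have sub: "l ` Z \<subseteq> {1..n}" using l by (auto simp: L_def Z_def PiE_iff)
    moreover have "card (l ` Z) \<le> n" using card_mono[OF _ sub] by simp
    moreover have "finite (l ` Z)" using zV by (simp add: Z_def)
    ultimately show "real (card ({1..n} - l ` Z)) = real n - real c"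
      by (simp add: card_Diff_subset of_nat_diff)
  qed
  also have "\<dots> = real (card (L V)) * (real n - real c)" by simp
  finally have eq: "real (card (L (insert z V))) = real (card (L V)) * (real n - real c)" .
  have "real n * real (card (L (insert z V))) = (real n - real c) * crossing R n (zs @ [b])"
    unfolding eq IH[symmetric] by (simp only: mult_ac)
  then show ?case unfolding setV L_def c_def by simp
qed

lemma comp_transpose_perms:
  "p \<in> perms n \<Longrightarrow> i \<in> {1..n} \<Longrightarrow> j \<in> {1..n} \<Longrightarrow> Transposition.transpose i j \<circ> p \<in> perms n"
  by (intro comp_perms) (auto simp: sym_group_carrier permutes_swap_id)

text \<open>Imposing the constraints one at a time, the next one selects one of \<open>n - s\<close> equally likely
  values, where \<open>s\<close> earlier constraints concern the same permutation.\<close>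

lemma card_constrained_perms:
  fixes cs :: "('i \<times> nat \<times> nat) list"
  assumes I: "finite I"
    and cs: "\<And>i p q. (i, p, q) \<in> set cs \<Longrightarrow> i \<in> I \<and> p \<in> {1..n} \<and> q \<in> {1..n}"
    and indep: "\<And>i p q p' q'. (i, p, q) \<in> set cs \<Longrightarrow> (i, p', q') \<in> set cs \<Longrightarrow> (p, q) \<noteq> (p', q') \<Longrightarrow> p \<noteq> p' \<and> q \<noteq> q'"
    and dist: "distinct cs"
  shows "real (card {a \<in> I \<rightarrow>\<^sub>E perms n. \<forall>(i, p, q)\<in>set cs. a i p = q}) *
    crossing (\<lambda>c c'. fst c = fst c') n cs = fact n ^ card I"
  using cs indep dist
proof (induction cs)
  case Nil
  show ?case using I by (simp add: card_PiE)
next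
  case (Cons c cs)
  obtain i p q where c: "c = (i, p, q)" by (cases c)
  define A where "A = {a \<in> I \<rightarrow>\<^sub>E perms n. \<forall>(i, p, q)\<in>set cs. a i p = q}"
  have IH: "real (card A) * crossing (\<lambda>c c'. fst c = fst c') n cs = fact n ^ card I"
    unfolding A_def
  proof (rule Cons.IH)
    show "i \<in> I \<and> p \<in> {1..n} \<and> q \<in> {1..n}" if "(i, p, q) \<in> set cs" for i p q
      by (rule Cons.prems(1)) (use that in simp)
    show "p \<noteq> p' \<and> q \<noteq> q'" if "(i, p, q) \<in> set cs" "(i, p', q') \<in> set cs" "(p, q) \<noteq> (p', q')" for i p q p' q'
      by (rule Cons.prems(2)[of i]) (use that in simp_all)
    show "distinct cs" using Cons.prems(3) by simp
  qed
  have ipq: "i \<in> I" "p \<in> {1..n}" "q \<in> {1..n}" using Cons.prems(1) c by auto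
  have finA: "finite A"
    by (rule finite_subset[of _ "I \<rightarrow>\<^sub>E perms n"]) (use I in \<open>auto simp: A_def intro: finite_PiE\<close>)
  define Q where "Q = {q'. \<exists>p'. (i, p', q') \<in> set cs}"
  have indep_c: "p \<noteq> p' \<and> q \<noteq> q'" if "(i, p', q') \<in> set cs" for p' q'
    using Cons.prems(2)[of i p q p' q'] Cons.prems(3) that c by auto
  have Q_sub: "Q \<subseteq> {1..n}"
  proof
    fix q' assume "q' \<in> Q"
    then obtain p' where "(i, p', q') \<in> set (c # cs)" by (auto simp: Q_def)
    then show "q' \<in> {1..n}" using Cons.prems(1) by blast
  qed
  have qQ: "q \<in> {1..n} - Q" using ipq indep_c by (auto simp: Q_def)
  have filt: "length (filter ((\<lambda>c c'. fst c = fst c') c) cs) = card Q"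
  proof -
    let ?F = "filter (\<lambda>c'. i = fst c') cs"
    have "inj_on (\<lambda>c. snd (snd c)) (set ?F)"
    proof (rule inj_onI)
      fix d d' assume d: "d \<in> set ?F" "d' \<in> set ?F" "snd (snd d) = snd (snd d')"
      obtain p1 q1 p2 q2 where pq: "snd d = (p1, q1)" "snd d' = (p2, q2)" by fastforce
      have "fst d = i" "fst d' = i" using d(1,2) by auto
      with pq have d1: "d = (i, p1, q1)" and d2: "d' = (i, p2, q2)" by (simp_all add: prod_eq_iff)
      have "(i, p1, q1) \<in> set (c # cs)" "(i, p2, q2) \<in> set (c # cs)" using d d1 d2 by auto
      then have "(p1, q1) \<noteq> (p2, q2) \<Longrightarrow> q1 \<noteq> q2" using Cons.prems(2) by blast
      then show "d = d'" using d(3) d1 d2 by auto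
    qed
    moreover have "Q = (\<lambda>c. snd (snd c)) ` set ?F" by (force simp: Q_def image_iff)
    moreover have "distinct ?F" using Cons.prems(3) by simp
    ultimately show ?thesis using c by (simp add: card_image distinct_card del: set_filter)
  qed
  define Aq where "Aq q' = {a \<in> A. a i p = q'}" for q'
  have A_perm: "a i \<in> perms n" if "a \<in> A" for a using that ipq by (auto simp: A_def PiE_iff)
  have A_un: "A = (\<Union>q'\<in>{1..n} - Q. Aq q')"
  proof -
    have "a i p \<in> {1..n} - Q" if a: "a \<in> A" for a
    proof -
      have "a i permutes {1..n}" using A_perm[OF a] by (simp add: sym_group_carrier)
      then have "a i p \<in> {1..n}" using permutes_in_image[of "a i" "{1..n}" p] ipq(2) by simp
      moreover have "a i p \<notin> Q"
      proof
        assume "a i p \<in> Q"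
        then obtain p' where p': "(i, p', a i p) \<in> set cs" by (auto simp: Q_def)
        then have "a i p' = a i p" using a by (auto simp: A_def)
        then show False using indep_c[OF p'] injD[OF perms_inj[OF A_perm[OF a]]] by metis
      qed
      ultimately show ?thesis by blast
    qed
    then show ?thesis by (auto simp: Aq_def)
  qed
  have Aq_card: "card (Aq q') = card (Aq q)" if q': "q' \<in> {1..n} - Q" for q'
  proof -
    define \<tau> where "\<tau> = Transposition.transpose q q'"
    have \<tau>\<tau>: "\<tau> (\<tau> y) = y" for y by (simp add: \<tau>_def)
    have \<tau>_in: "a(i := \<tau> \<circ> a i) \<in> A" if a: "a \<in> A" for a
    proof -
      have "\<tau> \<circ> a i \<in> perms n" unfolding \<tau>_def using q' ipq by (intro comp_transpose_perms A_perm[OF a]) auto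
      then have "a(i := \<tau> \<circ> a i) \<in> I \<rightarrow>\<^sub>E perms n"
        using a ipq(1) by (auto simp: A_def PiE_iff extensional_def)
      moreover have "(a(i := \<tau> \<circ> a i)) j x = y" if jxy: "(j, x, y) \<in> set cs" for j x y
      proof (cases "j = i")
        case True
        then have "y \<noteq> q" "y \<noteq> q'" using jxy q' qQ by (auto simp: Q_def)
        then show ?thesis using True a jxy by (auto simp: A_def \<tau>_def transpose_apply_other)
      next
        case False
        then show ?thesis using a jxy by (auto simp: A_def)
      qed
      ultimately show ?thesis by (auto simp: A_def)
    qed
    have "bij_betw (\<lambda>a. a(i := \<tau> \<circ> a i)) (Aq q') (Aq q)"
      by (rule bij_betw_byWitness[where f' = "\<lambda>a. a(i := \<tau> \<circ> a i)"])
        (use \<tau>_in \<tau>\<tau> in \<open>auto simp: Aq_def fun_eq_iff, auto simp: \<tau>_def\<close>)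
    then show ?thesis by (rule bij_betw_same_card)
  qed
  have "card A = (\<Sum>q'\<in>{1..n} - Q. card (Aq q'))"
    by (subst A_un, rule card_UN_disjoint) (use finA in \<open>auto simp: Aq_def\<close>)
  also have "\<dots> = card ({1..n} - Q) * card (Aq q)" using Aq_card by simp
  finally have "real (card A) = (real n - real (card Q)) * real (card (Aq q))"
    using Q_sub card_mono[OF _ Q_sub] finite_subset[OF Q_sub] by (simp add: card_Diff_subset of_nat_diff)
  moreover have "{a \<in> I \<rightarrow>\<^sub>E perms n. \<forall>(i, p, q)\<in>set (c # cs). a i p = q} = Aq q"
    by (auto simp: Aq_def A_def c)
  ultimately show ?case using IH filt by (simp add: mult_ac)
qed

context cayley_window
begin

text \<open>Representatives of the cosets of \<open>M\<close> that meet the window. The coset of \<open>\<one>\<close> is singled out because its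
  label is prescribed, and it comes last because labels are chosen from the end.\<close>

definition vertex_reps :: "'a set \<Rightarrow> 'a list \<Rightarrow> bool" where
  "vertex_reps M vs \<longleftrightarrow> distinct (vs @ [\<one>]) \<and> set vs \<subseteq> W \<and>
     (\<forall>u\<in>W. \<exists>v\<in>set (vs @ [\<one>]). inv v \<otimes> u \<in> M) \<and>
     (\<forall>u\<in>set (vs @ [\<one>]). \<forall>v\<in>set (vs @ [\<one>]). inv u \<otimes> v \<in> M \<longrightarrow> u = v)"

definition edge_reps :: "'a set \<Rightarrow> ('a \<times> 'a) list \<Rightarrow> bool" where
  "edge_reps M es \<longleftrightarrow> distinct es \<and> set es \<subseteq> window_edges \<and>
     (\<forall>(x, u)\<in>window_edges. \<exists>v. (x, v) \<in> set es \<and> inv v \<otimes> u \<in> M) \<and>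
     (\<forall>(x, u)\<in>set es. \<forall>(y, v)\<in>set es. x = y \<and> inv u \<otimes> v \<in> M \<longrightarrow> u = v)"

lemma vertex_reps_exist:
  assumes M: "subgroup M G"
  shows "\<exists>vs. vertex_reps M vs \<and> length vs + 1 = card (verts M)"
proof -
  obtain t where tM: "t M = \<one>" and t': "\<forall>v\<in>verts M. t v \<in> W \<and> t v <# M = v"
    using vertex_representatives[OF M] by blast
  have t: "t v \<in> W" "t v <# M = v" if "v \<in> verts M" for v using t' that by auto
  have "\<one> = t M" using tM by simp
  then have one: "\<one> \<in> t ` verts M" using N_in_verts[OF M] by blast
  have "finite (t ` verts M - {\<one>})" using finite_verts by simp
  then obtain vs where vs: "set vs = t ` verts M - {\<one>}" "distinct vs" using finite_distinct_list by blast
  have all: "set (vs @ [\<one>]) = t ` verts M" using vs(1) one by auto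
  have "inj_on t (verts M)" using t(2) by (metis inj_onI)
  then have "card (set (vs @ [\<one>])) = card (verts M)" unfolding all by (rule card_image)
  moreover have dist: "distinct (vs @ [\<one>])" using vs by simp
  ultimately have "length vs + 1 = card (verts M)" using distinct_card[OF dist] by simp
  moreover have "\<exists>v\<in>set (vs @ [\<one>]). inv v \<otimes> u \<in> M" if u: "u \<in> W" for u
  proof -
    have v: "u <# M \<in> verts M" using u by (auto simp: verts_def)
    have "inv (t (u <# M)) \<otimes> u \<in> M"
      using t(2)[OF v] l_coset_eq_iff[OF M W_closed[OF t(1)[OF v]] W_closed[OF u]] by simp
    then show ?thesis using v unfolding all by blast
  qed
  moreover have "u = v" if uv: "u \<in> set (vs @ [\<one>])" "v \<in> set (vs @ [\<one>])" "inv u \<otimes> v \<in> M" for u v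
  proof -
    obtain c d where cd: "c \<in> verts M" "u = t c" "d \<in> verts M" "v = t d" using uv unfolding all by blast
    have "u <# M = v <# M" using uv(3) l_coset_eq_iff[OF M] cd t(1) W_closed by simp
    then show ?thesis using cd t(2) by simp
  qed
  moreover have "set vs \<subseteq> W" using vs(1) t(1) by auto
  ultimately show ?thesis using dist unfolding vertex_reps_def by (intro exI[of _ vs] conjI ballI impI)
qed

lemma edge_reps_exist:
  assumes M: "subgroup M G"
  shows "\<exists>es. edge_reps M es \<and> length es = card (edges M)"
proof -
  define f :: "'a \<times> 'a \<Rightarrow> 'a \<times> 'a set" where "f = (\<lambda>(x, u). (x, u <# M))"
  define t where "t e = (SOME d. d \<in> window_edges \<and> f d = e)" for e
  have t: "t e \<in> window_edges" "f (t e) = e" if e: "e \<in> edges M" for e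
  proof -
    obtain d where d: "d \<in> window_edges \<and> f d = e" using e by (auto simp: edges_def f_def)
    have "t e \<in> window_edges \<and> f (t e) = e"
      unfolding t_def by (rule someI[of "\<lambda>d. d \<in> window_edges \<and> f d = e", OF d])
    then show "t e \<in> window_edges" "f (t e) = e" by auto
  qed
  have fE: "f d \<in> edges M" if "d \<in> window_edges" for d using that by (auto simp: edges_def f_def)
  obtain es where es: "set es = t ` edges M" "distinct es"
    using finite_distinct_list[of "t ` edges M"] finite_edges by blast
  have "inj_on t (edges M)" using t(2) by (metis inj_onI)
  then have "length es = card (edges M)" using es distinct_card[of es] by (simp add: card_image)
  moreover have "\<exists>v. (x, v) \<in> set es \<and> inv v \<otimes> u \<in> M" if xu: "(x, u) \<in> window_edges" for x u
  proof -
    obtain y v where yv: "t (f (x, u)) = (y, v)" by (cases "t (f (x, u))")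
    note tt = t[OF fE[OF xu], unfolded yv]
    have eq: "y = x" "v <# M = u <# M" using tt(2) by (auto simp: f_def)
    have "inv v \<otimes> u \<in> M"
      using l_coset_eq_iff[OF M window_edgesD(5)[OF tt(1)] window_edgesD(5)[OF xu]] eq by simp
    moreover have "(x, v) \<in> set es" using es(1) fE[OF xu] yv eq by (metis imageI)
    ultimately show ?thesis by blast
  qed
  moreover have "u = v" if uv: "(x, u) \<in> set es" "(x, v) \<in> set es" "inv u \<otimes> v \<in> M" for x u v
  proof -
    obtain c d where cd: "c \<in> edges M" "(x, u) = t c" "d \<in> edges M" "(x, v) = t d" using uv(1,2) es(1) by blast
    have "u <# M = v <# M"
      using uv(3) l_coset_eq_iff[OF M] cd t(1) window_edgesD(5) by metis
    then have "f (x, u) = f (x, v)" by (simp add: f_def)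
    then have "c = d" using cd t(2) by simp
    then show ?thesis using cd by (metis prod.inject)
  qed
  moreover have "set es \<subseteq> window_edges" using es(1) t(1) by auto
  ultimately show ?thesis using es(2) unfolding edge_reps_def by (intro exI[of _ es]) auto
qed

definition stab :: "'a set \<Rightarrow> nat \<Rightarrow> ('a \<times> 'a set \<Rightarrow> nat \<Rightarrow> nat) \<Rightarrow> 'a set" where
  "stab N n a = {h \<in> N. holonomy N n a h 1 = 1}"

text \<open>Of the stabilizer of the first sheet over the base point, this is what can be seen inside the
  window. There are only finitely many possible values.\<close>

definition shape :: "'a set \<Rightarrow> nat \<Rightarrow> ('a \<times> 'a set \<Rightarrow> nat \<Rightarrow> nat) \<Rightarrow> 'a set" where
  "shape N n a = supported_part G W (stab N n a)"

lemma stab_subgroup: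
  assumes N: "subgroup N G" and a: "a \<in> connections N n"
  shows "subgroup (stab N n a) G"
proof (rule subgroup.intro)
  have Nc: "h \<in> carrier G" if "h \<in> N" for h using subgroup.mem_carrier[OF N that] .
  show "stab N n a \<subseteq> carrier G" using Nc by (auto simp: stab_def)
  show "\<one> \<in> stab N n a" using subgroup.one_closed[OF N] holonomy_one[OF N a] by (simp add: stab_def)
  fix g assume g: "g \<in> stab N n a"
  then have gN: "g \<in> N" "holonomy N n a g 1 = 1" by (auto simp: stab_def)
  show "g \<otimes> h \<in> stab N n a" if h: "h \<in> stab N n a" for h
    using gN h holonomy_mult[OF N a Nc[OF gN(1)], of h] subgroup.m_closed[OF N] by (auto simp: stab_def)
  have "inv g \<in> N" using subgroup.m_inv_closed[OF N gN(1)] .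
  moreover have "holonomy N n a (inv g) \<circ> holonomy N n a g = id"
    using holonomy_mult[OF N a _ gN(1), of "inv g"] Nc[OF gN(1)] holonomy_one[OF N a] by simp
  then have "holonomy N n a (inv g) 1 = 1" using gN(2) by (metis comp_apply id_apply)
  ultimately show "inv g \<in> stab N n a" by (simp add: stab_def)
qed

lemma supported_part_pair_iff:
  assumes "subgroup J G" "u \<in> W" "v \<in> W"
  shows "inv u \<otimes> v \<in> supported_part G W J \<longleftrightarrow> inv u \<otimes> v \<in> J"
  using supported_part_subset[OF assms(1), of W] supported_part_member[OF assms(2,3)] by blast

lemma spanned_supported_part:
  assumes "subgroup J G"
  shows "spanned (supported_part G W J)"
proof -
  have "{inv u \<otimes> v |u v. u \<in> W \<and> v \<in> W \<and> inv u \<otimes> v \<in> supported_part G W J} =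
      {inv u \<otimes> v |u v. u \<in> W \<and> v \<in> W \<and> inv u \<otimes> v \<in> J}"
    using supported_part_pair_iff[OF assms] by auto
  then have "supported_part G W (supported_part G W J) = supported_part G W J"
    unfolding supported_part_def by simp
  then show ?thesis using supported_part_subgroup[OF W_carrier] by (simp add: spanned_def)
qed

lemma spanned_subset_iff:
  assumes "spanned M" "subgroup K G"
  shows "M \<subseteq> K \<longleftrightarrow> (\<forall>u\<in>W. \<forall>v\<in>W. inv u \<otimes> v \<in> M \<longrightarrow> inv u \<otimes> v \<in> K)"
proof
  assume *: "\<forall>u\<in>W. \<forall>v\<in>W. inv u \<otimes> v \<in> M \<longrightarrow> inv u \<otimes> v \<in> K"
  have "supported_part G W M \<subseteq> K"
    unfolding supported_part_def by (rule generate_subgroup_incl[OF _ assms(2)]) (use * in auto)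
  then show "M \<subseteq> K" using assms(1) by (simp add: spanned_def)
qed blast

lemma spanned_supported_part_subset_iff:
  assumes "spanned M" "subgroup K G"
  shows "M \<subseteq> supported_part G W K \<longleftrightarrow> M \<subseteq> K"
  unfolding spanned_subset_iff[OF assms(1) supported_part_subgroup[OF W_carrier]]
    spanned_subset_iff[OF assms] using supported_part_pair_iff[OF assms(2)] by simp

lemma supported_part_eq_iff:
  assumes M: "spanned M" and K: "subgroup K G"
  shows "supported_part G W K = M \<longleftrightarrow> (\<forall>u\<in>W. \<forall>v\<in>W. inv u \<otimes> v \<in> K \<longleftrightarrow> inv u \<otimes> v \<in> M)"
proof
  assume "supported_part G W K = M"
  then show "\<forall>u\<in>W. \<forall>v\<in>W. inv u \<otimes> v \<in> K \<longleftrightarrow> inv u \<otimes> v \<in> M"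
    using supported_part_pair_iff[OF K] by auto
next
  assume *: "\<forall>u\<in>W. \<forall>v\<in>W. inv u \<otimes> v \<in> K \<longleftrightarrow> inv u \<otimes> v \<in> M"
  then have "{inv u \<otimes> v |u v. u \<in> W \<and> v \<in> W \<and> inv u \<otimes> v \<in> K} =
      {inv u \<otimes> v |u v. u \<in> W \<and> v \<in> W \<and> inv u \<otimes> v \<in> M}" by auto
  then have "supported_part G W K = supported_part G W M" unfolding supported_part_def by simp
  then show "supported_part G W K = M" using M by (simp add: spanned_def)
qed

text \<open>A connection with shape \<open>M\<close> is the same as a labelling of the cosets of \<open>M\<close> by sheets, with
  different labels for different cosets over one vertex, together with permutations that respect
  it.\<close>

lemma card_shape:
  assumes M: "spanned M" and N: "subgroup N G" and MN: "M \<subseteq> N" and n: "n \<ge> 1"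
    and vs: "vertex_reps M vs" and es: "edge_reps M es"
  shows "real n * real (card {a \<in> connections N n. shape N n a = M}) *
      crossing (\<lambda>(x, u) (y, v). x = y \<and> inv u \<otimes> v \<in> N) n es =
    fact n ^ card (edges N) * crossing (\<lambda>u v. inv u \<otimes> v \<in> N) n (vs @ [\<one>])"
proof -
  let ?h = "holonomy N n"
  define V where "V = set (vs @ [\<one>])"
  have subM: "subgroup M G" using M by (simp add: spanned_def)
  have VW: "V \<subseteq> W" "\<one> \<in> V" "finite V" using vs one_W by (auto simp: V_def vertex_reps_def)
  have Vc: "v \<in> carrier G" if "v \<in> V" for v using VW W_closed that by blast
  define r where "r u = (SOME v. v \<in> V \<and> inv v \<otimes> u \<in> M)" for u
  have r: "r u \<in> V" "inv (r u) \<otimes> u \<in> M" if u: "u \<in> W" for u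
  proof -
    obtain v where v: "v \<in> V \<and> inv v \<otimes> u \<in> M" using vs u unfolding vertex_reps_def V_def by blast
    have "r u \<in> V \<and> inv (r u) \<otimes> u \<in> M"
      unfolding r_def by (rule someI[of "\<lambda>v. v \<in> V \<and> inv v \<otimes> u \<in> M", OF v])
    then show "r u \<in> V" "inv (r u) \<otimes> u \<in> M" by auto
  qed
  have Vinj: "u = v" if "u \<in> V" "v \<in> V" "inv u \<otimes> v \<in> M" for u v
    using vs that unfolding vertex_reps_def V_def by blast
  have r_eq_iff: "r u = r v \<longleftrightarrow> inv u \<otimes> v \<in> M" if u: "u \<in> W" and v: "v \<in> W" for u v
  proof -
    have c: "u \<in> carrier G" "v \<in> carrier G" "r u \<in> carrier G" "r v \<in> carrier G"
      using u v r(1) Vc W_closed by auto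
    show ?thesis
    proof
      assume eq: "r u = r v"
      then have "inv (r u) \<otimes> v \<in> M" using r(2)[OF v] by simp
      then show "inv u \<otimes> v \<in> M" using coset_trans[OF subM c(1,3,2) coset_sym[OF subM c(3,1) r(2)[OF u]]] by blast
    next
      assume "inv u \<otimes> v \<in> M"
      then have "inv (r u) \<otimes> v \<in> M" using coset_trans[OF subM c(3,1,2) r(2)[OF u]] by blast
      then have "inv (r u) \<otimes> r v \<in> M" using coset_trans[OF subM c(3,2,4) _ coset_sym[OF subM c(4,2) r(2)[OF v]]] by blast
      then show "r u = r v" using Vinj r(1) u v by blast
    qed
  qed
  have r_N: "inv (r u) \<otimes> r v \<in> N \<longleftrightarrow> inv u \<otimes> v \<in> N" if u: "u \<in> W" and v: "v \<in> W" for u v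
  proof -
    have c: "u \<in> carrier G" "v \<in> carrier G" "r u \<in> carrier G" "r v \<in> carrier G"
      using u v r(1) Vc W_closed by auto
    have "r u <# N = u <# N" "r v <# N = v <# N"
      using l_coset_eq_iff[OF N c(3,1)] l_coset_eq_iff[OF N c(4,2)] r(2) u v MN by auto
    then show ?thesis using l_coset_eq_iff[OF N c(1,2)] l_coset_eq_iff[OF N c(3,4)] by simp
  qed
  have r_V: "r v = v" if "v \<in> V" for v
    using Vinj[OF r(1) that r(2)] VW that by blast
  define L where "L = {l \<in> V \<rightarrow>\<^sub>E {1..n}. l \<one> = 1 \<and>
    (\<forall>u\<in>V. \<forall>v\<in>V. u \<noteq> v \<longrightarrow> inv u \<otimes> v \<in> N \<longrightarrow> l u \<noteq> l v)}"
  have card_L: "real n * real (card L) = crossing (\<lambda>u v. inv u \<otimes> v \<in> N) n (vs @ [\<one>])"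
    unfolding L_def V_def
  proof (rule card_separating_labellings[OF n])
    show "distinct (vs @ [\<one>])" using vs by (simp add: vertex_reps_def)
    show "inv v \<otimes> u \<in> N" if "inv u \<otimes> v \<in> N" "u \<in> set (vs @ [\<one>])" "v \<in> set (vs @ [\<one>])" for u v
      using coset_sym[OF N _ _ that(1)] that(2,3) Vc unfolding V_def by blast
    show "inv u \<otimes> w \<in> N" if "inv u \<otimes> v \<in> N" "inv v \<otimes> w \<in> N" "u \<in> set (vs @ [\<one>])"
      "v \<in> set (vs @ [\<one>])" "w \<in> set (vs @ [\<one>])" for u v w
      using coset_trans[OF N _ _ _ that(1,2)] that(3-5) Vc unfolding V_def by blast
  qed
  define A where "A l = {a \<in> connections N n. \<forall>(x, u)\<in>set es. a (x, u <# N) (l (r u)) = l (r (x \<otimes> u))}" for l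
  have esD: "(x, u) \<in> window_edges" if "(x, u) \<in> set es" for x u using es that by (auto simp: edge_reps_def)
  have sheet_iff: "?h a u 1 = ?h a v 1 \<longleftrightarrow> inv u \<otimes> v \<in> stab N n a"
    if a: "a \<in> connections N n" and uv: "u \<in> carrier G" "v \<in> carrier G" "inv u \<otimes> v \<in> N" for a u v
  proof -
    have "?h a v 1 = ?h a u (?h a (inv u \<otimes> v) 1)" using holonomy_quotient[OF N a uv] by simp
    moreover have "inj (?h a u)" using perms_inj[OF holonomy_perms[OF N a uv(1)]] .
    ultimately show ?thesis using uv(3) by (auto simp: stab_def inj_eq)
  qed
  have stab_pair: "inv u \<otimes> v \<in> stab N n a \<longleftrightarrow> inv u \<otimes> v \<in> N \<and> ?h a u 1 = ?h a v 1"
    if a: "a \<in> connections N n" and uv: "u \<in> W" "v \<in> W" for a u v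
    using sheet_iff[OF a W_closed[OF uv(1)] W_closed[OF uv(2)]] by (auto simp: stab_def)
  have shape_iff: "shape N n a = M \<longleftrightarrow> (\<forall>u\<in>W. \<forall>v\<in>W. inv u \<otimes> v \<in> N \<and> ?h a u 1 = ?h a v 1 \<longleftrightarrow> inv u \<otimes> v \<in> M)"
    if a: "a \<in> connections N n" for a
    unfolding shape_def supported_part_eq_iff[OF M stab_subgroup[OF N a]] using stab_pair[OF a] by auto
  have sheet: "?h a u 1 = l (r u)" if l: "l \<in> L" and a: "a \<in> A l" and u: "u \<in> W" for a l u
  proof -
    have ac: "a \<in> connections N n" using a by (simp add: A_def)
    show ?thesis using u
    proof (induction rule: window_edges_induct)
      case one
      have "l \<one> = 1" using l by (simp add: L_def)
      then show ?case using holonomy_one[OF N ac] r_V[OF VW(2)] by simp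
    next
      case (step x u)
      note c = window_edgesD[OF step]
      obtain v where v: "(x, v) \<in> set es" "inv v \<otimes> u \<in> M"
        using es step unfolding edge_reps_def by blast
      note d = window_edgesD[OF esD[OF v(1)]]
      have "r v = r u" using r_eq_iff[OF d(2) c(2)] v(2) by simp
      moreover have "inv (x \<otimes> v) \<otimes> (x \<otimes> u) \<in> M" using v(2) c d by (simp add: inv_mult_cancel_left)
      then have "r (x \<otimes> v) = r (x \<otimes> u)" using r_eq_iff[OF d(3) c(3)] by simp
      moreover have "v <# N = u <# N" using l_coset_eq_iff[OF N d(5) c(5)] v(2) MN by blast
      ultimately have "a (x, u <# N) (l (r u)) = l (r (x \<otimes> u))" using a v(1) by (auto simp: A_def)
      moreover have "?h a (x \<otimes> u) 1 = a (x, u <# N) (?h a u 1)" using holonomy_edge[OF N ac step] by simp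
      moreover have "inj (a (x, u <# N))" using perms_inj[OF connection_perms[OF N ac edgesI[OF step]]] .
      ultimately show ?case by (metis inj_eq)
    qed
  qed
  have UN: "{a \<in> connections N n. shape N n a = M} = (\<Union>l\<in>L. A l)"
  proof (intro equalityI subsetI)
    fix a assume "a \<in> {a \<in> connections N n. shape N n a = M}"
    then have a: "a \<in> connections N n"
      and sh: "\<And>u v. u \<in> W \<Longrightarrow> v \<in> W \<Longrightarrow> inv u \<otimes> v \<in> N \<and> ?h a u 1 = ?h a v 1 \<longleftrightarrow> inv u \<otimes> v \<in> M"
      using shape_iff by auto
    define l where "l = (\<lambda>v\<in>V. ?h a v 1)"
    have "?h a v 1 \<in> {1..n}" if "v \<in> V" for v
      using holonomy_perms[OF N a Vc[OF that]] n permutes_in_image[of "?h a v" "{1..n}" 1] by (simp add: sym_group_carrier)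
    moreover have "?h a u 1 \<noteq> ?h a v 1" if "u \<in> V" "v \<in> V" "u \<noteq> v" "inv u \<otimes> v \<in> N" for u v
      using sh[of u v] Vinj[of u v] that VW(1) by blast
    moreover have "?h a \<one> 1 = 1" using holonomy_one[OF N a] by simp
    ultimately have lL: "l \<in> L" using VW(2) by (auto simp: L_def l_def)
    have l_r: "l (r u) = ?h a u 1" if u: "u \<in> W" for u
    proof -
      have "r u \<in> W" using r(1)[OF u] VW by blast
      then show ?thesis using sh[OF _ u, of "r u"] r[OF u] by (simp add: l_def)
    qed
    have "a (x, u <# N) (l (r u)) = l (r (x \<otimes> u))" if "(x, u) \<in> set es" for x u
    proof -
      note c = window_edgesD[OF esD[OF that]]
      show ?thesis using l_r[OF c(2)] l_r[OF c(3)] holonomy_edge[OF N a esD[OF that]] by simp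
    qed
    then have "a \<in> A l" using a by (auto simp: A_def)
    then show "a \<in> (\<Union>l\<in>L. A l)" using lL by blast
  next
    fix a assume "a \<in> (\<Union>l\<in>L. A l)"
    then obtain l where l: "l \<in> L" "a \<in> A l" by blast
    then have a: "a \<in> connections N n" by (simp add: A_def)
    have "inv u \<otimes> v \<in> N \<and> ?h a u 1 = ?h a v 1 \<longleftrightarrow> inv u \<otimes> v \<in> M" if uv: "u \<in> W" "v \<in> W" for u v
    proof
      assume *: "inv u \<otimes> v \<in> N \<and> ?h a u 1 = ?h a v 1"
      then have "l (r u) = l (r v)" "inv (r u) \<otimes> r v \<in> N" using sheet[OF l] uv r_N[OF uv] by auto
      then have "r u = r v" using l(1) r(1) uv unfolding L_def by blast
      then show "inv u \<otimes> v \<in> M" using r_eq_iff[OF uv] by simp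
    next
      assume "inv u \<otimes> v \<in> M"
      then show "inv u \<otimes> v \<in> N \<and> ?h a u 1 = ?h a v 1"
        using r_eq_iff[OF uv] sheet[OF l] uv MN by auto
    qed
    then show "a \<in> {a \<in> connections N n. shape N n a = M}" using shape_iff[OF a] a by blast
  qed
  have finconn: "finite (connections N n)" using finite_edges by (intro finite_PiE) auto
  have disj: "A l \<inter> A l' = {}" if ll: "l \<in> L" "l' \<in> L" "l \<noteq> l'" for l l'
  proof (rule ccontr)
    assume "A l \<inter> A l' \<noteq> {}"
    then obtain a where a: "a \<in> A l" "a \<in> A l'" by blast
    have "l v = l' v" if "v \<in> V" for v
      using sheet[OF ll(1) a(1), of v] sheet[OF ll(2) a(2), of v] r_V[OF that] VW(1) that by auto
    then have "l = l'" using ll by (intro extensionalityI[of _ V]) (auto simp: L_def PiE_iff)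
    then show False using ll(3) by simp
  qed
  let ?E = "crossing (\<lambda>(x, u) (y, v). x = y \<and> inv u \<otimes> v \<in> N) n es"
  have card_A: "real (card (A l)) * ?E = fact n ^ card (edges N)" if l: "l \<in> L" for l
  proof -
    define g where "g = (\<lambda>(x, u). ((x, u <# N), l (r u), l (r (x \<otimes> u))))"
    have lV: "l v \<in> {1..n}" if "v \<in> V" for v using l that by (auto simp: L_def PiE_iff)
    have lsep: "u = v" if "u \<in> V" "v \<in> V" "inv u \<otimes> v \<in> N" "l u = l v" for u v
      using l that unfolding L_def by blast
    have es_inj: "u = v" if "(x, u) \<in> set es" "(x, v) \<in> set es" "inv u \<otimes> v \<in> M" for x u v
      using es that unfolding edge_reps_def by blast
    have key: "u = v" if xu: "(x, u) \<in> set es" "(x, v) \<in> set es" "u <# N = v <# N"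
      and or: "l (r u) = l (r v) \<or> l (r (x \<otimes> u)) = l (r (x \<otimes> v))" for x u v
    proof -
      note c = window_edgesD[OF esD[OF xu(1)]] and d = window_edgesD[OF esD[OF xu(2)]]
      have uvN: "inv u \<otimes> v \<in> N" using l_coset_eq_iff[OF N c(5) d(5)] xu(3) by simp
      have "inv u \<otimes> v \<in> M"
      proof (cases "l (r u) = l (r v)")
        case True
        then have "r u = r v" using lsep[OF r(1)[OF c(2)] r(1)[OF d(2)]] r_N[OF c(2) d(2)] uvN by simp
        then show ?thesis using r_eq_iff[OF c(2) d(2)] by simp
      next
        case False
        have eq: "inv (x \<otimes> u) \<otimes> (x \<otimes> v) = inv u \<otimes> v" using c d by (simp add: inv_mult_cancel_left)
        have "r (x \<otimes> u) = r (x \<otimes> v)"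
          using lsep[OF r(1)[OF c(3)] r(1)[OF d(3)]] r_N[OF c(3) d(3)] uvN eq False or by simp
        then show ?thesis using r_eq_iff[OF c(3) d(3)] eq by simp
      qed
      then show ?thesis using es_inj xu by blast
    qed
    have "inj_on g (set es)"
    proof (rule inj_onI)
      fix c d assume cd: "c \<in> set es" "d \<in> set es" "g c = g d"
      obtain x u y v where "c = (x, u)" "d = (y, v)" by (cases c; cases d)
      then show "c = d" using cd key[of x u v] by (simp add: g_def)
    qed
    then have dist: "distinct (map g es)" using es by (simp add: distinct_map edge_reps_def)
    have "real (card {a \<in> connections N n. \<forall>(i, p, q)\<in>set (map g es). a i p = q}) *
      crossing (\<lambda>c c'. fst c = fst c') n (map g es) = fact n ^ card (edges N)"
    proof (rule card_constrained_perms[OF finite_edges _ _ dist])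
      fix i p q assume "(i, p, q) \<in> set (map g es)"
      then obtain x u where xu: "(x, u) \<in> set es" "i = (x, u <# N)" "p = l (r u)" "q = l (r (x \<otimes> u))"
        by (auto simp: g_def)
      note c = window_edgesD[OF esD[OF xu(1)]]
      show "i \<in> edges N \<and> p \<in> {1..n} \<and> q \<in> {1..n}"
        using xu edgesI[OF esD[OF xu(1)]] lV r(1) c by simp
      fix p' q' assume "(i, p', q') \<in> set (map g es)" and ne: "(p, q) \<noteq> (p', q')"
      then obtain y v where yv: "(y, v) \<in> set es" "i = (y, v <# N)" "p' = l (r v)" "q' = l (r (y \<otimes> v))"
        by (auto simp: g_def)
      then show "p \<noteq> p' \<and> q \<noteq> q'" using xu key[of x u v] ne by auto
    qed
    moreover have "{a \<in> connections N n. \<forall>(i, p, q)\<in>set (map g es). a i p = q} = A l"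
      by (auto simp: A_def g_def)
    moreover have "crossing (\<lambda>c c'. fst c = fst c') n (map g es) = ?E"
      unfolding crossing_map
    proof (rule crossing_cong)
      fix c d assume cd: "c \<in> set es" "d \<in> set es"
      obtain x u y v where xu: "c = (x, u)" "d = (y, v)" by (cases c; cases d)
      have "u \<in> carrier G" "v \<in> carrier G" using cd xu esD window_edgesD(5) by blast+
      then show "fst (g c) = fst (g d) \<longleftrightarrow> (case c of (x, u) \<Rightarrow> \<lambda>(y, v). x = y \<and> inv u \<otimes> v \<in> N) d"
        using xu l_coset_eq_iff[OF N] by (simp add: g_def)
    qed
    ultimately show ?thesis by simp
  qed
  have finL: "finite L" by (rule finite_subset[of _ "V \<rightarrow>\<^sub>E {1..n}"]) (use VW(3) in \<open>auto simp: L_def intro: finite_PiE\<close>)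
  have "card {a \<in> connections N n. shape N n a = M} = (\<Sum>l\<in>L. card (A l))"
    unfolding UN
  proof (rule card_UN_disjoint[OF finL])
    show "\<forall>l\<in>L. finite (A l)" using finconn by (auto simp: A_def)
  qed (use disj in blast)
  then have "real (card {a \<in> connections N n. shape N n a = M}) * ?E = (\<Sum>l\<in>L. real (card (A l)) * ?E)"
    by (simp add: sum_distrib_right)
  also have "\<dots> = real (card L) * fact n ^ card (edges N)" using card_A by simp
  finally have eq: "real (card {a \<in> connections N n. shape N n a = M}) * ?E =
    real (card L) * fact n ^ card (edges N)" .
  show ?thesis unfolding card_L[symmetric] mult.assoc eq by (simp only: mult_ac)
qed

end

section \<open>Asymptotic expansions over a join-semilattice of subgroups\<close>

text \<open>The function \<open>\<phi>\<close> depends on the subgroup \<open>N\<close> only through the indicators of \<open>J \<subseteq> N\<close>,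
  where an indicator of weight \<open>d J\<close> comes with order \<open>n ^ - d J\<close> at most.\<close>

definition expansion :: "'q set set \<Rightarrow> ('q set \<Rightarrow> nat) \<Rightarrow> (nat \<Rightarrow> 'q set \<Rightarrow> real) \<Rightarrow> bool" where
  "expansion Q d \<phi> \<longleftrightarrow> (\<exists>c. (\<forall>J\<in>Q. c J \<in> O(\<lambda>n. 1 / real n ^ d J)) \<and>
     (\<forall>\<^sub>F n in sequentially. \<forall>N\<in>Q. \<phi> n N = (\<Sum>J\<in>{J\<in>Q. J \<subseteq> N}. c J n)))"

locale weighted_joins =
  fixes Q :: "'q set set" and d :: "'q set \<Rightarrow> nat" and M :: "'q set"
  assumes finite_Q: "finite Q" and M_Q: "M \<in> Q" and d_M: "d M = 0"
    and M_least: "\<And>N. N \<in> Q \<Longrightarrow> M \<subseteq> N"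
    and joins: "\<And>J J'. J \<in> Q \<Longrightarrow> J' \<in> Q \<Longrightarrow>
      \<exists>K\<in>Q. (\<forall>N\<in>Q. K \<subseteq> N \<longleftrightarrow> J \<subseteq> N \<and> J' \<subseteq> N) \<and> d K \<le> d J + d J'"
begin

lemma expansion_cong:
  assumes "expansion Q d \<phi>" "\<forall>\<^sub>F n in sequentially. \<forall>N\<in>Q. \<phi> n N = \<psi> n N"
  shows "expansion Q d \<psi>"
proof -
  obtain c where c: "\<forall>J\<in>Q. c J \<in> O(\<lambda>n. 1 / real n ^ d J)"
    "\<forall>\<^sub>F n in sequentially. \<forall>N\<in>Q. \<phi> n N = (\<Sum>J\<in>{J\<in>Q. J \<subseteq> N}. c J n)"
    using assms(1) unfolding expansion_def by blast
  have "\<forall>\<^sub>F n in sequentially. \<forall>N\<in>Q. \<psi> n N = (\<Sum>J\<in>{J\<in>Q. J \<subseteq> N}. c J n)"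
    using c(2) assms(2) by eventually_elim simp
  then show ?thesis using c(1) unfolding expansion_def by blast
qed

lemma expansion_single:
  assumes "J0 \<in> Q" "g \<in> O(\<lambda>n. 1 / real n ^ d J0)"
  shows "expansion Q d (\<lambda>n N. if J0 \<subseteq> N then g n else 0)"
  unfolding expansion_def
proof (intro exI conjI ballI always_eventually allI)
  show "(\<lambda>n. if J = J0 then g n else 0) \<in> O(\<lambda>n. 1 / real n ^ d J)" for J
    using assms(2) by (cases "J = J0") auto
  fix n N assume "N \<in> Q"
  have "(\<Sum>J\<in>{J\<in>Q. J \<subseteq> N}. if J = J0 then g n else 0) = (if J0 \<in> {J\<in>Q. J \<subseteq> N} then g n else 0)"
    using finite_Q by (subst sum.delta) auto
  then show "(if J0 \<subseteq> N then g n else 0) = (\<Sum>J\<in>{J\<in>Q. J \<subseteq> N}. if J = J0 then g n else 0)"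
    using assms(1) by simp
qed

lemma expansion_const:
  assumes "g \<in> O(\<lambda>n. 1)"
  shows "expansion Q d (\<lambda>n N. g n)"
  by (rule expansion_cong[OF expansion_single[OF M_Q, of g]])
    (use assms d_M M_least in \<open>auto intro!: always_eventually\<close>)

lemma expansion_indicator:
  assumes "J0 \<in> Q" "d J0 \<le> 1"
  shows "expansion Q d (\<lambda>n N. (if J0 \<subseteq> N then 1 else 0) / real n)"
proof -
  have "(\<lambda>n. 1 / real n) \<in> O(\<lambda>n. 1 / real n ^ d J0)"
  proof (cases "d J0")
    case 0
    have "(\<lambda>n. 1 / real n) \<in> O(\<lambda>n. 1)"
      by (rule bigoI[of _ 1], rule eventually_sequentiallyI[of 1]) (simp add: field_simps)
    then show ?thesis using 0 by simp
  next
    case (Suc k)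
    then have "d J0 = 1" using assms(2) by simp
    then show ?thesis by simp
  qed
  from expansion_single[OF assms(1) this] show ?thesis
    by (rule expansion_cong) (auto intro!: always_eventually)
qed

lemma expansion_add:
  assumes "expansion Q d \<phi>" "expansion Q d \<psi>"
  shows "expansion Q d (\<lambda>n N. \<phi> n N + \<psi> n N)"
proof -
  obtain c where c: "\<forall>J\<in>Q. c J \<in> O(\<lambda>n. 1 / real n ^ d J)"
    "\<forall>\<^sub>F n in sequentially. \<forall>N\<in>Q. \<phi> n N = (\<Sum>J\<in>{J\<in>Q. J \<subseteq> N}. c J n)"
    using assms(1) unfolding expansion_def by blast
  obtain e where e: "\<forall>J\<in>Q. e J \<in> O(\<lambda>n. 1 / real n ^ d J)"
    "\<forall>\<^sub>F n in sequentially. \<forall>N\<in>Q. \<psi> n N = (\<Sum>J\<in>{J\<in>Q. J \<subseteq> N}. e J n)"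
    using assms(2) unfolding expansion_def by blast
  show ?thesis
    unfolding expansion_def
  proof (intro exI conjI ballI)
    show "(\<lambda>n. c J n + e J n) \<in> O(\<lambda>n. 1 / real n ^ d J)" if "J \<in> Q" for J
      using c(1) e(1) that by (intro sum_in_bigo) auto
    show "\<forall>\<^sub>F n in sequentially. \<forall>N\<in>Q. \<phi> n N + \<psi> n N = (\<Sum>J\<in>{J\<in>Q. J \<subseteq> N}. c J n + e J n)"
      using c(2) e(2) by eventually_elim (simp add: sum.distrib)
  qed
qed

lemma inverse_power_bigo_mono:
  assumes "k \<le> l"
  shows "(\<lambda>n. 1 / real n ^ l) \<in> O(\<lambda>n. 1 / real n ^ k)"
proof (rule bigoI[of _ 1], rule eventually_sequentiallyI[of 1])
  fix n :: nat assume n: "n \<ge> 1"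
  then have "real n ^ k \<le> real n ^ l" using assms by (intro power_increasing) auto
  then show "norm (1 / real n ^ l) \<le> 1 * norm (1 / real n ^ k)" using n by (simp add: frac_le)
qed

text \<open>Subgroups \<open>J\<close> and \<open>J'\<close> both lie below \<open>N\<close> exactly when their join does, so a product of
  coefficients at \<open>J\<close> and \<open>J'\<close> contributes at the join, whose weight is at most the sum of the
  weights.\<close>

lemma expansion_mult:
  assumes "expansion Q d \<phi>" "expansion Q d \<psi>"
  shows "expansion Q d (\<lambda>n N. \<phi> n N * \<psi> n N)"
proof -
  obtain c where c: "\<forall>J\<in>Q. c J \<in> O(\<lambda>n. 1 / real n ^ d J)"
    "\<forall>\<^sub>F n in sequentially. \<forall>N\<in>Q. \<phi> n N = (\<Sum>J\<in>{J\<in>Q. J \<subseteq> N}. c J n)"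
    using assms(1) unfolding expansion_def by blast
  obtain e where e: "\<forall>J\<in>Q. e J \<in> O(\<lambda>n. 1 / real n ^ d J)"
    "\<forall>\<^sub>F n in sequentially. \<forall>N\<in>Q. \<psi> n N = (\<Sum>J\<in>{J\<in>Q. J \<subseteq> N}. e J n)"
    using assms(2) unfolding expansion_def by blast
  have "\<forall>p\<in>Q \<times> Q. \<exists>K. K \<in> Q \<and> (\<forall>N\<in>Q. K \<subseteq> N \<longleftrightarrow> fst p \<subseteq> N \<and> snd p \<subseteq> N) \<and> d K \<le> d (fst p) + d (snd p)"
  proof
    fix p assume "p \<in> Q \<times> Q"
    then have "fst p \<in> Q" "snd p \<in> Q" by auto
    from joins[OF this, unfolded Bex_def] show "\<exists>K. K \<in> Q \<and> (\<forall>N\<in>Q. K \<subseteq> N \<longleftrightarrow> fst p \<subseteq> N \<and> snd p \<subseteq> N) \<and>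
      d K \<le> d (fst p) + d (snd p)" .
  qed
  from bchoice[OF this] obtain j where j: "\<forall>p\<in>Q \<times> Q. j p \<in> Q \<and>
      (\<forall>N\<in>Q. j p \<subseteq> N \<longleftrightarrow> fst p \<subseteq> N \<and> snd p \<subseteq> N) \<and> d (j p) \<le> d (fst p) + d (snd p)" ..
  define m where "m J n = (\<Sum>p\<in>{p\<in>Q \<times> Q. j p = J}. c (fst p) n * e (snd p) n)" for J n
  have "m J \<in> O(\<lambda>n. 1 / real n ^ d J)" if "J \<in> Q" for J
    unfolding m_def
  proof (rule big_sum_in_bigo)
    fix p assume p: "p \<in> {p\<in>Q \<times> Q. j p = J}"
    then have "(\<lambda>n. c (fst p) n * e (snd p) n) \<in> O(\<lambda>n. 1 / real n ^ d (fst p) * (1 / real n ^ d (snd p)))"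
      using c(1) e(1) by (intro landau_o.big.mult) auto
    also have "(\<lambda>n. 1 / real n ^ d (fst p) * (1 / real n ^ d (snd p))) = (\<lambda>n. 1 / real n ^ (d (fst p) + d (snd p)))"
      by (simp add: power_add)
    also have "(\<lambda>n. 1 / real n ^ (d (fst p) + d (snd p))) \<in> O(\<lambda>n. 1 / real n ^ d J)"
      by (rule inverse_power_bigo_mono) (use p j in auto)
    finally show "(\<lambda>n. c (fst p) n * e (snd p) n) \<in> O(\<lambda>n. 1 / real n ^ d J)" .
  qed
  moreover have "\<forall>\<^sub>F n in sequentially. \<forall>N\<in>Q. \<phi> n N * \<psi> n N = (\<Sum>J\<in>{J\<in>Q. J \<subseteq> N}. m J n)"
    using c(2) e(2)
  proof eventually_elim
    case (elim n)
    show ?case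
    proof
      fix N assume N: "N \<in> Q"
      let ?D = "{J\<in>Q. J \<subseteq> N}"
      have jN: "j p \<subseteq> N \<longleftrightarrow> fst p \<subseteq> N \<and> snd p \<subseteq> N" if "p \<in> Q \<times> Q" for p
        using j that N by blast
      have "{p\<in>Q \<times> Q. j p \<subseteq> N} = {p\<in>Q \<times> Q. fst p \<subseteq> N \<and> snd p \<subseteq> N}"
        using jN by (intro Collect_cong) blast
      also have "\<dots> = ?D \<times> ?D" by auto
      finally have D: "{p\<in>Q \<times> Q. j p \<subseteq> N} = ?D \<times> ?D" .
      have "(\<Sum>J\<in>?D. m J n) = (\<Sum>J\<in>?D. \<Sum>p\<in>{p\<in>?D \<times> ?D. j p = J}. c (fst p) n * e (snd p) n)"
        unfolding m_def by (intro sum.cong refl) (use D in auto)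
      also have "\<dots> = (\<Sum>p\<in>?D \<times> ?D. c (fst p) n * e (snd p) n)"
      proof (rule sum.group)
        show "j ` (?D \<times> ?D) \<subseteq> ?D" using j unfolding D[symmetric] by auto
      qed (use finite_Q in auto)
      also have "\<dots> = (\<Sum>J\<in>?D. c J n) * (\<Sum>J\<in>?D. e J n)"
        by (simp add: sum_product sum.cartesian_product case_prod_unfold)
      finally show "\<phi> n N * \<psi> n N = (\<Sum>J\<in>?D. m J n)" using elim N by simp
    qed
  qed
  ultimately show ?thesis unfolding expansion_def by blast
qed

abbreviation below :: "'q set list \<Rightarrow> 'q set \<Rightarrow> nat" where
  "below Js N \<equiv> length (filter (\<lambda>J. J \<subseteq> N) Js)"

lemma expansion_linear_factor:
  assumes "\<And>J. J \<in> set Js \<Longrightarrow> J \<in> Q \<and> d J \<le> 1"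
  shows "expansion Q d (\<lambda>n N. (real n - real (below Js N)) / real n)"
  using assms
proof (induction Js)
  case Nil
  have "(\<lambda>n. real n / real n) \<in> O(\<lambda>n. 1)" by (rule bigoI[of _ 1]) (simp add: always_eventually)
  then show ?case using expansion_const by simp
next
  case (Cons J Js)
  have minus: "expansion Q d (\<lambda>n N. -1)" by (rule expansion_const) simp
  have ind: "expansion Q d (\<lambda>n N. (if J \<subseteq> N then 1 else 0) / real n)"
    by (rule expansion_indicator) (use Cons.prems in auto)
  have "expansion Q d (\<lambda>n N. (real n - real (below Js N)) / real n)" using Cons by simp
  from expansion_add[OF this expansion_mult[OF minus ind]] show ?case
    by (rule expansion_cong) (auto intro!: always_eventually simp: field_simps diff_divide_distrib add_divide_distrib)
qed

text \<open>With \<open>m = n - k - s\<close> one has \<open>n / (m - 1) = n / m + (1 / n) * (n / m) * (n / (m - 1))\<close>, which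
  removes the indicators from the denominator one by one.\<close>

lemma expansion_inverse_factor:
  assumes "\<And>J. J \<in> set Js \<Longrightarrow> J \<in> Q \<and> d J \<le> 1"
  shows "expansion Q d (\<lambda>n N. real n / (real n - real k - real (below Js N)))"
  using assms
proof (induction Js arbitrary: k)
  case Nil
  have "(\<lambda>n. real n / (real n - real k)) \<in> O(\<lambda>n. 1)"
  proof (rule bigoI[of _ 2], rule eventually_sequentiallyI[of "2 * k + 1"])
    fix n :: nat assume n: "2 * k + 1 \<le> n"
    then have "real n > 2 * real k" by linarith
    then show "norm (real n / (real n - real k)) \<le> 2 * norm (1::real)" by (simp add: field_simps)
  qed
  then show ?case using expansion_const by simp
next
  case (Cons J Js)
  have ind: "expansion Q d (\<lambda>n N. (if J \<subseteq> N then 1 else 0) / real n)"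
    by (rule expansion_indicator) (use Cons.prems in auto)
  have IH: "expansion Q d (\<lambda>n N. real n / (real n - real k - real (below Js N)))" for k
    using Cons by simp
  from expansion_add[OF IH[of k] expansion_mult[OF ind expansion_mult[OF IH[of k] IH[of "Suc k"]]]]
  show ?case
  proof (rule expansion_cong, intro eventually_sequentiallyI[of "k + length Js + 2"] ballI)
    fix n N assume n: "k + length Js + 2 \<le> n"
    define m where "m = real n - real k - real (below Js N)"
    have "below Js N \<le> length Js" by simp
    then have m: "m > 1" using n unfolding m_def by linarith
    have n0: "real n > 0" using n by simp
    have eq: "real n / m + 1 / real n * (real n / m * (real n / (m - 1))) = real n / (m - 1)"
      using m n0 by (simp add: field_simps)
    have eq_m1: "real n - real (Suc k) - real (below Js N) = m - 1" by (simp add: m_def)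
    have eq_m: "real n - real k - real (below (J # Js) N) = (if J \<subseteq> N then m - 1 else m)"
      by (simp add: m_def)
    show "real n / (real n - real k - real (below Js N)) + (if J \<subseteq> N then 1 else 0) / real n *
        (real n / (real n - real k - real (below Js N)) * (real n / (real n - real (Suc k) - real (below Js N)))) =
      real n / (real n - real k - real (below (J # Js) N))"
      unfolding eq_m1 eq_m m_def[symmetric]
    proof (cases "J \<subseteq> N")
      case True
      then show "real n / m + (if J \<subseteq> N then 1 else 0) / real n * (real n / m * (real n / (m - 1))) =
        real n / (if J \<subseteq> N then m - 1 else m)" by (simp only: True if_True eq)
    qed simp
  qed
qed

lemma exists_below_list:
  assumes "\<And>b. b \<in> set zs \<Longrightarrow> (\<forall>N\<in>Q. \<not> R N b) \<or> (\<exists>J\<in>Q. d J \<le> 1 \<and> (\<forall>N\<in>Q. R N b \<longleftrightarrow> J \<subseteq> N))"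
  shows "\<exists>Js. (\<forall>J\<in>set Js. J \<in> Q \<and> d J \<le> 1) \<and> (\<forall>N\<in>Q. length (filter (R N) zs) = below Js N)"
  using assms
proof (induction zs)
  case Nil
  show ?case by (intro exI[of _ "[]"]) simp
next
  case (Cons b zs)
  have "\<exists>Js. (\<forall>J\<in>set Js. J \<in> Q \<and> d J \<le> 1) \<and> (\<forall>N\<in>Q. length (filter (R N) zs) = below Js N)"
    by (rule Cons.IH) (use Cons.prems in auto)
  then obtain Js where Js: "\<forall>J\<in>set Js. J \<in> Q \<and> d J \<le> 1" "\<forall>N\<in>Q. length (filter (R N) zs) = below Js N"
    by blast
  have "(\<forall>N\<in>Q. \<not> R N b) \<or> (\<exists>J\<in>Q. d J \<le> 1 \<and> (\<forall>N\<in>Q. R N b \<longleftrightarrow> J \<subseteq> N))"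
    by (rule Cons.prems) simp
  then show ?case
  proof
    assume "\<forall>N\<in>Q. \<not> R N b"
    then show ?thesis using Js by (intro exI[of _ Js]) auto
  next
    assume "\<exists>J\<in>Q. d J \<le> 1 \<and> (\<forall>N\<in>Q. R N b \<longleftrightarrow> J \<subseteq> N)"
    then obtain J where "J \<in> Q" "d J \<le> 1" "\<forall>N\<in>Q. R N b \<longleftrightarrow> J \<subseteq> N" by blast
    then show ?thesis using Js by (intro exI[of _ "J # Js"]) auto
  qed
qed

lemma expansion_crossing:
  assumes "\<And>a b. a \<in> set zs \<Longrightarrow> b \<in> set zs \<Longrightarrow>
    (\<forall>N\<in>Q. \<not> R N a b) \<or> (\<exists>J\<in>Q. d J \<le> 1 \<and> (\<forall>N\<in>Q. R N a b \<longleftrightarrow> J \<subseteq> N))"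
  shows "expansion Q d (\<lambda>n N. crossing (R N) n zs / real n ^ length zs)"
    and "expansion Q d (\<lambda>n N. real n ^ length zs / crossing (R N) n zs)"
  using assms
proof (induction zs)
  case Nil
  {
    case 1
    show ?case using expansion_const[of "\<lambda>_. 1"] by simp
  next
    case 2
    show ?case using expansion_const[of "\<lambda>_. 1"] by simp
  }
next
  case (Cons z zs)
  {
    assume prems: "\<And>a b. a \<in> set (z # zs) \<Longrightarrow> b \<in> set (z # zs) \<Longrightarrow>
      (\<forall>N\<in>Q. \<not> R N a b) \<or> (\<exists>J\<in>Q. d J \<le> 1 \<and> (\<forall>N\<in>Q. R N a b \<longleftrightarrow> J \<subseteq> N))"
    obtain Js where Js: "\<forall>J\<in>set Js. J \<in> Q \<and> d J \<le> 1"
      "\<forall>N\<in>Q. length (filter (R N z) zs) = below Js N"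
      using exists_below_list[of zs "\<lambda>N. R N z"] prems[of z] by auto
    have lin: "expansion Q d (\<lambda>n N. (real n - real (length (filter (R N z) zs))) / real n)"
      by (rule expansion_cong[OF expansion_linear_factor[of Js]]) (use Js in \<open>auto intro!: always_eventually\<close>)
    have inv: "expansion Q d (\<lambda>n N. real n / (real n - real (length (filter (R N z) zs))))"
      by (rule expansion_cong[OF expansion_inverse_factor[of Js 0]]) (use Js in \<open>auto intro!: always_eventually\<close>)
    note lin inv
  } note factor = this
  {
    case 1
    have "expansion Q d (\<lambda>n N. crossing (R N) n zs / real n ^ length zs)"
      by (rule Cons.IH(1)) (use 1 in auto)
    from expansion_mult[OF factor(1)[OF 1] this] show ?case by simp
  next
    case 2
    have "expansion Q d (\<lambda>n N. real n ^ length zs / crossing (R N) n zs)"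
      by (rule Cons.IH(2)) (use 2 in auto)
    from expansion_mult[OF factor(2)[OF 2] this] show ?case by simp
  }
qed

end

section \<open>Expected number of common fixed points\<close>

definition fix_prob :: "('a, 'b) monoid_scheme \<Rightarrow> 'a set \<Rightarrow> 'a set \<Rightarrow> nat \<Rightarrow> real" where
  "fix_prob G N H n =
     real (card {\<phi> \<in> perm_homs G N n. \<forall>h\<in>H. \<phi> h 1 = 1}) / real (card (perm_homs G N n))"

lemma crossing_pos: "n > length zs \<Longrightarrow> crossing R n zs > 0"
proof (induction zs)
  case (Cons z zs)
  have "length zs < n" using Cons.prems by simp
  then have "length (filter (R z) zs) < n" by (rule le_less_trans[OF length_filter_le])
  then show ?case using Cons by simp
qed simp

lemma crossing_discrete:
  "distinct zs \<Longrightarrow> (\<And>a b. a \<in> set zs \<Longrightarrow> b \<in> set zs \<Longrightarrow> R a b \<Longrightarrow> a = b) \<Longrightarrow>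
   crossing R n zs = real n ^ length zs"
proof (induction zs)
  case (Cons z zs)
  have "filter (R z) zs = []" using Cons.prems by (auto simp: filter_empty_conv)
  then show ?case using Cons by simp
qed simp

lemma card_perms_fixing_one:
  assumes "n \<ge> 1"
  shows "card {p \<in> perms n. p 1 = 1} = fact (n - 1)"
proof -
  have "{p \<in> perms n. p 1 = 1} = {p. p permutes {2..n}}"
  proof (intro equalityI subsetI)
    fix p assume "p \<in> {p \<in> perms n. p 1 = 1}"
    then have p: "p permutes {1..n}" "p 1 = 1" by (auto simp: sym_group_carrier)
    have "p permutes {2..n}"
    proof (rule permutes_superset[OF p(1)])
      fix x assume "x \<in> {1..n} - {2..n}"
      then have "x = 1" by auto
      then show "p x = x" using p(2) by simp
    qed
    then show "p \<in> {p. p permutes {2..n}}" by simp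
  next
    fix p assume "p \<in> {p. p permutes {2..n}}"
    then have p: "p permutes {2..n}" by simp
    then have "p 1 = 1" by (rule permutes_not_in) simp
    moreover have "p permutes {1..n}" by (rule permutes_subset[OF p]) simp
    ultimately show "p \<in> {p \<in> perms n. p 1 = 1}" by (simp add: sym_group_carrier)
  qed
  moreover have "card {p. p permutes {2..n}} = fact (card {2..n})" by (rule card_permutations) simp_all
  ultimately show ?thesis by simp
qed

lemma (in group) fixes_point_iff_generators:
  assumes \<phi>: "\<phi> \<in> perm_homs G J n" and J: "subgroup J G" and B: "B \<subseteq> J" and H: "generate G B = H"
  shows "(\<forall>h\<in>H. \<phi> h i = i) \<longleftrightarrow> (\<forall>b\<in>B. \<phi> b i = i)"
proof
  assume "\<forall>h\<in>H. \<phi> h i = i"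
  then show "\<forall>b\<in>B. \<phi> b i = i" using H by (auto intro: generate.incl)
next
  assume fix_B: "\<forall>b\<in>B. \<phi> b i = i"
  have Bc: "B \<subseteq> carrier G" using B subgroup.subset[OF J] by blast
  have HJ: "H \<subseteq> J" using generate_subgroup_incl[OF B J] H by simp
  show "\<forall>h\<in>H. \<phi> h i = i"
  proof
    fix h assume "h \<in> H"
    then have "h \<in> generate G B" using H by simp
    then show "\<phi> h i = i" using Bc
    proof (induction rule: generate_induct_iff)
      case one
      show ?case using perm_homs_one[OF \<phi> J] by simp
    next
      case (step x u)
      have x: "x \<in> J" and u: "u \<in> J" using step B H HJ by auto
      have "\<phi> (x \<otimes> u) i = \<phi> x (\<phi> u i)" using perm_homs_mult[OF \<phi> x u] by simp
      moreover have "\<phi> x i = i" using fix_B step(1) by blast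
      ultimately show ?case using injD[OF perms_inj[OF perm_homs_perms[OF \<phi> x]], of "\<phi> u i" i] by auto
    qed
  qed
qed

text \<open>A homomorphism from a free group is given by independent images of the basis elements.\<close>

lemma (in free_group_with_basis) fix_prob_free_factor:
  assumes N: "subgroup N G" "rk G N \<noteq> \<infinity>" and ff: "free_factor G H N" and n: "n \<ge> 1"
    and r: "rk G H = enat r"
  shows "fix_prob G N H n = 1 / real n ^ r"
proof -
  obtain B B0 where B: "free_basis G N B" "B0 \<subseteq> B" "generate G B0 = H"
    using ff free_factor_iff[OF N(1)] by blast
  have fin: "finite B" using rk_eq_card[OF B(1)] N(2) by (auto split: if_splits)
  have fin0: "finite B0" using finite_subset[OF B(2) fin] .
  have "free_basis G H B0" using free_basis_subset[OF B(1,2)] B(3) by simp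
  then have card0: "card B0 = r" using rk_eq_card[of H B0] fin0 r by simp
  have BN: "B \<subseteq> N" using B(1) by (auto simp: free_basis_def intro: generate.incl)
  let ?S = "\<lambda>b. if b \<in> B0 then {p \<in> perms n. p 1 = 1} else perms n"
  note bij = bij_betw_perm_homs_basis[OF B(1), of n]
  have iff: "(\<forall>h\<in>H. \<phi> h 1 = 1) \<longleftrightarrow> (\<forall>b\<in>B0. \<phi> b 1 = 1)" if "\<phi> \<in> perm_homs G N n" for \<phi>
    by (rule fixes_point_iff_generators[OF that N(1) _ B(3)]) (use B(2) BN in blast)
  have "bij_betw (\<lambda>\<phi>. restrict \<phi> B) {\<phi> \<in> perm_homs G N n. \<forall>h\<in>H. \<phi> h 1 = 1} (PiE B ?S)"
    unfolding bij_betw_def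
  proof (intro conjI equalityI subsetI)
    show "inj_on (\<lambda>\<phi>. restrict \<phi> B) {\<phi> \<in> perm_homs G N n. \<forall>h\<in>H. \<phi> h 1 = 1}"
      using bij by (auto simp: bij_betw_def intro: inj_on_subset)
    fix f assume "f \<in> (\<lambda>\<phi>. restrict \<phi> B) ` {\<phi> \<in> perm_homs G N n. \<forall>h\<in>H. \<phi> h 1 = 1}"
    then obtain \<phi> where \<phi>: "\<phi> \<in> perm_homs G N n" "\<forall>h\<in>H. \<phi> h 1 = 1" "f = restrict \<phi> B" by blast
    then show "f \<in> PiE B ?S" using iff[OF \<phi>(1)] BN perm_homs_perms[OF \<phi>(1)] by auto
  next
    fix f assume f: "f \<in> PiE B ?S"
    then have "f \<in> B \<rightarrow>\<^sub>E perms n" by (auto simp: PiE_iff split: if_splits)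
    then obtain \<phi> where \<phi>: "\<phi> \<in> perm_homs G N n" "f = restrict \<phi> B" using bij unfolding bij_betw_def by blast
    have "\<phi> b 1 = 1" if b: "b \<in> B0" for b
    proof -
      have "f b \<in> ?S b" by (rule PiE_mem[OF f]) (use b B(2) in blast)
      then show ?thesis using \<phi>(2) b B(2) by auto
    qed
    then show "f \<in> (\<lambda>\<phi>. restrict \<phi> B) ` {\<phi> \<in> perm_homs G N n. \<forall>h\<in>H. \<phi> h 1 = 1}"
      using \<phi> iff[OF \<phi>(1)] by blast
  qed
  then have "card {\<phi> \<in> perm_homs G N n. \<forall>h\<in>H. \<phi> h 1 = 1} = (\<Prod>b\<in>B. card (?S b))"
    by (simp only: bij_betw_same_card card_PiE[OF fin])
  also have "\<dots> = (\<Prod>b\<in>B. if b \<in> B0 then fact (n - 1) else fact n)"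
    using card_perms_fixing_one[OF n] by (intro prod.cong) auto
  also have "\<dots> = fact (n - 1) ^ card (B \<inter> B0) * fact n ^ card (B \<inter> - B0)"
    using fin by (simp add: prod.If_cases)
  also have "B \<inter> B0 = B0" using B(2) by blast
  finally have num: "card {\<phi> \<in> perm_homs G N n. \<forall>h\<in>H. \<phi> h 1 = 1} =
    fact (n - 1) ^ r * fact n ^ card (B \<inter> - B0)" using card0 by simp
  have "card B = r + card (B \<inter> - B0)"
    using card0 card_Un_disjoint[of B0 "B \<inter> - B0"] fin fin0 B(2) by (simp add: Un_Int_distrib Un_absorb1)
  then have "card (perm_homs G N n) = fact n ^ r * fact n ^ card (B \<inter> - B0)"
    using card_perm_homs(2)[OF B(1) fin] by (simp add: power_add)
  then have "fix_prob G N H n = (fact (n - 1) / fact n) ^ r"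
    unfolding fix_prob_def num by (simp add: power_divide)
  also have "fact n = real n * fact (n - 1)" using n by (simp add: fact_reduce)
  finally show ?thesis by (simp add: power_divide)
qed

context cayley_window
begin

definition overgroups :: "'a set \<Rightarrow> 'a set set" where
  "overgroups M = {N. spanned N \<and> M \<subseteq> N}"

text \<open>The number of elements that have to be added to \<open>M\<close> to generate \<open>J\<close>. It is subadditive under joins and
  bounds the growth of the rank.\<close>

definition gen_dist :: "'a set \<Rightarrow> 'a set \<Rightarrow> nat" where
  "gen_dist M J = (LEAST k. \<exists>S. finite S \<and> card S \<le> k \<and> S \<subseteq> carrier G \<and> J = generate G (M \<union> S))"

lemma finite_overgroups: "finite (overgroups M)"
proof (rule finite_subset)
  let ?P = "(\<lambda>(u, v). inv u \<otimes> v) ` (W \<times> W)"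
  show "finite (generate G ` Pow ?P)" using finite_W by simp
  show "overgroups M \<subseteq> generate G ` Pow ?P"
  proof
    fix N assume "N \<in> overgroups M"
    then have "N = generate G {inv u \<otimes> v |u v. u \<in> W \<and> v \<in> W \<and> inv u \<otimes> v \<in> N}"
      by (simp add: overgroups_def spanned_def supported_part_def)
    moreover have "{inv u \<otimes> v |u v. u \<in> W \<and> v \<in> W \<and> inv u \<otimes> v \<in> N} \<in> Pow ?P" by auto
    ultimately show "N \<in> generate G ` Pow ?P" by (rule image_eqI)
  qed
qed

lemma spanned_subgroup: "spanned N \<Longrightarrow> subgroup N G"
  by (simp add: spanned_def)

lemma overgroups_subgroup: "N \<in> overgroups M \<Longrightarrow> subgroup N G"
  by (simp add: overgroups_def spanned_subgroup)

lemma spanned_generate: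
  assumes S: "S \<subseteq> carrier G" "S \<subseteq> supported_part G W (generate G S)"
  shows "spanned (generate G S)"
proof -
  have sub: "subgroup (generate G S) G" using generate_is_subgroup[OF S(1)] .
  have "generate G S \<subseteq> supported_part G W (generate G S)"
    by (rule generate_subgroup_incl[OF S(2) supported_part_subgroup[OF W_carrier]])
  then show ?thesis using sub supported_part_subset[OF sub, of W] by (simp add: spanned_def subset_antisym)
qed

lemma spanned_join:
  assumes "spanned J" "spanned K"
  shows "spanned (generate G (J \<union> K))"
proof (rule spanned_generate)
  show c: "J \<union> K \<subseteq> carrier G" using assms spanned_subgroup subgroup.subset by blast
  have sub: "subgroup (generate G (J \<union> K)) G" using generate_is_subgroup[OF c] .
  have "J \<subseteq> generate G (J \<union> K)" "K \<subseteq> generate G (J \<union> K)" by (auto intro: generate.incl)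
  then show "J \<union> K \<subseteq> supported_part G W (generate G (J \<union> K))"
    using spanned_supported_part_subset_iff[OF assms(1) sub] spanned_supported_part_subset_iff[OF assms(2) sub]
    by blast
qed

lemma spanned_add_pair:
  assumes "spanned M" "u \<in> W" "v \<in> W"
  shows "spanned (generate G (M \<union> {inv u \<otimes> v}))"
proof (rule spanned_generate)
  show c: "M \<union> {inv u \<otimes> v} \<subseteq> carrier G"
    using assms spanned_subgroup subgroup.subset W_closed by blast
  have sub: "subgroup (generate G (M \<union> {inv u \<otimes> v})) G" using generate_is_subgroup[OF c] .
  have "M \<subseteq> generate G (M \<union> {inv u \<otimes> v})" "inv u \<otimes> v \<in> generate G (M \<union> {inv u \<otimes> v})"
    by (auto intro: generate.incl)
  then show "M \<union> {inv u \<otimes> v} \<subseteq> supported_part G W (generate G (M \<union> {inv u \<otimes> v}))"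
    using spanned_supported_part_subset_iff[OF assms(1) sub] supported_part_member[OF assms(2,3)] by blast
qed

lemma gen_dist_le:
  assumes "finite S" "S \<subseteq> carrier G" "J = generate G (M \<union> S)"
  shows "gen_dist M J \<le> card S"
  unfolding gen_dist_def by (rule Least_le) (use assms in blast)

lemma gen_dist_witness:
  assumes M: "subgroup M G" and J: "J \<in> overgroups M"
  shows "\<exists>S. finite S \<and> card S \<le> gen_dist M J \<and> S \<subseteq> carrier G \<and> J = generate G (M \<union> S)"
proof -
  have sp: "spanned J" "M \<subseteq> J" using J by (auto simp: overgroups_def)
  obtain S where S: "finite S" "S \<subseteq> carrier G" "generate G S = J"
    using spanned_finite_generators[OF sp(1)] by blast
  have "generate G (M \<union> S) = J"
  proof (rule generateI[symmetric])
    show "subgroup J G" using spanned_subgroup[OF sp(1)] .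
    show "M \<union> S \<subseteq> J" using sp(2) S(3) by (auto intro: generate.incl)
    fix K assume "subgroup K G" "M \<union> S \<subseteq> K"
    then show "J \<subseteq> K" using generate_subgroup_incl[of S K] S(3) by blast
  qed
  then have "\<exists>k S. finite S \<and> card S \<le> k \<and> S \<subseteq> carrier G \<and> J = generate G (M \<union> S)"
    using S by blast
  then show ?thesis unfolding gen_dist_def by (rule LeastI_ex)
qed

lemma weighted_joins_overgroups:
  assumes M: "spanned M"
  shows "weighted_joins (overgroups M) (gen_dist M) M"
proof
  have subM: "subgroup M G" using spanned_subgroup[OF M] .
  show "finite (overgroups M)" by (rule finite_overgroups)
  show "M \<in> overgroups M" using M by (simp add: overgroups_def)
  have "M = generate G (M \<union> {})" using subM generate_incl generate_subgroup_incl[of M M]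
    by (auto intro: generate.incl)
  then show "gen_dist M M = 0" using gen_dist_le[of "{}" M M] by simp
  show "M \<subseteq> N" if "N \<in> overgroups M" for N using that by (simp add: overgroups_def)
  show "\<exists>K\<in>overgroups M. (\<forall>N\<in>overgroups M. K \<subseteq> N \<longleftrightarrow> J \<subseteq> N \<and> J' \<subseteq> N) \<and>
      gen_dist M K \<le> gen_dist M J + gen_dist M J'"
    if J: "J \<in> overgroups M" "J' \<in> overgroups M" for J J'
  proof (intro bexI conjI ballI)
    let ?K = "generate G (J \<union> J')"
    have JK: "J \<union> J' \<subseteq> ?K" by (auto intro: generate.incl)
    show "?K \<in> overgroups M"
      using J JK spanned_join by (auto simp: overgroups_def)
    show "?K \<subseteq> N \<longleftrightarrow> J \<subseteq> N \<and> J' \<subseteq> N" if "N \<in> overgroups M" for N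
      using JK generate_subgroup_incl[OF _ overgroups_subgroup[OF that], of "J \<union> J'"] by blast
    obtain S where S: "finite S" "card S \<le> gen_dist M J" "S \<subseteq> carrier G" "J = generate G (M \<union> S)"
      using gen_dist_witness[OF subM J(1)] by blast
    obtain S' where S': "finite S'" "card S' \<le> gen_dist M J'" "S' \<subseteq> carrier G" "J' = generate G (M \<union> S')"
      using gen_dist_witness[OF subM J(2)] by blast
    have "?K = generate G (M \<union> (S \<union> S'))"
    proof (rule generateI[symmetric])
      show "subgroup (generate G (M \<union> (S \<union> S'))) G"
        using S(3) S'(3) subgroup.subset[OF subM] by (intro generate_is_subgroup) blast
      show "J \<union> J' \<subseteq> generate G (M \<union> (S \<union> S'))"
        unfolding S(4) S'(4) by (intro Un_least mono_generate) auto
      fix K assume K: "subgroup K G" "J \<union> J' \<subseteq> K"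
      have "M \<union> S \<subseteq> J" "M \<union> S' \<subseteq> J'" using S(4) S'(4) by (auto intro: generate.incl)
      then show "generate G (M \<union> (S \<union> S')) \<subseteq> K" using K by (intro generate_subgroup_incl) auto
    qed
    then have "gen_dist M ?K \<le> card (S \<union> S')" using S S' by (intro gen_dist_le) auto
    also have "\<dots> \<le> gen_dist M J + gen_dist M J'" using card_Un_le[of S S'] S(2) S'(2) by linarith
    finally show "gen_dist M ?K \<le> gen_dist M J + gen_dist M J'" .
  qed
qed

abbreviation nat_rk :: "'a set \<Rightarrow> nat" where
  "nat_rk J \<equiv> the_enat (rk G J)"

lemma rk_nat_rk: "spanned J \<Longrightarrow> rk G J = enat (nat_rk J)"
  using spanned_rk_finite[of J] by auto

lemma pair_overgroup:
  assumes M: "spanned M" and uv: "u \<in> W" "v \<in> W"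
  shows "\<exists>J\<in>overgroups M. gen_dist M J \<le> 1 \<and> (\<forall>N\<in>overgroups M. inv u \<otimes> v \<in> N \<longleftrightarrow> J \<subseteq> N)"
proof (intro bexI conjI ballI)
  let ?J = "generate G (M \<union> {inv u \<otimes> v})"
  show "?J \<in> overgroups M" using spanned_add_pair[OF M uv] by (auto simp: overgroups_def intro: generate.incl)
  have "gen_dist M ?J \<le> card {inv u \<otimes> v}" by (rule gen_dist_le) (use uv W_closed in auto)
  then show "gen_dist M ?J \<le> 1" by simp
  fix N assume N: "N \<in> overgroups M"
  then have "M \<subseteq> N" by (simp add: overgroups_def)
  moreover have "inv u \<otimes> v \<in> ?J" by (auto intro: generate.incl)
  ultimately show "inv u \<otimes> v \<in> N \<longleftrightarrow> ?J \<subseteq> N"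
    using generate_subgroup_incl[OF _ overgroups_subgroup[OF N], of "M \<union> {inv u \<otimes> v}"] by blast
qed

text \<open>The counting formula for coverings of shape \<open>M\<close> depends on \<open>N\<close> through the numbers of cosets of \<open>M\<close>, or of
  edges, that become equal in \<open>N\<close>. Each such coincidence is the indicator of a group generated by \<open>M\<close>
  and one element. The power of \<open>n\<close> in front is given by the Euler characteristic. For \<open>N = M\<close> there
  are no coincidences, which determines the leading coefficient.\<close>

lemma shape_expansion:
  assumes M: "spanned M"
  shows "\<exists>c. (\<forall>J\<in>overgroups M. c J \<in> O(\<lambda>n. 1 / real n ^ gen_dist M J)) \<and>
    (\<forall>\<^sub>F n in sequentially. c M n = 1) \<and>
    (\<forall>\<^sub>F n in sequentially. \<forall>N\<in>overgroups M.
       real (card {a \<in> connections N n. shape N n a = M}) / fact n ^ card (edges N) =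
       (\<Sum>J\<in>{J\<in>overgroups M. J \<subseteq> N}. c J n / real n ^ nat_rk M))"
proof -
  interpret weighted_joins "overgroups M" "gen_dist M" M by (rule weighted_joins_overgroups[OF M])
  have subM: "subgroup M G" using spanned_subgroup[OF M] .
  obtain vs where vs: "vertex_reps M vs" "length vs + 1 = card (verts M)" using vertex_reps_exist[OF subM] by blast
  obtain es where es: "edge_reps M es" "length es = card (edges M)" using edge_reps_exist[OF subM] by blast
  have len: "length es = nat_rk M + length vs"
    using rk_spanned[OF M] rk_nat_rk[OF M] vs(2) es(2) by (metis enat.inject plus_enat_simps(1) add.assoc add_right_cancel)
  let ?V = "\<lambda>N n. crossing (\<lambda>u v. inv u \<otimes> v \<in> N) n (vs @ [\<one>])"
  let ?E = "\<lambda>N n. crossing (\<lambda>(x, u) (y, v). x = y \<and> inv u \<otimes> v \<in> N) n es"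
  let ?\<phi> = "\<lambda>n N. (?V N n / real n ^ length (vs @ [\<one>])) * (real n ^ length es / ?E N n)"
  have vsW: "u \<in> W" if "u \<in> set (vs @ [\<one>])" for u using vs(1) one_W that by (auto simp: vertex_reps_def)
  have esW: "u \<in> W" if "(x, u) \<in> set es" for x u
    using es(1) that window_edgesD(2) by (auto simp: edge_reps_def)
  have "expansion (overgroups M) (gen_dist M) ?\<phi>"
  proof (rule expansion_mult)
    show "expansion (overgroups M) (gen_dist M) (\<lambda>n N. ?V N n / real n ^ length (vs @ [\<one>]))"
    proof (rule expansion_crossing(1))
      fix u v assume "u \<in> set (vs @ [\<one>])" "v \<in> set (vs @ [\<one>])"
      then show "(\<forall>N\<in>overgroups M. \<not> inv u \<otimes> v \<in> N) \<or>
        (\<exists>J\<in>overgroups M. gen_dist M J \<le> 1 \<and> (\<forall>N\<in>overgroups M. (inv u \<otimes> v \<in> N) = (J \<subseteq> N)))"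
        using pair_overgroup[OF M vsW vsW] by blast
    qed
    show "expansion (overgroups M) (gen_dist M) (\<lambda>n N. real n ^ length es / ?E N n)"
    proof (rule expansion_crossing(2))
      fix a b assume ab: "a \<in> set es" "b \<in> set es"
      obtain x u y v where xu: "a = (x, u)" "b = (y, v)" by (cases a; cases b)
      show "(\<forall>N\<in>overgroups M. \<not> (case a of (x, u) \<Rightarrow> \<lambda>(y, v). x = y \<and> inv u \<otimes> v \<in> N) b) \<or>
        (\<exists>J\<in>overgroups M. gen_dist M J \<le> 1 \<and>
          (\<forall>N\<in>overgroups M. (case a of (x, u) \<Rightarrow> \<lambda>(y, v). x = y \<and> inv u \<otimes> v \<in> N) b = (J \<subseteq> N)))"
        using pair_overgroup[OF M esW esW, of x u y v] ab unfolding xu by (cases "x = y") auto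
    qed
  qed
  then obtain c where c: "\<forall>J\<in>overgroups M. c J \<in> O(\<lambda>n. 1 / real n ^ gen_dist M J)"
    and c_eq: "\<forall>\<^sub>F n in sequentially. \<forall>N\<in>overgroups M. ?\<phi> n N = (\<Sum>J\<in>{J\<in>overgroups M. J \<subseteq> N}. c J n)"
    unfolding expansion_def by blast
  have M_in: "M \<in> overgroups M" using M by (simp add: overgroups_def)
  have large: "\<forall>\<^sub>F n in sequentially. n > length es \<and> n \<ge> (1::nat)"
    by (rule eventually_sequentiallyI[of "length es + 1"]) simp
  have "\<forall>\<^sub>F n in sequentially. c M n = 1"
    using c_eq large
  proof eventually_elim
    case (elim n)
    have "?V M n = real n ^ length (vs @ [\<one>])"
      by (rule crossing_discrete) (use vs(1) in \<open>auto simp: vertex_reps_def\<close>)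
    moreover have "?E M n = real n ^ length es"
      by (rule crossing_discrete) (use es(1) in \<open>auto simp: edge_reps_def\<close>)
    moreover have "{J\<in>overgroups M. J \<subseteq> M} = {M}" using M_in by (auto simp: overgroups_def)
    moreover have "?\<phi> n M = (\<Sum>J\<in>{J\<in>overgroups M. J \<subseteq> M}. c J n)" using elim(1) M_in by blast
    ultimately have "(real n ^ length (vs @ [\<one>]) / real n ^ length (vs @ [\<one>])) *
        (real n ^ length es / real n ^ length es) = c M n" by simp
    then show ?case using elim(2) by simp
  qed
  moreover have "\<forall>\<^sub>F n in sequentially. \<forall>N\<in>overgroups M.
       real (card {a \<in> connections N n. shape N n a = M}) / fact n ^ card (edges N) =
       (\<Sum>J\<in>{J\<in>overgroups M. J \<subseteq> N}. c J n / real n ^ nat_rk M)"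
    using c_eq large
  proof eventually_elim
    case (elim n)
    show ?case
    proof
      fix N assume N: "N \<in> overgroups M"
      then have MN: "M \<subseteq> N" by (simp add: overgroups_def)
      define k where "k = real (card {a \<in> connections N n. shape N n a = M})"
      have n: "n \<ge> 1" "real n > 0" using elim(2) by auto
      have E: "?E N n > 0" using elim(2) by (intro crossing_pos) auto
      have eq: "real n * k * ?E N n = fact n ^ card (edges N) * ?V N n"
        unfolding k_def by (rule card_shape[OF M overgroups_subgroup[OF N] MN n(1) vs(1) es(1)])
      have "k / fact n ^ card (edges N) = ?V N n / (real n * ?E N n)"
        using eq E n by (simp add: field_simps)
      also have "\<dots> = ?\<phi> n N / real n ^ nat_rk M"
        using E n len by (simp add: field_simps power_add)
      also have "?\<phi> n N = (\<Sum>J\<in>{J\<in>overgroups M. J \<subseteq> N}. c J n)" using elim(1) N by blast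
      finally show "real (card {a \<in> connections N n. shape N n a = M}) / fact n ^ card (edges N) =
        (\<Sum>J\<in>{J\<in>overgroups M. J \<subseteq> N}. c J n / real n ^ nat_rk M)"
        unfolding k_def by (simp add: sum_divide_distrib)
    qed
  qed
  ultimately show ?thesis using c by blast
qed

text \<open>Since \<open>H\<close> is spanned, it fixes the first sheet precisely if it is contained in the shape.\<close>

lemma fix_prob_eq_sum_shapes:
  assumes H: "spanned H" and N: "N \<in> overgroups H"
  shows "fix_prob G N H n = (\<Sum>M\<in>{M\<in>overgroups H. M \<subseteq> N}.
    real (card {a \<in> connections N n. shape N n a = M}) / fact n ^ card (edges N))"
proof -
  have sp: "spanned N" "H \<subseteq> N" "subgroup N G" using N by (auto simp: overgroups_def spanned_subgroup)
  let ?k = "fact n ^ (card (verts N) - 1) :: nat"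
  let ?A = "{a \<in> connections N n. H \<subseteq> stab N n a}"
  have "card (connections N n) = card (perm_homs G N n) * ?k"
    using card_connections_holonomy[OF sp(1), of n "\<lambda>_. True"] by simp
  moreover have "card (connections N n) = fact n ^ card (edges N)" using finite_edges by (simp add: card_PiE)
  ultimately have tot: "fact n ^ card (edges N) = card (perm_homs G N n) * ?k" by simp
  have "?A = {a \<in> connections N n. \<forall>h\<in>H. restrict (holonomy N n a) N h 1 = 1}"
    using sp(2) by (auto simp: stab_def)
  then have num: "card ?A = card {\<phi> \<in> perm_homs G N n. \<forall>h\<in>H. \<phi> h 1 = 1} * ?k"
    using card_connections_holonomy[OF sp(1), of n "\<lambda>\<phi>. \<forall>h\<in>H. \<phi> h 1 = 1"] by simp
  have tot': "(fact n :: real) ^ card (edges N) = real (card (perm_homs G N n)) * real ?k"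
    using arg_cong[OF tot, of real] by simp
  have "fix_prob G N H n = real (card ?A) / fact n ^ card (edges N)"
    unfolding fix_prob_def tot' num by simp
  also have "card ?A = (\<Sum>M\<in>{M\<in>overgroups H. M \<subseteq> N}. card {a \<in> connections N n. shape N n a = M})"
  proof -
    have fin: "finite (connections N n)" using finite_edges by (intro finite_PiE) auto
    have shape_iff: "H \<subseteq> stab N n a \<longleftrightarrow> shape N n a \<in> {M\<in>overgroups H. M \<subseteq> N}"
      if a: "a \<in> connections N n" for a
    proof -
      note st = stab_subgroup[OF sp(3) a]
      have "shape N n a \<subseteq> N" using supported_part_subset[OF st, of W] by (auto simp: shape_def stab_def)
      moreover have "spanned (shape N n a)" using spanned_supported_part[OF st] by (simp add: shape_def)
      ultimately show ?thesis
        using spanned_supported_part_subset_iff[OF H st] by (simp add: overgroups_def shape_def)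
    qed
    have "?A = (\<Union>M\<in>{M\<in>overgroups H. M \<subseteq> N}. {a \<in> connections N n. shape N n a = M})"
      using shape_iff by auto
    then show ?thesis
      using fin finite_overgroups by (simp only:) (rule card_UN_disjoint, auto)
  qed
  finally show ?thesis by (simp add: sum_divide_distrib)
qed

end

context cayley_window
begin

lemma gen_dist_rk:
  assumes M: "spanned M" and J: "J \<in> overgroups M"
  shows "nat_rk J \<le> nat_rk M + gen_dist M J"
    and "nat_rk J = nat_rk M + gen_dist M J \<Longrightarrow> free_factor G M J"
proof -
  have subM: "subgroup M G" using spanned_subgroup[OF M] .
  have spJ: "spanned J" using J by (simp add: overgroups_def)
  obtain S where S: "finite S" "card S \<le> gen_dist M J" "S \<subseteq> carrier G" "J = generate G (M \<union> S)"
    using gen_dist_witness[OF subM J] by blast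
  note rk = rk_generate_Un_le[OF subM rk_nat_rk[OF M] S(1,3), folded S(4)]
  have le: "nat_rk J \<le> nat_rk M + card S" using rk(1) by (cases "rk G J") auto
  then show "nat_rk J \<le> nat_rk M + gen_dist M J" using S(2) by simp
  assume "nat_rk J = nat_rk M + gen_dist M J"
  then have "nat_rk J = nat_rk M + card S" using le S(2) by linarith
  then have "rk G J = enat (nat_rk M + card S)" using rk_nat_rk[OF spJ] by (rule subst)
  then show "free_factor G M J" by (rule rk(2))
qed

text \<open>Summing the expansions of all shapes \<open>M\<close> at the subgroups \<open>J\<close> above them gives the coefficients.
  They do not depend on the ambient group \<open>N\<close>, so they can be found by taking for \<open>N\<close> a group in
  which \<open>H\<close> is a free factor.\<close>

lemma fix_prob_expansion:
  assumes H: "spanned H"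
  shows "\<exists>C. (\<forall>\<^sub>F n in sequentially. \<forall>N\<in>overgroups H.
       fix_prob G N H n = (\<Sum>J\<in>{J\<in>overgroups H. J \<subseteq> N}. C J n)) \<and>
    (\<forall>J\<in>overgroups H. C J \<in> O(\<lambda>n. 1 / real n ^ nat_rk J)) \<and>
    (\<forall>J\<in>overgroups H. (\<forall>M\<in>overgroups H. M \<subseteq> J \<longrightarrow> M \<noteq> J \<longrightarrow> \<not> free_factor G M J) \<longrightarrow>
       (\<lambda>n. C J n - 1 / real n ^ nat_rk J) \<in> O(\<lambda>n. 1 / real n ^ (nat_rk J + 1)))"
proof -
  let ?Q = "overgroups H"
  have spQ: "spanned M" if "M \<in> ?Q" for M using that by (simp add: overgroups_def)
  have up: "J \<in> overgroups M" if "J \<in> ?Q" "M \<subseteq> J" for J M using that by (simp add: overgroups_def)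
  have up': "J \<in> ?Q" if "J \<in> overgroups M" "M \<in> ?Q" for J M using that by (auto simp: overgroups_def)
  interpret weighted_joins ?Q "gen_dist H" H by (rule weighted_joins_overgroups[OF H])
  have "\<forall>M\<in>?Q. \<exists>c. (\<forall>J\<in>overgroups M. c J \<in> O(\<lambda>n. 1 / real n ^ gen_dist M J)) \<and>
    (\<forall>\<^sub>F n in sequentially. c M n = 1) \<and>
    (\<forall>\<^sub>F n in sequentially. \<forall>N\<in>overgroups M.
       real (card {a \<in> connections N n. shape N n a = M}) / fact n ^ card (edges N) =
       (\<Sum>J\<in>{J\<in>overgroups M. J \<subseteq> N}. c J n / real n ^ nat_rk M))"
    using shape_expansion[OF spQ] by blast
  from bchoice[OF this] obtain c where
    c0: "\<forall>M\<in>?Q. (\<forall>J\<in>overgroups M. c M J \<in> O(\<lambda>n. 1 / real n ^ gen_dist M J)) \<and>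
    (\<forall>\<^sub>F n in sequentially. c M M n = 1) \<and>
    (\<forall>\<^sub>F n in sequentially. \<forall>N\<in>overgroups M.
       real (card {a \<in> connections N n. shape N n a = M}) / fact n ^ card (edges N) =
       (\<Sum>J\<in>{J\<in>overgroups M. J \<subseteq> N}. c M J n / real n ^ nat_rk M))" ..
  have c_O: "c M J \<in> O(\<lambda>n. 1 / real n ^ gen_dist M J)" if "M \<in> ?Q" "J \<in> overgroups M" for M J
    using c0 that by blast
  have c_1: "\<forall>\<^sub>F n in sequentially. c M M n = 1" if "M \<in> ?Q" for M using c0 that by blast
  have c_sum: "\<forall>\<^sub>F n in sequentially. \<forall>M\<in>?Q. \<forall>N\<in>overgroups M.
       real (card {a \<in> connections N n. shape N n a = M}) / fact n ^ card (edges N) =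
       (\<Sum>J\<in>{J\<in>overgroups M. J \<subseteq> N}. c M J n / real n ^ nat_rk M)"
    by (rule eventually_ball_finite[OF finite_overgroups]) (use c0 in blast)
  define C where "C J n = (\<Sum>M\<in>{M\<in>?Q. M \<subseteq> J}. c M J n / real n ^ nat_rk M)" for J n
  have term_O: "(\<lambda>n. c M J n / real n ^ nat_rk M) \<in> O(\<lambda>n. 1 / real n ^ k)"
    if M: "M \<in> ?Q" and J: "J \<in> overgroups M" and k: "k \<le> nat_rk M + gen_dist M J" for M J k
  proof -
    have "(\<lambda>n. c M J n * (1 / real n ^ nat_rk M)) \<in> O(\<lambda>n. 1 / real n ^ gen_dist M J * (1 / real n ^ nat_rk M))"
      using c_O[OF M J] by (intro landau_o.big.mult) auto
    also have "(\<lambda>n. 1 / real n ^ gen_dist M J * (1 / real n ^ nat_rk M)) =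
      (\<lambda>n. 1 / real n ^ (nat_rk M + gen_dist M J))" by (simp add: power_add mult.commute)
    also have "(\<lambda>n. 1 / real n ^ (nat_rk M + gen_dist M J)) \<in> O(\<lambda>n. 1 / real n ^ k)"
      by (rule inverse_power_bigo_mono[OF k])
    finally show ?thesis by simp
  qed
  have "\<forall>\<^sub>F n in sequentially. \<forall>N\<in>?Q. fix_prob G N H n = (\<Sum>J\<in>{J\<in>?Q. J \<subseteq> N}. C J n)"
    using c_sum
  proof eventually_elim
    case (elim n)
    show ?case
    proof
      fix N assume N: "N \<in> ?Q"
      let ?D = "{J\<in>?Q. J \<subseteq> N}"
      have finD: "finite ?D" using finite_overgroups by simp
      have "fix_prob G N H n = (\<Sum>M\<in>?D. \<Sum>J\<in>{J\<in>overgroups M. J \<subseteq> N}. c M J n / real n ^ nat_rk M)"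
        unfolding fix_prob_eq_sum_shapes[OF H N] using elim N up by (intro sum.cong) auto
      also have "\<dots> = (\<Sum>M\<in>?D. \<Sum>J\<in>{J\<in>?D. M \<subseteq> J}. c M J n / real n ^ nat_rk M)"
        using up up' by (intro sum.cong refl arg_cong2[where f = sum]) (auto simp: overgroups_def)
      also have "\<dots> = (\<Sum>J\<in>?D. \<Sum>M\<in>{M\<in>?D. M \<subseteq> J}. c M J n / real n ^ nat_rk M)"
        by (rule sum.swap_restrict[OF finD finD])
      also have "\<dots> = (\<Sum>J\<in>?D. C J n)"
        unfolding C_def by (intro sum.cong refl arg_cong2[where f = sum]) auto
      finally show "fix_prob G N H n = (\<Sum>J\<in>?D. C J n)" .
    qed
  qed
  moreover have "C J \<in> O(\<lambda>n. 1 / real n ^ nat_rk J)" if J: "J \<in> ?Q" for J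
    unfolding C_def
  proof (rule big_sum_in_bigo)
    fix M assume M: "M \<in> {M\<in>?Q. M \<subseteq> J}"
    then have "J \<in> overgroups M" using up J by blast
    then show "(\<lambda>n. c M J n / real n ^ nat_rk M) \<in> O(\<lambda>n. 1 / real n ^ nat_rk J)"
      using M gen_dist_rk(1)[OF spQ] by (intro term_O) auto
  qed
  moreover have "(\<lambda>n. C J n - 1 / real n ^ nat_rk J) \<in> O(\<lambda>n. 1 / real n ^ (nat_rk J + 1))"
    if J: "J \<in> ?Q" and min: "\<forall>M\<in>?Q. M \<subseteq> J \<longrightarrow> M \<noteq> J \<longrightarrow> \<not> free_factor G M J" for J
  proof -
    let ?D = "{M\<in>?Q. M \<subseteq> J} - {J}"
    have ev: "\<forall>\<^sub>F n in sequentially. C J n - 1 / real n ^ nat_rk J = (\<Sum>M\<in>?D. c M J n / real n ^ nat_rk M)"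
      using c_1[OF J]
    proof eventually_elim
      case (elim n)
      have "C J n = c J J n / real n ^ nat_rk J + (\<Sum>M\<in>?D. c M J n / real n ^ nat_rk M)"
        unfolding C_def using J finite_overgroups by (subst sum.remove[of _ J]) auto
      then show ?case using elim by simp
    qed
    have "(\<lambda>n. \<Sum>M\<in>?D. c M J n / real n ^ nat_rk M) \<in> O(\<lambda>n. 1 / real n ^ (nat_rk J + 1))"
    proof (rule big_sum_in_bigo)
      fix M assume M: "M \<in> ?D"
      then have JM: "J \<in> overgroups M" using up J by blast
      have "\<not> free_factor G M J" using min M by blast
      then have "nat_rk J + 1 \<le> nat_rk M + gen_dist M J"
        using gen_dist_rk[OF spQ JM] M by (metis Diff_iff Suc_eq_plus1 Suc_leI le_neq_implies_less mem_Collect_eq)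
      then show "(\<lambda>n. c M J n / real n ^ nat_rk M) \<in> O(\<lambda>n. 1 / real n ^ (nat_rk J + 1))"
        using M JM by (intro term_O) auto
    qed
    then show ?thesis unfolding landau_o.big.in_cong[OF ev] .
  qed
  ultimately show ?thesis by (intro exI[of _ C] conjI ballI impI)
qed

lemma nonfactor_rk_ge:
  assumes "primitivity_rank G H = enat p" "J \<in> nonfactor_overgroups G H"
  shows "enat p \<le> rk G J"
  using assms INF_lower[of J "nonfactor_overgroups G H" "rk G"] by (simp add: primitivity_rank_def)

text \<open>The part of a critical subgroup that is supported in the window is a free factor of it, hence
  also critical, hence all of it.\<close>

lemma Crit_spanned:
  assumes H: "spanned H" and p: "primitivity_rank G H = enat p" and J: "J \<in> Crit G H"
  shows "J \<in> overgroups H"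
proof -
  have Jn: "J \<in> nonfactor_overgroups G H" and rkJ: "rk G J = enat p" using J p by (auto simp: Crit_def)
  then have sub: "subgroup J G" and HJ: "H \<subseteq> J" and nff: "\<not> free_factor G H J"
    by (auto simp: nonfactor_overgroups_def)
  let ?K = "supported_part G W J"
  have ffK: "free_factor G ?K J" by (rule supported_part_free_factor[OF sub W_carrier W_connected])
  have subK: "subgroup ?K G" by (rule supported_part_subgroup[OF W_carrier])
  have HK: "H \<subseteq> ?K" using spanned_supported_part_subset_iff[OF H sub] HJ by simp
  have "\<not> free_factor G H ?K" using free_factor_trans[OF _ ffK sub] nff by blast
  then have "?K \<in> nonfactor_overgroups G H" using subK HK by (simp add: nonfactor_overgroups_def)
  then have "enat p \<le> rk G ?K" by (rule nonfactor_rk_ge[OF p])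
  moreover have "rk G ?K \<le> enat p" using free_factor_rk_le[OF ffK sub] rkJ by simp
  ultimately have "rk G ?K = rk G J" using rkJ by simp
  then have "?K = J" by (rule free_factor_rk_eq[OF ffK sub]) (simp add: rkJ)
  then show ?thesis using spanned_supported_part[OF sub] HJ by (simp add: overgroups_def)
qed

text \<open>A proper free factor \<open>M\<close> of a critical subgroup has smaller rank, so \<open>H\<close> would be a free factor of \<open>M\<close> by
  minimality, and by transitivity of the critical subgroup.\<close>

lemma Crit_minimal:
  assumes p: "primitivity_rank G H = enat p" and J: "J \<in> Crit G H"
    and M: "M \<in> overgroups H" "M \<noteq> J"
  shows "\<not> free_factor G M J"
proof
  assume ff: "free_factor G M J"
  have rkJ: "rk G J = enat p" using J p by (auto simp: Crit_def)
  have sub: "subgroup J G" and nff: "\<not> free_factor G H J"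
    using J by (auto simp: Crit_def nonfactor_overgroups_def)
  have "\<not> free_factor G H M" using free_factor_trans[OF _ ff sub] nff by blast
  then have "M \<in> nonfactor_overgroups G H"
    using M overgroups_subgroup[OF M(1)] by (simp add: nonfactor_overgroups_def overgroups_def)
  then have "enat p \<le> rk G M" by (rule nonfactor_rk_ge[OF p])
  then have "rk G M = rk G J" using free_factor_rk_le[OF ff sub] rkJ by simp
  then have "M = J" by (rule free_factor_rk_eq[OF ff sub]) (simp add: rkJ)
  then show False using M(2) by simp
qed

text \<open>Induction over the subgroups \<open>J\<close> that have \<open>H\<close> as a free factor shows that only \<open>J = H\<close> contributes among
  them, because the probability for \<open>J\<close> is known exactly and \<open>H\<close> is a free factor of every group between
  \<open>H\<close> and \<open>J\<close>. The remaining subgroups are critical or have larger rank.\<close>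

theorem fix_prob_asymptotics:
  assumes H: "spanned H" and G: "spanned (carrier G)" and p: "primitivity_rank G H = enat p"
  shows "finite (Crit G H)"
    and "(\<lambda>n. fix_prob G (carrier G) H n - (1 / real n ^ nat_rk H + real (card (Crit G H)) / real n ^ p))
      \<in> O(\<lambda>n. 1 / real n ^ (p + 1))"
proof -
  let ?Q = "overgroups H"
  have CQ: "Crit G H \<subseteq> ?Q" using Crit_spanned[OF H p] by blast
  show finC: "finite (Crit G H)" using finite_subset[OF CQ finite_overgroups] .
  obtain C where C_sum: "\<forall>\<^sub>F n in sequentially. \<forall>N\<in>?Q. fix_prob G N H n = (\<Sum>J\<in>{J\<in>?Q. J \<subseteq> N}. C J n)"
    and C_O: "\<forall>J\<in>?Q. C J \<in> O(\<lambda>n. 1 / real n ^ nat_rk J)"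
    and C_min: "\<forall>J\<in>?Q. (\<forall>M\<in>?Q. M \<subseteq> J \<longrightarrow> M \<noteq> J \<longrightarrow> \<not> free_factor G M J) \<longrightarrow>
       (\<lambda>n. C J n - 1 / real n ^ nat_rk J) \<in> O(\<lambda>n. 1 / real n ^ (nat_rk J + 1))"
    using fix_prob_expansion[OF H] by blast
  interpret weighted_joins ?Q "gen_dist H" H by (rule weighted_joins_overgroups[OF H])
  have spQ: "spanned J" if "J \<in> ?Q" for J using that by (simp add: overgroups_def)
  have subH: "subgroup H G" using spanned_subgroup[OF H] .
  have HQ: "H \<in> ?Q" using H by (simp add: overgroups_def)
  have HJ: "H \<subseteq> J" if "J \<in> ?Q" for J using that by (simp add: overgroups_def)
  have ffH: "free_factor G H H" by (rule free_factor_refl[OF subH])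
  have large: "\<forall>\<^sub>F n in sequentially. n \<ge> (1::nat)" by (rule eventually_ge_at_top)
  have C_ff: "\<forall>\<^sub>F n in sequentially. C J n = (if J = H then 1 / real n ^ nat_rk H else 0)"
    if "J \<in> ?Q" "free_factor G H J" for J
    using that
  proof (induction "card {K\<in>?Q. K \<subseteq> J}" arbitrary: J rule: less_induct)
    case less
    let ?D = "{K\<in>?Q. K \<subseteq> J} - {J}"
    have finD: "finite ?D" using finite_overgroups by simp
    have IH: "\<forall>\<^sub>F n in sequentially. \<forall>K\<in>?D. C K n = (if K = H then 1 / real n ^ nat_rk H else 0)"
    proof (rule eventually_ball_finite[OF finD], intro ballI)
      fix K assume K: "K \<in> ?D"
      have "{K'\<in>?Q. K' \<subseteq> K} \<subset> {K\<in>?Q. K \<subseteq> J}" using K less.prems(1) by blast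
      then have "card {K'\<in>?Q. K' \<subseteq> K} < card {K\<in>?Q. K \<subseteq> J}"
        using finite_overgroups by (intro psubset_card_mono) auto
      moreover have "free_factor G H K"
        using free_factor_intermediate[OF less.prems(2) overgroups_subgroup[OF less.prems(1)]]
          overgroups_subgroup[of K H] HJ[of K] K by blast
      ultimately show "\<forall>\<^sub>F n in sequentially. C K n = (if K = H then 1 / real n ^ nat_rk H else 0)"
        using less.hyps K by blast
    qed
    show ?case
      using IH C_sum large
    proof eventually_elim
      case (elim n)
      have "fix_prob G J H n = 1 / real n ^ nat_rk H"
        by (rule fix_prob_free_factor[OF overgroups_subgroup[OF less.prems(1)]
            spanned_rk_finite[OF spQ[OF less.prems(1)]] less.prems(2) elim(3) rk_nat_rk[OF H]])
      moreover have "fix_prob G J H n = (\<Sum>K\<in>{K\<in>?Q. K \<subseteq> J}. C K n)" using elim(2) less.prems(1) by blast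
      moreover have "\<dots> = C J n + (\<Sum>K\<in>?D. C K n)"
        using less.prems(1) finite_overgroups by (subst sum.remove[of _ J]) auto
      moreover have "(\<Sum>K\<in>?D. C K n) = (\<Sum>K\<in>?D. if K = H then 1 / real n ^ nat_rk H else 0)"
        using elim(1) by (intro sum.cong) auto
      moreover have "\<dots> = (if H \<in> ?D then 1 / real n ^ nat_rk H else 0)"
        using finD by (subst sum.delta) auto
      moreover have "H \<in> ?D \<longleftrightarrow> J \<noteq> H" using HQ HJ[OF less.prems(1)] by blast
      ultimately show ?case by (cases "J = H") auto
    qed
  qed
  define D where "D J n = C J n - (if J = H then 1 / real n ^ nat_rk H else 0) -
    (if J \<in> Crit G H then 1 / real n ^ p else 0)" for J n
  have D_O: "D J \<in> O(\<lambda>n. 1 / real n ^ (p + 1))" if J: "J \<in> ?Q" for J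
  proof (cases "free_factor G H J")
    case True
    then have "J \<notin> Crit G H" by (auto simp: Crit_def nonfactor_overgroups_def)
    then have "\<forall>\<^sub>F n in sequentially. D J n = 0"
      using C_ff[OF J True] by (auto simp: D_def elim: eventually_mono)
    then show ?thesis using landau_o.big.in_cong[of "D J" "\<lambda>_. 0"] by simp
  next
    case False
    then have JH: "J \<noteq> H" using ffH by blast
    have Jn: "J \<in> nonfactor_overgroups G H"
      using False overgroups_subgroup[OF J] HJ[OF J] by (simp add: nonfactor_overgroups_def)
    note rkJ = rk_nat_rk[OF spQ[OF J]]
    show ?thesis
    proof (cases "J \<in> Crit G H")
      case True
      then have "rk G J = enat p" using p by (simp add: Crit_def)
      then have "nat_rk J = p" by simp
      moreover have "(\<lambda>n. C J n - 1 / real n ^ nat_rk J) \<in> O(\<lambda>n. 1 / real n ^ (nat_rk J + 1))"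
        using C_min J Crit_minimal[OF p True] by blast
      moreover have "D J = (\<lambda>n. C J n - 1 / real n ^ p)" using True JH by (simp add: D_def fun_eq_iff)
      ultimately show ?thesis by simp
    next
      case no: False
      have "enat p \<le> rk G J" by (rule nonfactor_rk_ge[OF p Jn])
      moreover have "rk G J \<noteq> enat p" using no Jn p by (simp add: Crit_def)
      ultimately have "p + 1 \<le> nat_rk J" using rkJ by (metis Suc_eq_plus1 Suc_leI enat_ord_simps(1) le_neq_implies_less)
      then have "(\<lambda>n. 1 / real n ^ nat_rk J) \<in> O(\<lambda>n. 1 / real n ^ (p + 1))" by (rule inverse_power_bigo_mono)
      then have "C J \<in> O(\<lambda>n. 1 / real n ^ (p + 1))" using C_O J landau_o.big_trans by blast
      moreover have "D J = C J" using no JH by (simp add: D_def fun_eq_iff)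
      ultimately show ?thesis by simp
    qed
  qed
  have GQ: "carrier G \<in> ?Q" using G subgroup.subset[OF subH] by (simp add: overgroups_def)
  have all: "{J\<in>?Q. J \<subseteq> carrier G} = ?Q" using overgroups_subgroup subgroup.subset by blast
  have ev: "\<forall>\<^sub>F n in sequentially. fix_prob G (carrier G) H n -
      (1 / real n ^ nat_rk H + real (card (Crit G H)) / real n ^ p) = (\<Sum>J\<in>?Q. D J n)"
    using C_sum
  proof eventually_elim
    case (elim n)
    have "(\<Sum>J\<in>?Q. if J = H then 1 / real n ^ nat_rk H else 0) = 1 / real n ^ nat_rk H"
      using finite_overgroups HQ by (subst sum.delta) auto
    moreover have "(\<Sum>J\<in>?Q. if J \<in> Crit G H then 1 / real n ^ p else 0) = real (card (Crit G H)) / real n ^ p"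
      using finite_overgroups CQ by (simp add: sum.If_cases Int_absorb1 Int_absorb2)
    moreover have "fix_prob G (carrier G) H n = (\<Sum>J\<in>?Q. C J n)" using elim GQ all by force
    ultimately show ?case by (simp add: D_def sum_subtractf)
  qed
  have "(\<lambda>n. \<Sum>J\<in>?Q. D J n) \<in> O(\<lambda>n. 1 / real n ^ (p + 1))"
    using D_O by (intro big_sum_in_bigo) auto
  then show "(\<lambda>n. fix_prob G (carrier G) H n - (1 / real n ^ nat_rk H + real (card (Crit G H)) / real n ^ p))
      \<in> O(\<lambda>n. 1 / real n ^ (p + 1))" unfolding landau_o.big.in_cong[OF ev] .
qed

end

context free_group_with_basis
begin

lemma connected_set_through_word:
  "fst ` set ls \<subseteq> X \<Longrightarrow> \<exists>T. finite T \<and> T \<subseteq> carrier G \<and> cayley_connected G (X \<times> UNIV) T \<and> word_value G ls \<in> T"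
proof (induction ls)
  case Nil
  have "cayley_connected G (X \<times> UNIV) {\<one>}" by (rule cayley_connectedI) auto
  then show ?case by (intro exI[of _ "{\<one>}"]) simp
next
  case (Cons l ls)
  then obtain T where T: "finite T" "T \<subseteq> carrier G" "cayley_connected G (X \<times> UNIV) T" "word_value G ls \<in> T"
    by auto
  let ?u = "word_value G ls" and ?v = "word_value G (l # ls)"
  have c: "fst l \<in> X" "fst l \<in> carrier G" "?u \<in> carrier G" using Cons.prems X_carrier T by auto
  have v: "?v \<in> carrier G" using c by (simp add: letter_value_closed)
  have "cayley_connected G (X \<times> UNIV) (insert ?v T)"
  proof (cases "snd l")
    case True
    then show ?thesis
      using T(4) c by (intro cayley_connected_insert[OF T(3), of "fst l" ?u]) (auto simp: letter_value_def)
  next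
    case False
    then show ?thesis
      using T(4) c by (intro cayley_connected_insert[OF T(3), of "fst l" ?v]) (auto simp: letter_value_def)
  qed
  then show ?case using T v by (intro exI[of _ "insert ?v T"]) blast
qed

text \<open>The window is a union of paths from \<open>\<one>\<close> to finitely many prescribed elements.\<close>

lemma exists_window:
  assumes X: "finite X" and S: "finite S" "S \<subseteq> carrier G"
  shows "\<exists>W. cayley_window G X W \<and> S \<subseteq> W"
proof -
  have "\<forall>s\<in>insert \<one> (S \<union> X). \<exists>T. finite T \<and> T \<subseteq> carrier G \<and> cayley_connected G (X \<times> UNIV) T \<and> s \<in> T"
  proof
    fix s assume "s \<in> insert \<one> (S \<union> X)"
    then have "s \<in> carrier G" using S(2) X_carrier by blast
    then have "s \<in> generate G X" using basis by (simp add: free_basis_def)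
    then obtain ls where "fst ` set ls \<subseteq> X" "word_value G ls = s"
      using generate_word[OF X_carrier] by blast
    then show "\<exists>T. finite T \<and> T \<subseteq> carrier G \<and> cayley_connected G (X \<times> UNIV) T \<and> s \<in> T"
      using connected_set_through_word by blast
  qed
  from bchoice[OF this] obtain T where T: "\<forall>s\<in>insert \<one> (S \<union> X). finite (T s) \<and> T s \<subseteq> carrier G \<and>
    cayley_connected G (X \<times> UNIV) (T s) \<and> s \<in> T s" ..
  let ?W = "\<Union>(T ` insert \<one> (S \<union> X))"
  have "cayley_connected G (X \<times> UNIV) ?W" by (rule cayley_connected_Union) (use T in auto)
  moreover have "S \<union> X \<subseteq> ?W" using T by blast
  moreover have "finite ?W" "?W \<subseteq> carrier G" using T X S(1) by auto
  ultimately show ?thesis by (intro exI[of _ ?W]) (auto intro!: cayley_window.intro cayley_window_axioms.intro free_group_with_basis_axioms)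
qed

end

lemma (in cayley_window) spanned_if_generators:
  assumes "S \<subseteq> W" "generate G S = H"
  shows "spanned H"
proof -
  have "spanned (generate G S)"
  proof (rule spanned_generate)
    show "S \<subseteq> carrier G" using assms(1) W_carrier by blast
    show "S \<subseteq> supported_part G W (generate G S)"
    proof
      fix s assume s: "s \<in> S"
      then have "s \<in> carrier G" "s \<in> W" "s \<in> generate G S"
        using assms(1) W_closed by (auto intro: generate.incl)
      then show "s \<in> supported_part G W (generate G S)" using supported_part_member[OF one_W, of s] by simp
    qed
  qed
  then show ?thesis using assms(2) by simp
qed

lemma random_hom_eq: "random_hom G n = pmf_of_set (perm_homs G (carrier G) n)"
  by (simp add: random_hom_def perm_homs_def)

text \<open>Conjugation with a transposition shows that every point is equally likely to be fixed.\<close>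

lemma (in group) card_fixing_point:
  assumes i: "i \<in> {1..n}" and H: "H \<subseteq> carrier G"
  shows "card {\<phi> \<in> perm_homs G (carrier G) n. \<forall>h\<in>H. \<phi> h i = i} =
    card {\<phi> \<in> perm_homs G (carrier G) n. \<forall>h\<in>H. \<phi> h 1 = 1}"
proof -
  define \<tau> where "\<tau> = Transposition.transpose 1 i"
  have \<tau>: "\<tau> \<in> perms n" using i by (simp add: \<tau>_def sym_group_carrier permutes_swap_id)
  have \<tau>\<tau>: "\<tau> (\<tau> y) = y" for y by (simp add: \<tau>_def)
  have \<tau>1: "\<tau> 1 = i" "\<tau> i = 1" by (simp_all add: \<tau>_def)
  define K where "K \<phi> = (\<lambda>u\<in>carrier G. \<tau> \<circ> \<phi> u \<circ> \<tau>)" for \<phi>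
  have K_in: "K \<phi> \<in> perm_homs G (carrier G) n" if \<phi>: "\<phi> \<in> perm_homs G (carrier G) n" for \<phi>
    unfolding perm_homs_iff
  proof (intro conjI ballI)
    fix u v assume uv: "u \<in> carrier G" "v \<in> carrier G"
    show "K \<phi> u \<in> perms n"
      using comp_perms[OF comp_perms[OF \<tau> perm_homs_perms[OF \<phi> uv(1)]] \<tau>] uv by (simp add: K_def)
    show "K \<phi> (u \<otimes> v) = K \<phi> u \<circ> K \<phi> v"
      using perm_homs_mult[OF \<phi> uv] uv \<tau>\<tau> by (auto simp: K_def fun_eq_iff)
  qed (simp add: K_def)
  have KK: "K (K \<phi>) = \<phi>" if \<phi>: "\<phi> \<in> perm_homs G (carrier G) n" for \<phi>
    using \<phi> by (intro extensionalityI[of _ "carrier G"]) (auto simp: K_def perm_homs_iff fun_eq_iff \<tau>\<tau>)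
  have "bij_betw K {\<phi> \<in> perm_homs G (carrier G) n. \<forall>h\<in>H. \<phi> h i = i}
    {\<phi> \<in> perm_homs G (carrier G) n. \<forall>h\<in>H. \<phi> h 1 = 1}"
  proof (rule bij_betw_byWitness[where f' = K])
    show "K ` {\<phi> \<in> perm_homs G (carrier G) n. \<forall>h\<in>H. \<phi> h i = i} \<subseteq>
        {\<phi> \<in> perm_homs G (carrier G) n. \<forall>h\<in>H. \<phi> h 1 = 1}"
    proof (intro image_subsetI CollectI conjI ballI)
      fix \<phi> h assume \<phi>: "\<phi> \<in> {\<phi> \<in> perm_homs G (carrier G) n. \<forall>h\<in>H. \<phi> h i = i}" and h: "h \<in> H"
      then show "K \<phi> h 1 = 1" using H \<tau>1 unfolding K_def by auto
    qed (use K_in in blast)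
    show "K ` {\<phi> \<in> perm_homs G (carrier G) n. \<forall>h\<in>H. \<phi> h 1 = 1} \<subseteq>
        {\<phi> \<in> perm_homs G (carrier G) n. \<forall>h\<in>H. \<phi> h i = i}"
    proof (intro image_subsetI CollectI conjI ballI)
      fix \<phi> h assume \<phi>: "\<phi> \<in> {\<phi> \<in> perm_homs G (carrier G) n. \<forall>h\<in>H. \<phi> h 1 = 1}" and h: "h \<in> H"
      then have "\<phi> h 1 = 1" "h \<in> carrier G" using H by auto
      then show "K \<phi> h i = i" using \<tau>1 unfolding K_def by simp
    qed (use K_in in blast)
  qed (use KK in auto)
  then show ?thesis by (rule bij_betw_same_card)
qed

context free_group_with_basis
begin

lemma finite_perm_homs:
  assumes "finite X"
  shows "finite (perm_homs G (carrier G) n)" "perm_homs G (carrier G) n \<noteq> {}"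
proof -
  show "finite (perm_homs G (carrier G) n)" using card_perm_homs(1)[OF basis assms] .
  have "card (perm_homs G (carrier G) n) > 0" using card_perm_homs(2)[OF basis assms] by simp
  then show "perm_homs G (carrier G) n \<noteq> {}" by auto
qed

lemma expected_common_fix_eq:
  assumes X: "finite X" and n: "n \<ge> 1" and H: "H \<subseteq> carrier G"
  shows "expected_common_fix G H n = real n * fix_prob G (carrier G) H n"
proof -
  let ?P = "perm_homs G (carrier G) n"
  note fin = finite_perm_homs[OF X, of n]
  have cnt: "real (num_common_fix n (\<phi> ` H)) = (\<Sum>i\<in>{1..n}. if \<forall>h\<in>H. \<phi> h i = i then 1 else 0)" for \<phi> :: "'a \<Rightarrow> nat \<Rightarrow> nat"
    by (simp add: num_common_fix_def sum.If_cases Int_def)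
  have "(\<Sum>\<phi>\<in>?P. real (num_common_fix n (\<phi> ` H))) =
      (\<Sum>i\<in>{1..n}. \<Sum>\<phi>\<in>?P. if \<forall>h\<in>H. \<phi> h i = i then 1 else 0)"
    unfolding cnt by (rule sum.swap)
  also have "\<dots> = (\<Sum>i\<in>{1..n}. real (card {\<phi> \<in> ?P. \<forall>h\<in>H. \<phi> h i = i}))"
    using fin(1) by (simp add: sum.If_cases Int_def)
  also have "\<dots> = (\<Sum>i\<in>{1..n}. real (card {\<phi> \<in> ?P. \<forall>h\<in>H. \<phi> h 1 = 1}))"
    by (rule sum.cong[OF refl]) (simp only: card_fixing_point[OF _ H])
  also have "\<dots> = real n * real (card {\<phi> \<in> ?P. \<forall>h\<in>H. \<phi> h 1 = 1})" by simp
  finally show ?thesis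
    using integral_pmf_of_set[OF fin(2,1), of "\<lambda>\<phi>. real (num_common_fix n (\<phi> ` H))"]
    by (simp add: expected_common_fix_def random_hom_eq fix_prob_def)
qed

text \<open>If \<open>H\<close> were not a free factor of the whole group, its primitivity rank would be at most the rank of that
  group. Every intermediate subgroup, of infinite rank or not, inherits the free factor.\<close>

lemma nonfactor_overgroups_empty:
  assumes X: "finite X" and inf: "primitivity_rank G H = \<infinity>" and H: "subgroup H G"
  shows "free_factor G H (carrier G)" "nonfactor_overgroups G H = {}"
proof -
  show ff: "free_factor G H (carrier G)"
  proof (rule ccontr)
    assume "\<not> free_factor G H (carrier G)"
    then have "carrier G \<in> nonfactor_overgroups G H"
      using subgroup_self subgroup.subset[OF H] by (simp add: nonfactor_overgroups_def)
    then have "primitivity_rank G H \<le> rk G (carrier G)" unfolding primitivity_rank_def by (rule INF_lower)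
    then show False using inf rk_eq_card[OF basis] X by simp
  qed
  show "nonfactor_overgroups G H = {}"
    using free_factor_intermediate[OF ff subgroup_self] subgroup.subset
    by (auto simp: nonfactor_overgroups_def)
qed

lemma inverse_powi_minus_one:
  assumes "n \<ge> (1::nat)"
  shows "1 / real n powi (int r - 1) = real n * (1 / real n ^ r)"
  using assms by (simp add: power_int_diff)

theorem expected_common_fix_asymptotics:
  assumes X: "finite X" and H: "subgroup H G" and fg: "finitely_generated G H"
  shows "finite (Crit G H) \<and>
    (case primitivity_rank G H of
       enat p \<Rightarrow>
         (\<lambda>n. expected_common_fix G H n
               - (1 / real n powi reduced_rk G H
                  + real (card (Crit G H)) / real n powi (int p - 1)))
         \<in> O(\<lambda>n. 1 / real n powi (int p - 1 + 1))
     | \<infinity> \<Rightarrow> (\<forall>n\<ge>1. expected_common_fix G H n = 1 / real n powi reduced_rk G H))"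
proof -
  have Hc: "H \<subseteq> carrier G" using subgroup.subset[OF H] .
  obtain S where S: "finite S" "S \<subseteq> carrier G" "H = generate G S"
    using fg by (auto simp: finitely_generated_def)
  obtain W where "cayley_window G X W" and SW: "S \<subseteq> W" using exists_window[OF X S(1,2)] by blast
  then interpret cayley_window G X W by simp
  have spH: "spanned H" using spanned_if_generators[OF SW] S(3) by simp
  have spG: "spanned (carrier G)"
    using spanned_if_generators[OF X_W] basis by (simp add: free_basis_def)
  define r where "r = nat_rk H"
  have rk: "rk G H = enat r" using rk_nat_rk[OF spH] by (simp add: r_def)
  have red: "reduced_rk G H = int r - 1" by (simp add: reduced_rk_def r_def)
  show ?thesis
  proof (cases "primitivity_rank G H")
    case (enat p)
    have fin: "finite (Crit G H)" by (rule fix_prob_asymptotics(1)[OF spH spG enat])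
    let ?f = "\<lambda>n. fix_prob G (carrier G) H n - (1 / real n ^ r + real (card (Crit G H)) / real n ^ p)"
    have "?f \<in> O(\<lambda>n. 1 / real n ^ (p + 1))"
      using fix_prob_asymptotics(2)[OF spH spG enat] by (simp add: r_def)
    then have prod: "(\<lambda>n. real n * ?f n) \<in> O(\<lambda>n. real n * (1 / real n ^ (p + 1)))"
      by (intro landau_o.big.mult) auto
    have ev: "\<forall>\<^sub>F n in sequentially. real n * ?f n = expected_common_fix G H n
        - (1 / real n powi reduced_rk G H + real (card (Crit G H)) / real n powi (int p - 1))"
    proof (rule eventually_sequentiallyI[of 1])
      fix n :: nat assume n: "1 \<le> n"
      have "real (card (Crit G H)) / real n powi (int p - 1) = real (card (Crit G H)) * (1 / real n powi (int p - 1))"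
        by simp
      then show "real n * ?f n = expected_common_fix G H n
        - (1 / real n powi reduced_rk G H + real (card (Crit G H)) / real n powi (int p - 1))"
        unfolding expected_common_fix_eq[OF X n Hc] red inverse_powi_minus_one[OF n]
        by (simp add: algebra_simps)
    qed
    have ev': "\<forall>\<^sub>F n in sequentially. real n * (1 / real n ^ (p + 1)) = 1 / real n powi (int p - 1 + 1)"
      by (rule eventually_sequentiallyI[of 1]) simp
    show ?thesis
      using fin enat prod unfolding landau_o.big.in_cong[OF ev] landau_o.big.cong[OF ev'] by simp
  next
    case infinity
    note ff = nonfactor_overgroups_empty[OF X infinity H]
    have "expected_common_fix G H n = 1 / real n powi reduced_rk G H" if n: "n \<ge> 1" for n
      using expected_common_fix_eq[OF X n Hc] inverse_powi_minus_one[OF n]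
        fix_prob_free_factor[OF subgroup_self spanned_rk_finite[OF spG] ff(1) n rk]
      by (simp add: red)
    then show ?thesis using infinity ff(2) by (simp add: Crit_def)
  qed
qed

section \<open>Fixed points of a single word\<close>

text \<open>The subgroup is free of rank at most one, being generated by one element, and not trivial; a single
  generator of a group of rank one is a basis.\<close>

lemma cyclic_basis:
  assumes w: "w \<in> carrier G" "w \<noteq> \<one>"
  shows "free_basis G (generate G {w}) {w}"
proof -
  have sub: "subgroup (generate G {w}) G" using w by (intro generate_is_subgroup) auto
  obtain B where B: "free_basis G (generate G {w}) B" using subgroup_has_basis[OF sub] by blast
  have fin: "finite B" using basis_card_le_generators[OF B, of "{w}"] w by simp
  have "B \<noteq> {}"
  proof
    assume "B = {}"
    then have "generate G {w} = {\<one>}" using B generate_empty by (simp add: free_basis_def)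
    then show False using w generate.incl[of w "{w}" G] by auto
  qed
  then have "card {w} \<le> card B" using fin by (simp add: Suc_leI card_gt_0_iff)
  then show ?thesis using free_basis_if_card_le[OF B fin, of "{w}"] w by simp
qed

lemma primitive_in_iff_free_factor:
  assumes w: "w \<in> carrier G" "w \<noteq> \<one>" and J: "subgroup J G"
  shows "primitive_in G w J \<longleftrightarrow> free_factor G (generate G {w}) J"
proof
  assume "primitive_in G w J"
  then show "free_factor G (generate G {w}) J"
    unfolding primitive_in_def free_factor_iff[OF J] by blast
next
  assume "free_factor G (generate G {w}) J"
  then obtain K where K: "free_product_of G J (generate G {w}) K" by (auto simp: free_factor_def)
  then have "subgroup K G" by (simp add: free_product_of_def)
  then obtain C where "free_basis G K C" using subgroup_has_basis by blast
  then have "free_basis G J ({w} \<union> C)" by (rule free_basis_Un[OF K cyclic_basis[OF w]])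
  then show "primitive_in G w J" unfolding primitive_in_def by blast
qed

lemma expected_fix_eq_expected_common_fix:
  assumes X: "finite X" and w: "w \<in> carrier G"
  shows "expected_fix G w n = expected_common_fix G (generate G {w}) n"
proof -
  let ?P = "perm_homs G (carrier G) n"
  note fin = finite_perm_homs[OF X, of n]
  have "num_fix n (\<phi> w) = num_common_fix n (\<phi> ` generate G {w})" if \<phi>: "\<phi> \<in> ?P" for \<phi>
    using fixes_point_iff_generators[OF \<phi> subgroup_self, of "{w}"] w
    by (simp add: num_fix_def num_common_fix_def)
  then have "(\<Sum>\<phi>\<in>?P. real (num_fix n (\<phi> w))) = (\<Sum>\<phi>\<in>?P. real (num_common_fix n (\<phi> ` generate G {w})))"
    by (intro sum.cong) auto
  then show ?thesis
    using integral_pmf_of_set[OF fin(2,1), of "\<lambda>\<phi>. real (num_fix n (\<phi> w))"]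
      integral_pmf_of_set[OF fin(2,1), of "\<lambda>\<phi>. real (num_common_fix n (\<phi> ` generate G {w}))"]
    by (simp add: expected_fix_def expected_common_fix_def random_hom_eq)
qed

lemma expected_fix_one:
  assumes X: "finite X"
  shows "expected_fix G \<one> n = real n"
proof -
  let ?P = "perm_homs G (carrier G) n"
  note fin = finite_perm_homs[OF X, of n]
  have "num_fix n (\<phi> \<one>) = n" if \<phi>: "\<phi> \<in> ?P" for \<phi>
  proof -
    have "{i \<in> {1..n}. \<phi> \<one> i = i} = {1..n}" using perm_homs_one[OF \<phi> subgroup_self] by auto
    then show ?thesis by (simp add: num_fix_def)
  qed
  then have "(\<Sum>\<phi>\<in>?P. real (num_fix n (\<phi> \<one>))) = (\<Sum>\<phi>\<in>?P. real n)" by (intro sum.cong) auto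
  then show ?thesis
    using integral_pmf_of_set[OF fin(2,1), of "\<lambda>\<phi>. real (num_fix n (\<phi> \<one>))"] fin
    by (simp add: expected_fix_def random_hom_eq)
qed

text \<open>The trivial word is primitive in no subgroup, in contrast to the trivial subgroup, which is a free
  factor of every subgroup. It is therefore not covered by the result on subgroups.\<close>

lemma word_Crit_one:
  shows "word_primitivity_rank G \<one> = enat 0" "word_Crit G \<one> = {{\<one>}}"
proof -
  have "free_basis G {\<one>} {}" by (simp add: free_basis_def generate_empty)
  then have rk1: "rk G {\<one>} = enat 0" using rk_eq_card[of "{\<one>}" "{}"] by simp
  have all: "imprimitive_overgroups G \<one> = {J. subgroup J G}"
  proof (intro equalityI subsetI)
    fix J assume "J \<in> {J. subgroup J G}"
    then have "subgroup J G" "\<one> \<in> J" by (auto intro: subgroup.one_closed)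
    then show "J \<in> imprimitive_overgroups G \<one>"
      using free_basis_neq_one by (auto simp: imprimitive_overgroups_def primitive_in_def)
  qed (simp add: imprimitive_overgroups_def)
  have sub1: "{\<one>} \<in> imprimitive_overgroups G \<one>" unfolding all by (simp add: triv_subgroup)
  have "word_primitivity_rank G \<one> \<le> rk G {\<one>}" unfolding word_primitivity_rank_def by (rule INF_lower[OF sub1])
  then show rk0: "word_primitivity_rank G \<one> = enat 0" using rk1 by (simp add: zero_enat_def[symmetric])
  have "J = {\<one>}" if "subgroup J G" "rk G J = enat 0" for J
  proof -
    obtain B where "free_basis G J B" "finite B" "card B = 0" using rk_basis[OF \<open>subgroup J G\<close> \<open>rk G J = enat 0\<close>] .
    then show ?thesis using generate_empty by (simp add: free_basis_def)
  qed
  then have "word_Crit G \<one> \<subseteq> {{\<one>}}" unfolding word_Crit_def all rk0 by blast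
  moreover have "{\<one>} \<in> word_Crit G \<one>" unfolding word_Crit_def rk0 using sub1 rk1 by blast
  ultimately show "word_Crit G \<one> = {{\<one>}}" by blast
qed

theorem expected_fix_asymptotics:
  assumes X: "finite X" and w: "w \<in> carrier G"
  shows "finite (word_Crit G w) \<and>
    (case word_primitivity_rank G w of
       enat p \<Rightarrow>
         (\<lambda>n. expected_fix G w n
               - (1 + real (card (word_Crit G w)) / real n powi (int p - 1)))
         \<in> O(\<lambda>n. 1 / real n powi (int p - 1 + 1))
     | \<infinity> \<Rightarrow> (\<forall>n\<ge>1. expected_fix G w n = 1))"
proof (cases "w = \<one>")
  case True
  have "(\<lambda>n. real n - (1 + 1 / real n powi (-1))) \<in> O(\<lambda>n. 1 / real n powi 0)"
    by (rule bigoI[of _ 1]) (simp add: power_int_minus divide_inverse)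
  then show ?thesis unfolding True word_Crit_one expected_fix_one[OF X] by simp
next
  case False
  let ?H = "generate G {w}"
  have sub: "subgroup ?H G" using w by (intro generate_is_subgroup) auto
  have "finitely_generated G ?H" using w by (auto simp: finitely_generated_def)
  note asym = expected_common_fix_asymptotics[OF X sub this]
  have "rk G ?H = enat 1" using rk_eq_card[OF cyclic_basis[OF w False]] by simp
  then have red: "reduced_rk G ?H = 0" by (simp add: reduced_rk_def)
  have "?H \<subseteq> J \<longleftrightarrow> w \<in> J" if "subgroup J G" for J
    using generate_subgroup_incl[OF _ that, of "{w}"] generate.incl[of w "{w}" G] by blast
  then have over: "imprimitive_overgroups G w = nonfactor_overgroups G ?H"
    using primitive_in_iff_free_factor[OF w False]
    by (auto simp: imprimitive_overgroups_def nonfactor_overgroups_def)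
  then have rank: "word_primitivity_rank G w = primitivity_rank G ?H"
    by (simp add: word_primitivity_rank_def primitivity_rank_def)
  then have crit: "word_Crit G w = Crit G ?H" using over by (simp add: word_Crit_def Crit_def)
  have pow0: "1 / real n powi 0 = 1" for n by simp
  show ?thesis
    using asym unfolding rank crit expected_fix_eq_expected_common_fix[OF X w] red pow0 .
qed

end

theorem theorem1p8:
  fixes F :: "('a, 'b) monoid_scheme" and k :: nat
  assumes "k \<ge> 1" and "free_group_of_rank F k"
  shows
    "(\<forall>H. subgroup H F \<and> finitely_generated F H \<longrightarrow>
        finite (Crit F H) \<and>
        (case primitivity_rank F H of
           enat p \<Rightarrow>
             (\<lambda>n. expected_common_fix F H n
                   - (1 / real n powi reduced_rk F H
                      + real (card (Crit F H)) / real n powi (int p - 1)))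
             \<in> O(\<lambda>n. 1 / real n powi (int p - 1 + 1))
         | \<infinity> \<Rightarrow>
             (\<forall>n\<ge>1. expected_common_fix F H n = 1 / real n powi reduced_rk F H)))
     \<and>
     (\<forall>w\<in>carrier F.
        finite (word_Crit F w) \<and>
        (case word_primitivity_rank F w of
           enat p \<Rightarrow>
             (\<lambda>n. expected_fix F w n
                   - (1 + real (card (word_Crit F w)) / real n powi (int p - 1)))
             \<in> O(\<lambda>n. 1 / real n powi (int p - 1 + 1))
         | \<infinity> \<Rightarrow>
             (\<forall>n\<ge>1. expected_fix F w n = 1)))"
proof -
  obtain X where X: "free_basis F (carrier F) X" "finite X" and "group F"
    using assms(2) by (auto simp: free_group_of_rank_def)
  then interpret free_group_with_basis F X
    by (simp add: free_group_with_basis.intro free_group_with_basis_axioms.intro)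
  show ?thesis
    using expected_common_fix_asymptotics[OF X(2)] expected_fix_asymptotics[OF X(2)] by blast
qed

end
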